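(* Let $\alpha_{\mathbf P}\ge\alpha$ and let $\boldsymbol m_h^n\in\boldsymbol{\mathcal M}_h$ be given. Consider the preconditioned GMRES algorithm with the practical preconditioner $\widetilde{\mathbf P}_{\mathbf Q}[\boldsymbol m_h^n]$ for the solution of $\widetilde{\mathbf P}_{\mathbf Q}[\boldsymbol m_h^n]\mathbf A_{\mathbf Q}[\boldsymbol m_h^n]\mathbf x=\widetilde{\mathbf P}_{\mathbf Q}[\boldsymbol m_h^n]\mathbf b_{\mathbf Q}[\boldsymbol m_h^n]$ with initial guess $\widetilde{\mathbf x}^{(0)}\in\mathbb R^{2N}$. For $\ell\in\mathbb N_0$, let $\widetilde{\mathbf x}^{(\ell)}\in\mathbb R^{2N}$ denote the GMRES iterates with residuals $\widetilde{\mathbf r}^{(\ell)}:=\widetilde{\mathbf P}_{\mathbf Q}[\boldsymbol m_h^n]\mathbf b_{\mathbf Q}[\boldsymbol m_h^n]-\widetilde{\mathbf P}_{\mathbf Q}[\boldsymbol m_h^n]\mathbf A_{\mathbf Q}[\boldsymbol m_h^n]\widetilde{\mathbf x}^{(\ell)}$. Then: (i) There exists a constant $C>1$, which depends only on $C_{\rm mesh}$, such that for all $\ell\in\mathbb N_0$ $$|||\widetilde{\mathbf r}^{(\ell)}|||'_{\boldsymbol m_h^n}\le\bigg[1-C^{-1}\Big(\frac{\alpha}{\alpha_{\mathbf P}}\Big)^2\bigg(1+\frac1{\alpha_{\mathbf P}}+\frac{\|W_k(\lambda_h^n)-\alpha_{\mathbf P}\|_{L^\infty(\Omega)}}{\alpha_{\mathbf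 P}}\bigg)^{-2}\widetilde{\mathbb F}^{-1}\bigg]^{\ell/2}|||\widetilde{\mathbf r}^{(0)}|||'_{\boldsymbol m_h^n},\qquad(\ast)$$ where $$\widetilde{\mathbb F}:=1+\frac{\beta(k)k}{\alpha_{\mathbf P}h^2}\ge1.$$ (ii) If, additionally, $1+(\mathbf T_n\boldsymbol m_h^n(z))_3\ge\gamma>0$ for all nodes $z\in\mathcal N_h$, then the statement of (i), i.e. $(\ast)$ for all $\ell\in\mathbb N_0$ with a constant $C>1$ depending only on $C_{\rm mesh}$, holds with the ($h$-independent) factor $$\widetilde{\mathbb F}:=1+\frac{\beta(k)k}{\alpha_{\mathbf P}\gamma^4}\|\nabla\boldsymbol m_h^n\|_{L^\infty(\Omega)}^2\ge1.$$
   Context: Mesh and spaces: $\Omega\subset\mathbb R^3$ is a bounded Lipschitz domain, $\mathcal T_h$ a triangulation of $\Omega$ into tetrahedra which is $C_{\rm mesh}$-quasi-uniform with mesh-size $h>0$, i.e. $h\le|K|^{1/3}\le\operatorname{diam}(K)\le C_{\rm mesh}h$ for all $K\in\mathcal T_h$. $\mathcal S_h$ is the space of continuous functions on $\Omega$ that are affine on each element, $\mathcal N_h=\{z_1,\dots,z_N\}$ the set of nodes, $\varphi_j\in\mathcal S_h$ the hat functions, $\boldsymbol{\mathcal S}_h=(\mathcal S_h)^3$ with basis $\boldsymbol\phi_{3(j-1)+\ell}:=\varphi_j\mathbf e_\ell$ ($j=1,\dots,N$, $\ell=1,2,3$). $\boldsymbol{\mathcal M}_h:=\{\boldsymbol\varphi_h\in\boldsymbol{\mathcal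 S}_h:|\boldsymbol\varphi_h(z)|=1\ \forall z\in\mathcal N_h\}$. $\langle\cdot,\cdot\rangle_\Omega$ is the $L^2(\Omega)$-scalar product (also for vector- and matrix-valued functions); $L^\infty$-norms of vector/matrix-valued functions are taken with the pointwise Euclidean (Frobenius) norm. Data: $\alpha\in(0,1]$, $\ell_{\rm ex}>0$, $T>0$, time-step size $k=T/M$ with $M\in\mathbb N$, $t_n=kn$, $0\le n<M$; $\boldsymbol m_h^{n-1}\in\boldsymbol{\mathcal M}_h$. $\boldsymbol\pi:H^1(\Omega)^3\to L^2(\Omega)^3$ is a bounded operator, $\boldsymbol f\in C^1([0,T],L^2(\Omega)^3)$. $\beta:\mathbb R_{>0}\to\mathbb R_{>0}$ and the (bounded, measurable) functions $W_k:\mathbb R\to\mathbb R_{>0}$ satisfy $\lim_{k\to0}\|W_k-\alpha\|_{L^\infty(\mathbb R)}=0$, $\inf_{k>0}\inf_{s\in\mathbb R}W_k(s)\ge\alpha/2>0$, $\lim_{k\to0}\beta(k)k=0$. $\lambda_h^n:=-\ell_{\rm ex}^2|\nabla\boldsymbol m_h^n|^2+(\boldsymbol f(t_n)+\boldsymbol\pi(\boldsymbol m_h^n))\cdot\boldsymbol m_h^n$. $\boldsymbol L_h(\boldsymbol m_h^n,\boldsymbol m_h^{n-1})\in L^2(\Omega)^3$ is a given function. Matrices (in $\mathbb R^{3N\times3N}$): $\mathbf M_{ij}:=\langle\boldsymbol\phi_i,\boldsymbol\phi_j\rangle_\Omega$, $\mathbf M_k[\boldsymbol m_h^n]_{ij}:=\langle(W_k(\lambda_h^n)/\alpha)\boldsymbol\phi_i,\boldsymbol\phi_j\rangle_\Omega$,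 $\mathbf L_{ij}:=\langle\nabla\boldsymbol\phi_i,\nabla\boldsymbol\phi_j\rangle_\Omega$, $\mathbf S[\boldsymbol m_h^n]_{ij}:=\langle\boldsymbol m_h^n\times\boldsymbol\phi_i,\boldsymbol\phi_j\rangle_\Omega$, $\mathbf A_k[\boldsymbol m_h^n]:=\alpha\mathbf M_k[\boldsymbol m_h^n]+\beta(k)k\,\mathbf L-\mathbf S[\boldsymbol m_h^n]$; and $\mathbf b[\boldsymbol m_h^n]_j:=-\ell_{\rm ex}^2\langle\nabla\boldsymbol m_h^n,\nabla\boldsymbol\phi_j\rangle_\Omega+\langle\boldsymbol L_h(\boldsymbol m_h^n,\boldsymbol m_h^{n-1}),\boldsymbol\phi_j\rangle_\Omega$. Householder matrices: for $\mathbf m\in\mathbb R^3$ with $|\mathbf m|=1$, $\widetilde{\mathbf H}[\mathbf m]:=\mathbf I-2\mathbf w\mathbf w^T$ with $\mathbf w:=(\mathbf m+\mathbf e_3)/|\mathbf m+\mathbf e_3|$ if $\mathbf m\ne-\mathbf e_3$, and $\widetilde{\mathbf H}[-\mathbf e_3]:=[\mathbf e_1,\mathbf e_2,-\mathbf e_3]$; $\mathbf H[\mathbf m]:=[\widetilde{\mathbf H}[\mathbf m]\mathbf e_1,\widetilde{\mathbf H}[\mathbf m]\mathbf e_2]\in\mathbb R^{3\times2}$. $\mathbf T_n\in\mathbb R^{3\times3}$ is a fixed matrix with $\mathbf T_n=\mathbf T_n^{-1}=\mathbf T_n^T$. $\mathbf Q[\boldsymbol m_h^n]\in\mathbb R^{3N\times2N}$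 is block-diagonal with $i$-th diagonal block $\mathbf T_n\mathbf H[\mathbf T_n\boldsymbol m_h^n(z_i)]$. System and preconditioner: $\mathbf A_{\mathbf Q}[\boldsymbol m_h^n]:=\mathbf Q[\boldsymbol m_h^n]^T\mathbf A_k[\boldsymbol m_h^n]\mathbf Q[\boldsymbol m_h^n]$, $\mathbf b_{\mathbf Q}[\boldsymbol m_h^n]:=\mathbf Q[\boldsymbol m_h^n]^T\mathbf b[\boldsymbol m_h^n]$. With a parameter $\alpha_{\mathbf P}>0$, $\widetilde{\mathbf P}_{\mathbf Q}[\boldsymbol m_h^n]:=\mathbf Q[\boldsymbol m_h^n]^T(\alpha_{\mathbf P}\mathbf M+\beta(k)k\,\mathbf L)^{-1}\mathbf Q[\boldsymbol m_h^n]\in\mathbb R^{2N\times2N}$ and $(|||\mathbf x|||'_{\boldsymbol m_h^n})^2:=\mathbf x\cdot(\widetilde{\mathbf P}_{\mathbf Q}[\boldsymbol m_h^n])^{-1}\mathbf x$ for $\mathbf x\in\mathbb R^{2N}$. GMRES with symmetric positive definite preconditioner $\mathbf P$ for $\mathbf P\mathbf A\mathbf x=\mathbf P\mathbf b$ is understood with respect to the scalar product $\mathbf x\cdot\mathbf P^{-1}\mathbf y$: the iterate $\mathbf x^{(\ell)}$ minimizes $\mathbf x\mapsto|||\mathbf P\mathbf b-\mathbf P\mathbf A\mathbf x|||$, $|||\mathbf y|||^2=\mathbf y\cdot\mathbf P^{-1}\mathbf y$, over $\mathbf x^{(0)}+\operatorname{span}\{(\mathbf P\mathbf A)^j\mathbf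 r^{(0)}:0\le j\le\ell-1\}$, where $\mathbf r^{(0)}=\mathbf P\mathbf b-\mathbf P\mathbf A\mathbf x^{(0)}$. *)

theory Defs
  imports
    "HOL-Analysis.Analysis"
    "HOL-Probability.Essential_Supremum"
    "Jordan_Normal_Form.Matrix"
    "Jordan_Normal_Form.Gauss_Jordan_Elimination"
    "Jordan_Normal_Form.VS_Connect"
begin

no_notation vec_index (infixl "$" 100)
no_notation scalar_prod (infix "\<bullet>" 70)

text \<open>Elements of Lebesgue spaces are represented by functions on the whole space; only their
  restriction to \<open>\<Omega>\<close>, up to null sets, matters.\<close>

definition L2 :: "(real^3) set \<Rightarrow> (real^3 \<Rightarrow> 'a::euclidean_space) set" where
  "L2 \<Omega> = {u. u \<in> borel_measurable (lebesgue_on \<Omega>) \<and>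
               integrable (lebesgue_on \<Omega>) (\<lambda>x. (norm (u x))\<^sup>2)}"

definition L2_inner :: "(real^3) set \<Rightarrow> (real^3 \<Rightarrow> 'a::euclidean_space) \<Rightarrow> (real^3 \<Rightarrow> 'a) \<Rightarrow> real" where
  "L2_inner \<Omega> u v = integral\<^sup>L (lebesgue_on \<Omega>) (\<lambda>x. u x \<bullet> v x)"

definition L2_norm :: "(real^3) set \<Rightarrow> (real^3 \<Rightarrow> 'a::euclidean_space) \<Rightarrow> real" where
  "L2_norm \<Omega> u = sqrt (L2_inner \<Omega> u u)"

text \<open>For matrix-valued functions \<open>norm\<close> is the Frobenius norm. The conversion to \<open>real\<close> is
  meaningful for essentially bounded functions only.\<close>

definition Linf_norm :: "(real^3) set \<Rightarrow> (real^3 \<Rightarrow> 'a::euclidean_space) \<Rightarrow> real" where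
  "Linf_norm \<Omega> u = real_of_ereal (esssup (lebesgue_on \<Omega>) (\<lambda>x. ereal (norm (u x))))"

definition Linf_norm_real :: "(real \<Rightarrow> real) \<Rightarrow> real" where
  "Linf_norm_real g = real_of_ereal (esssup lebesgue (\<lambda>s. ereal \<bar>g s\<bar>))"

text \<open>\<open>C_diff r\<close> means r times continuously differentiable on the whole space.\<close>

fun C_diff :: "nat \<Rightarrow> (real^3 \<Rightarrow> real) \<Rightarrow> bool" where
  "C_diff 0 \<psi> \<longleftrightarrow> continuous_on UNIV \<psi>"
| "C_diff (Suc r) \<psi> \<longleftrightarrow> (\<forall>x. \<psi> differentiable (at x)) \<and>
     (\<forall>i. C_diff r (\<lambda>x. frechet_derivative \<psi> (at x) (axis i 1)))"

definition test_function :: "(real^3) set \<Rightarrow> (real^3 \<Rightarrow> real) \<Rightarrow> bool" where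
  "test_function \<Omega> \<psi> \<longleftrightarrow> (\<forall>r. C_diff r \<psi>) \<and>
     compact (closure {x. \<psi> x \<noteq> 0}) \<and> closure {x. \<psi> x \<noteq> 0} \<subseteq> \<Omega>"

text \<open>Column \<open>i\<close> of \<open>G x\<close> is the weak partial derivative of \<open>u\<close> in direction \<open>i\<close>.\<close>

definition weak_gradient :: "(real^3) set \<Rightarrow> (real^3 \<Rightarrow> real^3) \<Rightarrow> (real^3 \<Rightarrow> real^3^3) \<Rightarrow> bool" where
  "weak_gradient \<Omega> u G \<longleftrightarrow> u \<in> L2 \<Omega> \<and> G \<in> L2 \<Omega> \<and>
     (\<forall>\<psi>. test_function \<Omega> \<psi> \<longrightarrow> (\<forall>i.
        integral\<^sup>L (lebesgue_on \<Omega>) (\<lambda>x. frechet_derivative \<psi> (at x) (axis i 1) *\<^sub>R u x) =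
        - integral\<^sup>L (lebesgue_on \<Omega>) (\<lambda>x. \<psi> x *\<^sub>R column i (G x))))"

definition H1 :: "(real^3) set \<Rightarrow> (real^3 \<Rightarrow> real^3) set" where
  "H1 \<Omega> = {u. \<exists>G. weak_gradient \<Omega> u G}"

text \<open>Bounded linear operators from \<open>H1\<close> to \<open>L2\<close>. Linearity and boundedness imply that functions
  in \<open>H1\<close> that agree almost everywhere are mapped to functions that agree almost everywhere.\<close>

definition bounded_operator_H1_L2 ::
  "(real^3) set \<Rightarrow> ((real^3 \<Rightarrow> real^3) \<Rightarrow> (real^3 \<Rightarrow> real^3)) \<Rightarrow> bool" where
  "bounded_operator_H1_L2 \<Omega> S \<longleftrightarrow>
     (\<forall>u\<in>H1 \<Omega>. S u \<in> L2 \<Omega>) \<and>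
     (\<forall>u\<in>H1 \<Omega>. \<forall>v\<in>H1 \<Omega>. \<forall>a b. AE x in lebesgue_on \<Omega>.
        S (\<lambda>y. a *\<^sub>R u y + b *\<^sub>R v y) x = a *\<^sub>R S u x + b *\<^sub>R S v x) \<and>
     (\<exists>C. \<forall>u G. weak_gradient \<Omega> u G \<longrightarrow>
        L2_norm \<Omega> (S u) \<le> C * sqrt ((L2_norm \<Omega> u)\<^sup>2 + (L2_norm \<Omega> G)\<^sup>2))"

definition C1_L2 :: "(real^3) set \<Rightarrow> real \<Rightarrow> (real \<Rightarrow> real^3 \<Rightarrow> real^3) \<Rightarrow> bool" where
  "C1_L2 \<Omega> T f \<longleftrightarrow> (\<forall>t\<in>{0..T}. f t \<in> L2 \<Omega>) \<and>
     (\<exists>f'. \<forall>t\<in>{0..T}. f' t \<in> L2 \<Omega> \<and>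
        ((\<lambda>s. L2_norm \<Omega> (\<lambda>x. (f s x - f t x) /\<^sub>R (s - t) - f' t x)) \<longlongrightarrow> 0) (at t within {0..T}) \<and>
        ((\<lambda>s. L2_norm \<Omega> (\<lambda>x. f' s x - f' t x)) \<longlongrightarrow> 0) (at t within {0..T}))"

text \<open>Near each boundary point the domain is, after a rigid rotation or reflection, the set of points
  above the graph of a Lipschitz function.\<close>

definition bounded_Lipschitz_domain :: "(real^3) set \<Rightarrow> bool" where
  "bounded_Lipschitz_domain \<Omega> \<longleftrightarrow> open \<Omega> \<and> connected \<Omega> \<and> \<Omega> \<noteq> {} \<and> bounded \<Omega> \<and>
     (\<forall>x\<in>frontier \<Omega>. \<exists>r>0. \<exists>R :: real^3 \<Rightarrow> real^3. \<exists>g :: real \<times> real \<Rightarrow> real. \<exists>B.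
        orthogonal_transformation R \<and> B-lipschitz_on UNIV g \<and>
        \<Omega> \<inter> ball x r = {y \<in> ball x r. g (R y $ 1, R y $ 2) < R y $ 3})"

definition quasi_uniform_mesh :: "real \<Rightarrow> real \<Rightarrow> (real^3) set \<Rightarrow> (real^3) set set \<Rightarrow> bool" where
  "quasi_uniform_mesh Cmesh h \<Omega> \<T> \<longleftrightarrow> h > 0 \<and>
     triangulation \<T> \<and> (\<forall>K\<in>\<T>. 3 simplex K) \<and> \<Union>\<T> = closure \<Omega> \<and>
     (\<forall>K\<in>\<T>. h \<le> root 3 (measure lebesgue K) \<and> root 3 (measure lebesgue K) \<le> diameter K \<and>
             diameter K \<le> Cmesh * h)"

definition mesh_nodes :: "(real^3) set set \<Rightarrow> (real^3) set" where
  "mesh_nodes \<T> = {v. \<exists>K\<in>\<T>. v extreme_point_of K}"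

definition S_h :: "(real^3) set \<Rightarrow> (real^3) set set \<Rightarrow> (real^3 \<Rightarrow> real) set" where
  "S_h \<Omega> \<T> = {u. continuous_on (closure \<Omega>) u \<and> (\<forall>K\<in>\<T>. \<exists>a c. \<forall>x\<in>K. u x = a \<bullet> x + c)}"

definition S_h_vec :: "(real^3) set \<Rightarrow> (real^3) set set \<Rightarrow> (real^3 \<Rightarrow> real^3) set" where
  "S_h_vec \<Omega> \<T> = {u. \<forall>i. (\<lambda>x. u x $ i) \<in> S_h \<Omega> \<T>}"

definition M_h :: "(real^3) set \<Rightarrow> (real^3) set set \<Rightarrow> (real^3 \<Rightarrow> real^3) set" where
  "M_h \<Omega> \<T> = {u \<in> S_h_vec \<Omega> \<T>. \<forall>v\<in>mesh_nodes \<T>. norm (u v) = 1}"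

text \<open>The Jacobian. For finite element functions it exists in the interior of every element, hence
  almost everywhere in the domain; the unspecified values on the remaining null set are irrelevant.\<close>

definition grad :: "(real^3 \<Rightarrow> real^3) \<Rightarrow> real^3 \<Rightarrow> real^3^3" where
  "grad u x = matrix (frechet_derivative u (at x))"

text \<open>The functions \<open>beta\<close> and \<open>Wfun k\<close> are given for all step sizes \<open>k > 0\<close>, since their hypotheses
  concern the limit \<open>k\<close> to 0; the discretization uses the single value \<open>step_size\<close>. The hat functions
  are determined on the closure of the domain by the conditions in \<open>llg_setting\<close>.\<close>

record llg_data =
  Dom :: "(real^3) set"
  Mesh :: "(real^3) set set"
  mesh_size :: real
  num_nodes :: nat
  node :: "nat \<Rightarrow> real^3"
  hat :: "nat \<Rightarrow> real^3 \<Rightarrow> real"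
  alpha :: real
  ell_ex :: real
  final_time :: real
  num_steps :: nat
  step_index :: nat
  beta :: "real \<Rightarrow> real"
  Wfun :: "real \<Rightarrow> real \<Rightarrow> real"
  pi_op :: "(real^3 \<Rightarrow> real^3) \<Rightarrow> (real^3 \<Rightarrow> real^3)"
  ffun :: "real \<Rightarrow> real^3 \<Rightarrow> real^3"
  Lh :: "(real^3 \<Rightarrow> real^3) \<Rightarrow> (real^3 \<Rightarrow> real^3) \<Rightarrow> (real^3 \<Rightarrow> real^3)"
  m_prev :: "real^3 \<Rightarrow> real^3"
  Tmat :: "real^3^3"

definition step_size :: "llg_data \<Rightarrow> real" where
  "step_size D = final_time D / real (num_steps D)"

definition llg_setting :: "real \<Rightarrow> llg_data \<Rightarrow> bool" where
  "llg_setting Cmesh D \<longleftrightarrow>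
     bounded_Lipschitz_domain (Dom D) \<and>
     quasi_uniform_mesh Cmesh (mesh_size D) (Dom D) (Mesh D) \<and>
     bij_betw (node D) {..<num_nodes D} (mesh_nodes (Mesh D)) \<and>
     (\<forall>j<num_nodes D. hat D j \<in> S_h (Dom D) (Mesh D) \<and>
        (\<forall>i<num_nodes D. hat D j (node D i) = (if i = j then 1 else 0))) \<and>
     0 < alpha D \<and> alpha D \<le> 1 \<and> ell_ex D > 0 \<and>
     final_time D > 0 \<and> num_steps D \<ge> 1 \<and> step_index D < num_steps D \<and>
     m_prev D \<in> M_h (Dom D) (Mesh D) \<and>
     bounded_operator_H1_L2 (Dom D) (pi_op D) \<and>
     C1_L2 (Dom D) (final_time D) (ffun D) \<and>
     (\<forall>k>0. beta D k > 0) \<and>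
     (\<forall>k>0. \<forall>s. Wfun D k s > 0) \<and>
     (\<forall>k>0. bounded (range (Wfun D k)) \<and> Wfun D k \<in> borel_measurable borel) \<and>
     ((\<lambda>k. Linf_norm_real (\<lambda>s. Wfun D k s - alpha D)) \<longlongrightarrow> 0) (at_right 0) \<and>
     (INF k\<in>{0<..}. INF s. Wfun D k s) \<ge> alpha D / 2 \<and>
     ((\<lambda>k. beta D k * k) \<longlongrightarrow> 0) (at_right 0) \<and>
     invertible (Tmat D) \<and> matrix_inv (Tmat D) = Tmat D \<and> Finite_Cartesian_Product.transpose (Tmat D) = Tmat D"

definition lambda_h :: "llg_data \<Rightarrow> (real^3 \<Rightarrow> real^3) \<Rightarrow> real^3 \<Rightarrow> real" where
  "lambda_h D m x = - (ell_ex D)\<^sup>2 * (norm (grad m x))\<^sup>2 +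
     (ffun D (real (step_index D) * step_size D) x + pi_op D m x) \<bullet> m x"

definition W_lambda :: "llg_data \<Rightarrow> (real^3 \<Rightarrow> real^3) \<Rightarrow> real^3 \<Rightarrow> real" where
  "W_lambda D m x = Wfun D (step_size D) (lambda_h D m x)"

text \<open>Row and column indices start at 0: index \<open>3 * j + l\<close> with \<open>l < 3\<close> belongs to node \<open>j\<close> and
  the coordinate direction \<open>l + 1\<close>. In the index type \<open>3\<close> the numerals 3 and 0 coincide.\<close>

definition basis_fun :: "llg_data \<Rightarrow> nat \<Rightarrow> real^3 \<Rightarrow> real^3" where
  "basis_fun D i x = hat D (i div 3) x *\<^sub>R axis (of_nat (Suc (i mod 3))) 1"

definition mass_mat :: "llg_data \<Rightarrow> real mat" where
  "mass_mat D = Matrix.mat (3 * num_nodes D) (3 * num_nodes D)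
     (\<lambda>(i, j). L2_inner (Dom D) (basis_fun D i) (basis_fun D j))"

definition weighted_mass_mat :: "llg_data \<Rightarrow> (real^3 \<Rightarrow> real^3) \<Rightarrow> real mat" where
  "weighted_mass_mat D m = Matrix.mat (3 * num_nodes D) (3 * num_nodes D)
     (\<lambda>(i, j). L2_inner (Dom D) (\<lambda>x. (W_lambda D m x / alpha D) *\<^sub>R basis_fun D i x) (basis_fun D j))"

definition stiffness_mat :: "llg_data \<Rightarrow> real mat" where
  "stiffness_mat D = Matrix.mat (3 * num_nodes D) (3 * num_nodes D)
     (\<lambda>(i, j). L2_inner (Dom D) (grad (basis_fun D i)) (grad (basis_fun D j)))"

definition skew_mat :: "llg_data \<Rightarrow> (real^3 \<Rightarrow> real^3) \<Rightarrow> real mat" where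
  "skew_mat D m = Matrix.mat (3 * num_nodes D) (3 * num_nodes D)
     (\<lambda>(i, j). L2_inner (Dom D) (\<lambda>x. cross3 (m x) (basis_fun D i x)) (basis_fun D j))"

definition A_mat :: "llg_data \<Rightarrow> (real^3 \<Rightarrow> real^3) \<Rightarrow> real mat" where
  "A_mat D m = alpha D \<cdot>\<^sub>m weighted_mass_mat D m
     + (beta D (step_size D) * step_size D) \<cdot>\<^sub>m stiffness_mat D - skew_mat D m"

definition b_vec :: "llg_data \<Rightarrow> (real^3 \<Rightarrow> real^3) \<Rightarrow> real Matrix.vec" where
  "b_vec D m = Matrix.vec (3 * num_nodes D)
     (\<lambda>j. - (ell_ex D)\<^sup>2 * L2_inner (Dom D) (grad m) (grad (basis_fun D j))
          + L2_inner (Dom D) (Lh D m (m_prev D)) (basis_fun D j))"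

definition Householder :: "real^3 \<Rightarrow> real^3^3" where
  "Householder m =
     (if m = - axis 3 1 then (\<chi> i j. if i = j then (if i = 3 then -1 else 1) else 0)
      else let w = (m + axis 3 1) /\<^sub>R norm (m + axis 3 1)
           in Finite_Cartesian_Product.mat 1 - (\<chi> i j. 2 * w $ i * w $ j))"

definition H_mat :: "real^3 \<Rightarrow> real^2^3" where
  "H_mat m = (\<chi> i j. if j = 1 then (Householder m *v axis 1 1) $ i
                              else (Householder m *v axis 2 1) $ i)"

definition Q_mat :: "llg_data \<Rightarrow> (real^3 \<Rightarrow> real^3) \<Rightarrow> real mat" where
  "Q_mat D m = Matrix.mat (3 * num_nodes D) (2 * num_nodes D)
     (\<lambda>(i, j). if i div 3 = j div 2
               then (Tmat D ** H_mat (Tmat D *v m (node D (i div 3))))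
                      $ of_nat (Suc (i mod 3)) $ of_nat (Suc (j mod 2))
               else 0)"

text \<open>Meaningful for invertible matrices only.\<close>

definition mat_inv :: "real mat \<Rightarrow> real mat" where
  "mat_inv A = the (mat_inverse A)"

definition A_Q :: "llg_data \<Rightarrow> (real^3 \<Rightarrow> real^3) \<Rightarrow> real mat" where
  "A_Q D m = transpose_mat (Q_mat D m) * A_mat D m * Q_mat D m"

definition b_Q :: "llg_data \<Rightarrow> (real^3 \<Rightarrow> real^3) \<Rightarrow> real Matrix.vec" where
  "b_Q D m = transpose_mat (Q_mat D m) *\<^sub>v b_vec D m"

definition P_Q :: "llg_data \<Rightarrow> real \<Rightarrow> (real^3 \<Rightarrow> real^3) \<Rightarrow> real mat" where
  "P_Q D \<alpha>P m = transpose_mat (Q_mat D m)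
     * mat_inv (\<alpha>P \<cdot>\<^sub>m mass_mat D + (beta D (step_size D) * step_size D) \<cdot>\<^sub>m stiffness_mat D)
     * Q_mat D m"

definition prec_norm :: "real mat \<Rightarrow> real Matrix.vec \<Rightarrow> real" where
  "prec_norm P y = sqrt (scalar_prod y (mat_inv P *\<^sub>v y))"

definition prec_residual :: "real mat \<Rightarrow> real mat \<Rightarrow> real Matrix.vec \<Rightarrow> real Matrix.vec \<Rightarrow> real Matrix.vec" where
  "prec_residual P A b x = P *\<^sub>v b - P * A *\<^sub>v x"

definition krylov_space ::
  "real mat \<Rightarrow> real mat \<Rightarrow> real Matrix.vec \<Rightarrow> real Matrix.vec \<Rightarrow> nat \<Rightarrow> real Matrix.vec set" where
  "krylov_space P A b x0 l =
     LinearCombinations.module.span class_ring (module_vec TYPE(real) (dim_row P))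
       {(P * A) ^\<^sub>m j *\<^sub>v prec_residual P A b x0 | j. j < l}"

definition gmres_iterate ::
  "real mat \<Rightarrow> real mat \<Rightarrow> real Matrix.vec \<Rightarrow> real Matrix.vec \<Rightarrow> nat \<Rightarrow> real Matrix.vec \<Rightarrow> bool" where
  "gmres_iterate P A b x0 l x \<longleftrightarrow>
     (\<exists>v\<in>krylov_space P A b x0 l. x = x0 + v) \<and>
     (\<forall>v\<in>krylov_space P A b x0 l.
        prec_norm P (prec_residual P A b x) \<le> prec_norm P (prec_residual P A b (x0 + v)))"

end

theory Submission
  imports Defs
begin

text \<open>Put \<open>B = \<alpha>P M + \<beta> k L\<close>. With \<open>p x = x \<bullet> P\<^sup>-\<^sup>1 x\<close> and \<open>q x = Q x \<bullet> B Q x\<close>, the matrix \<open>P\<^sup>-\<^sup>1\<close> is the Schur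
  complement form \<open>p x = min {v \<bullet> B v | Q\<^sup>T v = x}\<close>, so \<open>p \<le> q \<le> C F p\<close> as soon as the projection \<open>Q Q\<^sup>T\<close> has
  squared norm at most \<open>C F\<close> with respect to \<open>B\<close>. Coercivity \<open>r \<bullet> A r \<ge> c q r\<close> and boundedness of \<open>A\<close> with constant \<open>\<kappa>\<close>
  on all of the big space give \<open>p (P A r) \<le> \<kappa>\<^sup>2 C F q r\<close>, and one step with the fixed damping
  parameter \<open>\<omega> = c / (\<kappa>\<^sup>2 C F)\<close> yields \<open>p (r - \<omega> P A r) \<le> (1 - c\<^sup>2 / (\<kappa>\<^sup>2 C F)) p r\<close>. Keeping \<open>q\<close> on the right-hand sides
  is what makes \<open>F\<close> enter only to the first power. Since \<open>Q Q\<^sup>T\<close> is blockwise \<open>I - m m\<^sup>T\<close>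
  regardless of the Householder construction, its norm is bounded element by element, either by an inverse estimate or through
  the gradient of \<open>m\<close>; the factor \<open>\<gamma>\<close> of part (ii) enters only through \<open>\<gamma> \<le> 2\<close>.\<close>

subsection \<open>Preconditioned GMRES on a constrained space\<close>

text \<open>The constant has to serve every domain, mesh and data set with the given
  \<open>Cmesh\<close>. The finite element estimates are therefore reduced, with explicit numbers,
  to two facts about a single convex element: its volume is at least \<open>h ^ 3\<close> and its
  diameter at most \<open>c * h\<close>. Volume against diameter bounds slopes from above; shrinking
  an element towards a point of maximal modulus bounds the maximum by the L2 norm. Tangency to
  \<open>m\<close> enters only through the stability of the projection; coercivity and boundedness
  hold for all finite element vector fields. Three functions take default values that have to be
  ruled out: \<open>mat_inv\<close> off the invertible matrices, \<open>Linf_norm\<close> off the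
  essentially bounded functions, and \<open>powr\<close> at base 0. The second costs most: the
  weight contains \<open>pi_op D m\<close>, which is under control only for weakly differentiable
  \<open>m\<close>, so integration by parts is needed for finite element functions on a domain that
  may be nonconvex.\<close>

lemma pos_def_mat_inv:
  assumes A: "A \<in> carrier_mat n n"
    and pos: "\<And>v. v \<in> carrier_vec n \<Longrightarrow> v \<noteq> 0\<^sub>v n \<Longrightarrow> scalar_prod v (A *\<^sub>v v) > (0::real)"
  shows "mat_inv A \<in> carrier_mat n n" "A * mat_inv A = 1\<^sub>m n" "mat_inv A * A = 1\<^sub>m n"
proof -
  have "Determinant.det A \<noteq> 0"
  proof
    assume "Determinant.det A = 0"
    then obtain v where v: "v \<in> carrier_vec n" "v \<noteq> 0\<^sub>v n" "A *\<^sub>v v = 0\<^sub>v n"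
      using det_0_iff_vec_prod_zero_field[OF A] by auto
    have "scalar_prod v (A *\<^sub>v v) = 0" unfolding v(3) using v(1) by simp
    with pos[OF v(1,2)] show False by simp
  qed
  then have U: "A \<in> Units (ring_mat TYPE(real) n ())" by (rule det_non_zero_imp_unit[OF A])
  \<comment> \<open>So \<open>the\<close> in \<open>mat_inv\<close> is applied to a
    \<open>Some\<close>.\<close>
  then obtain B where B: "mat_inverse A = Some B" using mat_inverse(1)[OF A] by fastforce
  with mat_inverse(2)[OF A B]
  show "mat_inv A \<in> carrier_mat n n" "A * mat_inv A = 1\<^sub>m n" "mat_inv A * A = 1\<^sub>m n"
    by (auto simp: mat_inv_def)
qed

lemma scalar_prod_symmetric_mat:
  fixes A :: "real mat"
  assumes "A \<in> carrier_mat n n" "transpose_mat A = A" "u \<in> carrier_vec n" "v \<in> carrier_vec n"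
  shows "scalar_prod u (A *\<^sub>v v) = scalar_prod v (A *\<^sub>v u)"
proof -
  have "scalar_prod u (A *\<^sub>v v) = scalar_prod (A *\<^sub>v v) u"
    using assms by (intro comm_scalar_prod[of _ n]) auto
  also have "\<dots> = scalar_prod v (transpose_mat A *\<^sub>v u)"
    using assms(1,3,4) by (metis transpose_vec_mult_scalar transpose_carrier_mat Matrix.transpose_transpose)
  finally show ?thesis using assms(2) by simp
qed

lemma qform_add:
  fixes A :: "real mat"
  assumes A: "A \<in> carrier_mat n n" "transpose_mat A = A" and v: "u \<in> carrier_vec n" "v \<in> carrier_vec n"
  shows "scalar_prod (u + c \<cdot>\<^sub>v v) (A *\<^sub>v (u + c \<cdot>\<^sub>v v)) =
    scalar_prod u (A *\<^sub>v u) + 2 * c * scalar_prod u (A *\<^sub>v v) + c\<^sup>2 * scalar_prod v (A *\<^sub>v v)"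
proof -
  have "scalar_prod (u + c \<cdot>\<^sub>v v) (A *\<^sub>v (u + c \<cdot>\<^sub>v v)) =
     scalar_prod u (A *\<^sub>v u) + c * scalar_prod u (A *\<^sub>v v) + c * scalar_prod v (A *\<^sub>v u) + c * c * scalar_prod v (A *\<^sub>v v)"
    using A(1) v
    by (simp add: mult_add_distrib_mat_vec[of _ n n] mult_mat_vec[of _ n n] add_scalar_prod_distrib[of _ n]
        scalar_prod_add_distrib[of _ n] algebra_simps)
  also have "scalar_prod v (A *\<^sub>v u) = scalar_prod u (A *\<^sub>v v)"
    using scalar_prod_symmetric_mat[OF A] v by simp
  finally show ?thesis by (simp add: power2_eq_square algebra_simps)
qed

text \<open>GMRES is compared with one damped Richardson step started at its own iterate:
  \<open>x l + \<omega> r l\<close> is admissible at level \<open>Suc l\<close>, so minimality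
  transfers the contraction factor of that step to the residuals.\<close>

lemma gmres_convergence:
  fixes P A :: "real mat" and x :: "nat \<Rightarrow> real Matrix.vec"
  assumes P: "P \<in> carrier_mat n n" and A: "A \<in> carrier_mat n n"
    and b: "b \<in> carrier_vec n" and x0: "x0 \<in> carrier_vec n"
    and x: "\<And>l. gmres_iterate P A b x0 l (x l)"
    and step: "\<And>r. r \<in> carrier_vec n \<Longrightarrow>
       prec_norm P (r - \<omega> \<cdot>\<^sub>v (P * A *\<^sub>v r)) \<le> q * prec_norm P r"
    and q: "0 \<le> q"
  shows "prec_norm P (prec_residual P A b (x l)) \<le> q ^ l * prec_norm P (prec_residual P A b (x 0))"
proof -
  interpret vec_space "TYPE(real)" n .
  define r0 where "r0 = prec_residual P A b x0"
  define PA where "PA = P * A"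
  have PA: "PA \<in> carrier_mat n n" using P A by (simp add: PA_def)
  have r0: "r0 \<in> carrier_vec n" using P A b x0 by (auto simp: r0_def prec_residual_def)
  define G where "G l = {PA ^\<^sub>m j *\<^sub>v r0 | j. j < l}" for l
  have G: "G l \<subseteq> carrier_vec n" for l using PA r0 by (auto simp: G_def intro!: mult_mat_vec_carrier)
  have K: "krylov_space P A b x0 l = span (G l)" for l
    using P by (simp add: krylov_space_def G_def PA_def r0_def)
  have spanc: "v \<in> carrier_vec n" if "v \<in> span (G l)" for v l
    using that G span_closed by (metis span_is_subset2 subsetD)
  have mono: "span (G l) \<subseteq> span (G (Suc l))" for l
    by (rule span_is_monotone) (auto simp: G_def)
  \<comment> \<open>Multiplication by \<open>PA\<close> shifts each generating power by one; this
    places the current residual \<open>r0 - PA v\<close> in the next Krylov space.\<close>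
  have PAK: "PA *\<^sub>v v \<in> span (G (Suc l))" if v: "v \<in> span (G l)" for v l
  proof -
    obtain a S where a: "v = lincomb a S" "finite S" "S \<subseteq> G l" using in_spanE[OF v] by blast
    from a(2,3) have "PA *\<^sub>v lincomb a S \<in> span (G (Suc l))"
    proof (induction S rule: finite_induct)
      case empty
      have "PA *\<^sub>v 0\<^sub>v n = 0\<^sub>v n" using PA by (intro eq_vecI) auto
      then show ?case by (simp add: span_zero)
    next
      case (insert s S)
      have s: "s \<in> G l" "S \<subseteq> G l" using insert by auto
      then obtain j where j: "s = PA ^\<^sub>m j *\<^sub>v r0" "j < l" by (auto simp: G_def)
      have sc: "s \<in> carrier_vec n" "S \<subseteq> carrier_vec n" using s G by auto
      have "PA * PA ^\<^sub>m j = PA ^\<^sub>m (Suc j)"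
      proof (induction j)
        case (Suc j)
        have "PA * PA ^\<^sub>m Suc j = (PA * PA ^\<^sub>m j) * PA"
          using PA by (simp add: assoc_mult_mat[of _ n n _ n _ n])
        then show ?case using Suc by simp
      qed (use PA in simp)
      then have "PA *\<^sub>v s = PA ^\<^sub>m (Suc j) *\<^sub>v r0"
        using PA r0 j by (metis assoc_mult_mat_vec pow_carrier_mat)
      then have "PA *\<^sub>v s \<in> G (Suc l)" using j unfolding G_def by blast
      then have 1: "PA *\<^sub>v s \<in> span (G (Suc l))" using G by (meson in_own_span subsetD)
      have "lincomb a (insert s S) = a s \<cdot>\<^sub>v s + lincomb a S"
        using insert sc by (intro lincomb_insert2) auto
      then have "PA *\<^sub>v lincomb a (insert s S) = a s \<cdot>\<^sub>v (PA *\<^sub>v s) + PA *\<^sub>v lincomb a S"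
        using PA sc by (simp add: mult_add_distrib_mat_vec[of _ n n] mult_mat_vec[of _ n n] lincomb_closed)
      then show ?case using 1 insert.IH[OF s(2)] G smult_in_span span_add1 by metis
    qed
    then show ?thesis using a by simp
  qed
  define r where "r l = prec_residual P A b (x l)" for l
  have "prec_norm P (r (Suc l)) \<le> q * prec_norm P (r l)" for l
  proof -
    obtain v where v: "v \<in> span (G l)" "x l = x0 + v"
      using x[of l] by (auto simp: gmres_iterate_def K)
    note vc = spanc[OF v(1)]
    have PAv: "PA *\<^sub>v v \<in> carrier_vec n" using PA vc by auto
    have rl: "r l = r0 - PA *\<^sub>v v"
      using P A b x0 vc PA by (intro eq_vecI)
        (auto simp: r_def r0_def prec_residual_def v(2) PA_def[symmetric] mult_add_distrib_mat_vec[of _ n n])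
    have rlc: "r l \<in> carrier_vec n" using rl r0 PAv by auto
    have "r0 \<in> G (Suc l)" using r0 PA unfolding G_def by (force intro: exI[of _ 0])
    then have "r0 \<in> span (G (Suc l))" using G by (meson in_own_span subsetD)
    moreover have "(-1) \<cdot>\<^sub>v (PA *\<^sub>v v) \<in> span (G (Suc l))"
      by (rule smult_in_span[OF G PAK[OF v(1)]])
    ultimately have "r0 + (-1) \<cdot>\<^sub>v (PA *\<^sub>v v) \<in> span (G (Suc l))" using G span_add1 by metis
    moreover have "r0 + (-1) \<cdot>\<^sub>v (PA *\<^sub>v v) = r l" using rl r0 PAv by (intro eq_vecI) auto
    ultimately have "r l \<in> span (G (Suc l))" by simp
    then have 1: "\<omega> \<cdot>\<^sub>v r l \<in> span (G (Suc l))" by (rule smult_in_span[OF G])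
    have "v \<in> span (G (Suc l))" using v(1) mono by (rule rev_subsetD)
    then have "v + \<omega> \<cdot>\<^sub>v r l \<in> span (G (Suc l))" by (rule span_add1[OF G _ 1])
    \<comment> \<open>The competitor is \<open>x0 + (v + \<omega> r l) = x l + \<omega> r l\<close>;
      its residual is exactly the damped step applied to \<open>r l\<close>.\<close>
    then have "prec_norm P (r (Suc l)) \<le> prec_norm P (prec_residual P A b (x0 + (v + \<omega> \<cdot>\<^sub>v r l)))"
      using x[of "Suc l"] by (simp add: gmres_iterate_def K r_def)
    also have "prec_residual P A b (x0 + (v + \<omega> \<cdot>\<^sub>v r l)) = (r0 - PA *\<^sub>v v) - \<omega> \<cdot>\<^sub>v (PA *\<^sub>v r l)"
      using P A b x0 vc PA rlc by (intro eq_vecI)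
        (auto simp: r0_def prec_residual_def PA_def[symmetric] mult_add_distrib_mat_vec[of _ n n] mult_mat_vec[of _ n n])
    also have "\<dots> = r l - \<omega> \<cdot>\<^sub>v (P * A *\<^sub>v r l)" by (simp only: rl[symmetric] PA_def[symmetric])
    also have "prec_norm P \<dots> \<le> q * prec_norm P (r l)" by (rule step[OF rlc])
    finally show ?thesis .
  qed
  then have "prec_norm P (r l) \<le> q ^ l * prec_norm P (r 0)" for l
  proof (induction l)
    case (Suc l)
    have "prec_norm P (r (Suc l)) \<le> q * prec_norm P (r l)" by fact
    also have "\<dots> \<le> q * (q ^ l * prec_norm P (r 0))" using Suc q by (intro mult_left_mono) auto
    finally show ?case by simp
  qed simp
  then show ?thesis by (simp add: r_def)
qed

text \<open>Boundedness is assumed in additive form, without square roots. Rescaling one argument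
  recovers the product form, and this is done once in the proof with an optimal scaling.\<close>

lemma constrained_gmres_convergence:
  fixes A B Q :: "real mat" and x :: "nat \<Rightarrow> real Matrix.vec"
  assumes B: "B \<in> carrier_mat n n" "transpose_mat B = B"
    and Bpos: "\<And>v. v \<in> carrier_vec n \<Longrightarrow> v \<noteq> 0\<^sub>v n \<Longrightarrow> scalar_prod v (B *\<^sub>v v) > 0"
    and A: "A \<in> carrier_mat n n" and Q: "Q \<in> carrier_mat n k"
    and QQ: "\<And>y. y \<in> carrier_vec k \<Longrightarrow> transpose_mat Q *\<^sub>v (Q *\<^sub>v y) = y"
    and coercive: "\<And>v. v \<in> carrier_vec n \<Longrightarrow> c * scalar_prod v (B *\<^sub>v v) \<le> scalar_prod v (A *\<^sub>v v)"
    and bounded: "\<And>v w. v \<in> carrier_vec n \<Longrightarrow> w \<in> carrier_vec n \<Longrightarrow>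
       scalar_prod w (A *\<^sub>v v) \<le> \<kappa> / 2 * (scalar_prod v (B *\<^sub>v v) + scalar_prod w (B *\<^sub>v w))"
    and stable: "\<And>v. v \<in> carrier_vec n \<Longrightarrow>
       scalar_prod (Q *\<^sub>v (transpose_mat Q *\<^sub>v v)) (B *\<^sub>v (Q *\<^sub>v (transpose_mat Q *\<^sub>v v)))
         \<le> F * scalar_prod v (B *\<^sub>v v)"
    and const: "0 < c" "0 < \<kappa>" "0 < F" and \<theta>: "\<theta> \<le> c\<^sup>2 / (\<kappa>\<^sup>2 * F)" "\<theta> < 1"
    and b: "b \<in> carrier_vec k" and x0: "x0 \<in> carrier_vec k"
  defines "P \<equiv> transpose_mat Q * mat_inv B * Q" and "AQ \<equiv> transpose_mat Q * A * Q"
  assumes x: "\<And>l. gmres_iterate P AQ b x0 l (x l)"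
  shows "prec_norm P (prec_residual P AQ b (x l)) \<le>
     (1 - \<theta>) powr (real l / 2) * prec_norm P (prec_residual P AQ b (x 0))"
proof -
  define Bi where "Bi = mat_inv B"
  note Bi = pos_def_mat_inv[OF B(1) Bpos, folded Bi_def]
  define QT where "QT = transpose_mat Q"
  have QT: "QT \<in> carrier_mat k n" using Q by (simp add: QT_def)
  have adj: "scalar_prod (QT *\<^sub>v v) y = scalar_prod v (Q *\<^sub>v y)"
    if "v \<in> carrier_vec n" "y \<in> carrier_vec k" for v y
    using transpose_vec_mult_scalar[OF Q that(2,1)] by (simp add: QT_def)
  have QQ': "QT *\<^sub>v (Q *\<^sub>v y) = y" if "y \<in> carrier_vec k" for y using QQ that by (simp add: QT_def)
  have P: "P \<in> carrier_mat k k" using Q Bi by (simp add: P_def Bi_def[symmetric])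
  have AQ: "AQ \<in> carrier_mat k k" using Q A by (simp add: AQ_def)
  have Pv: "P *\<^sub>v y = QT *\<^sub>v (Bi *\<^sub>v (Q *\<^sub>v y))" if "y \<in> carrier_vec k" for y
    using that Q QT Bi by (simp add: P_def Bi_def[symmetric] QT_def[symmetric] assoc_mult_mat_vec[of _ _ n _ k])
  have AQv: "AQ *\<^sub>v y = QT *\<^sub>v (A *\<^sub>v (Q *\<^sub>v y))" if "y \<in> carrier_vec k" for y
    using that Q QT A by (simp add: AQ_def QT_def[symmetric] assoc_mult_mat_vec[of _ _ n _ k])
  have BBi: "B *\<^sub>v (Bi *\<^sub>v v) = v" if "v \<in> carrier_vec n" for v
    using assoc_mult_mat_vec[of B n n Bi n v] B Bi that by simp
  have Qc[simp]: "Q *\<^sub>v y \<in> carrier_vec n" if "y \<in> carrier_vec k" for y using Q that by auto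
  have QTc[simp]: "QT *\<^sub>v y \<in> carrier_vec k" if "y \<in> carrier_vec n" for y using QT that by auto
  have Bc[simp]: "B *\<^sub>v y \<in> carrier_vec n" if "y \<in> carrier_vec n" for y using B that by auto
  have Bic[simp]: "Bi *\<^sub>v y \<in> carrier_vec n" if "y \<in> carrier_vec n" for y using Bi that by auto
  have Ac[simp]: "A *\<^sub>v y \<in> carrier_vec n" if "y \<in> carrier_vec n" for y using A that by auto
  have Bsym: "scalar_prod u (B *\<^sub>v v) = scalar_prod v (B *\<^sub>v u)"
    if "u \<in> carrier_vec n" "v \<in> carrier_vec n" for u v
    using scalar_prod_symmetric_mat[OF B that] .
  have Bnn: "scalar_prod v (B *\<^sub>v v) \<ge> 0" if v: "v \<in> carrier_vec n" for v
  proof (cases "v = 0\<^sub>v n")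
    case True
    then show ?thesis using B by simp
  next
    case False
    then show ?thesis using Bpos[OF v] by simp
  qed
  have Ppos: "scalar_prod y (P *\<^sub>v y) > 0" if y: "y \<in> carrier_vec k" "y \<noteq> 0\<^sub>v k" for y
  proof -
    let ?z = "Bi *\<^sub>v (Q *\<^sub>v y)"
    have "?z \<noteq> 0\<^sub>v n"
    proof
      assume "?z = 0\<^sub>v n"
      then have "B *\<^sub>v (Bi *\<^sub>v (Q *\<^sub>v y)) = 0\<^sub>v n" using B by (intro eq_vecI) auto
      then have "Q *\<^sub>v y = 0\<^sub>v n" using BBi y by simp
      then have "QT *\<^sub>v (Q *\<^sub>v y) = 0\<^sub>v k" using QT by (intro eq_vecI) auto
      then show False using y QQ' by simp
    qed
    then have "0 < scalar_prod ?z (B *\<^sub>v ?z)" using y by (intro Bpos) auto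
    also have "\<dots> = scalar_prod (QT *\<^sub>v ?z) y" using y by (simp add: BBi adj)
    also have "\<dots> = scalar_prod y (P *\<^sub>v y)" using y by (simp add: Pv comm_scalar_prod[of _ k])
    finally show ?thesis .
  qed
  define Pi where "Pi = mat_inv P"
  note Pi = pos_def_mat_inv[OF P Ppos, folded Pi_def]
  have Pic[simp]: "Pi *\<^sub>v y \<in> carrier_vec k" if "y \<in> carrier_vec k" for y using Pi that by auto
  have Pc[simp]: "P *\<^sub>v y \<in> carrier_vec k" if "y \<in> carrier_vec k" for y using P that by auto
  have PPi: "P *\<^sub>v (Pi *\<^sub>v y) = y" if "y \<in> carrier_vec k" for y
    using assoc_mult_mat_vec[of P k k Pi k y] P Pi that by simp
  have PiP: "Pi *\<^sub>v (P *\<^sub>v y) = y" if "y \<in> carrier_vec k" for y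
    using assoc_mult_mat_vec[of Pi k k P k y] P Pi that by simp
  \<comment> \<open>\<open>R y\<close> is the minimiser of the energy \<open>v \<bullet> B v\<close>
    under the constraint \<open>QT v = y\<close>; \<open>BR\<close> below is its Lagrange condition
    with multiplier \<open>Pi y\<close>.\<close>
  define R where "R y = Bi *\<^sub>v (Q *\<^sub>v (Pi *\<^sub>v y))" for y
  define p where "p y = scalar_prod y (Pi *\<^sub>v y)" for y
  define q where "q y = scalar_prod (Q *\<^sub>v y) (B *\<^sub>v (Q *\<^sub>v y))" for y
  have Rc[simp]: "R y \<in> carrier_vec n" if "y \<in> carrier_vec k" for y using that by (simp add: R_def)
  have QTR: "QT *\<^sub>v R y = y" if "y \<in> carrier_vec k" for y
    using that by (simp add: R_def Pv[symmetric] PPi)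
  have BR: "B *\<^sub>v R y = Q *\<^sub>v (Pi *\<^sub>v y)" if "y \<in> carrier_vec k" for y
    using that by (simp add: R_def BBi)
  have p_eq: "p y = scalar_prod (R y) (B *\<^sub>v R y)" if "y \<in> carrier_vec k" for y
    using adj[of "R y" "Pi *\<^sub>v y"] that by (simp add: p_def BR QTR)
  have p_nn: "p y \<ge> 0" if "y \<in> carrier_vec k" for y using that by (simp add: p_eq Bnn)
  have pq: "p y \<le> q y" if y: "y \<in> carrier_vec k" for y
  proof -
    \<comment> \<open>Since \<open>QT Q\<close> is the identity, \<open>Q y\<close> satisfies the
      same constraint. Their difference lies in the kernel of \<open>QT\<close> and is therefore
      \<open>B\<close>-orthogonal to \<open>R y\<close>, so Pythagoras applies.\<close>
    define e where "e = Q *\<^sub>v y - R y"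
    have e: "e \<in> carrier_vec n" "QT *\<^sub>v e = 0\<^sub>v k"
      using y QT by (auto simp: e_def mult_minus_distrib_mat_vec[of _ k n] QQ' QTR)
    have "Q *\<^sub>v y = R y + 1 \<cdot>\<^sub>v e" 
      by (intro eq_vecI) (use carrier_vecD[OF Rc[OF y]] Q in \<open>auto simp: e_def\<close>)
    then have "q y = p y + 2 * scalar_prod (R y) (B *\<^sub>v e) + scalar_prod e (B *\<^sub>v e)"
      using qform_add[OF B Rc[OF y] e(1), of 1] y by (simp add: q_def p_eq)
    moreover have "scalar_prod (R y) (B *\<^sub>v e) = scalar_prod (QT *\<^sub>v e) (Pi *\<^sub>v y)"
      using e(1) y by (simp add: Bsym[of "R y" e] BR adj)
    moreover have "scalar_prod (0\<^sub>v k) (Pi *\<^sub>v y) = 0" using y by simp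
    ultimately show ?thesis using Bnn[OF e(1)] by (simp add: e(2))
  qed
  \<comment> \<open>Stability is applied to the minimiser: projecting \<open>R y\<close> gives
    \<open>Q y\<close>, because \<open>QT (R y) = y\<close>.\<close>
  have qp: "q y \<le> F * p y" if y: "y \<in> carrier_vec k" for y
    using stable[OF Rc[OF y]] y by (simp add: q_def p_eq QT_def[symmetric] QTR)
  \<comment> \<open>This is the minimiser of
    \<open>\<omega>\<^sup>2 * \<kappa>\<^sup>2 * F - 2 * \<omega> * c\<close>, and
    \<open>- \<delta>\<close> is the minimum.\<close>
  define \<omega> where "\<omega> = c / (\<kappa>\<^sup>2 * F)"
  define \<delta> where "\<delta> = c\<^sup>2 / (\<kappa>\<^sup>2 * F)"
  have "prec_norm P (r - \<omega> \<cdot>\<^sub>v (P * AQ *\<^sub>v r)) \<le> sqrt (1 - \<theta>) * prec_norm P r"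
    if r: "r \<in> carrier_vec k" for r
  proof -
    define z where "z = AQ *\<^sub>v r"
    define y where "y = P *\<^sub>v z"
    have z: "z \<in> carrier_vec k" using AQ r by (auto simp: z_def)
    have y: "y \<in> carrier_vec k" using z by (simp add: y_def)
    have "p y = scalar_prod z y" using y z by (simp add: p_def y_def PiP comm_scalar_prod[of _ k])
    also have "\<dots> = scalar_prod (A *\<^sub>v (Q *\<^sub>v r)) (Q *\<^sub>v y)"
      using r y by (simp add: z_def AQv adj)
    finally have py: "p y = scalar_prod (Q *\<^sub>v y) (A *\<^sub>v (Q *\<^sub>v r))"
      using r y by (simp add: comm_scalar_prod[of _ n])
    \<comment> \<open>The scaling satisfies \<open>\<kappa> * s * F = 1\<close>, so the term in
      \<open>p y\<close> on the right is half of the left-hand side and can be absorbed.\<close>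
    define s where "s = 1 / (\<kappa> * F)"
    have "s * p y = scalar_prod (s \<cdot>\<^sub>v (Q *\<^sub>v y)) (A *\<^sub>v (Q *\<^sub>v r))"
      using r y by (simp add: py smult_scalar_prod_distrib[of _ n])
    also have "\<dots> \<le> \<kappa> / 2 * (q r + scalar_prod (s \<cdot>\<^sub>v (Q *\<^sub>v y)) (B *\<^sub>v (s \<cdot>\<^sub>v (Q *\<^sub>v y))))"
      unfolding q_def using r y by (intro bounded) auto
    also have "scalar_prod (s \<cdot>\<^sub>v (Q *\<^sub>v y)) (B *\<^sub>v (s \<cdot>\<^sub>v (Q *\<^sub>v y))) = s * (s * q y)"
      using B y Qc[OF y] by (simp add: q_def mult_mat_vec[of _ n n] smult_scalar_prod_distrib[of _ n] scalar_prod_smult_distrib[of _ n])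
    also have "s * (s * q y) \<le> s * (s * (F * p y))"
      using qp[OF y] const by (intro mult_left_mono) (auto simp: s_def)
    also have "\<kappa> / 2 * (q r + s * (s * (F * p y))) = \<kappa> / 2 * q r + s * p y / 2"
      using const by (simp add: s_def field_simps)
    finally have "s * p y \<le> \<kappa> * q r" using const by simp
    then have pyle: "p y \<le> \<kappa>\<^sup>2 * F * q r"
      using const by (simp add: s_def field_simps power2_eq_square)
    have Ry: "R y = Bi *\<^sub>v (Q *\<^sub>v z)" using z by (simp add: R_def y_def PiP)
    have yr: "r - \<omega> \<cdot>\<^sub>v y \<in> carrier_vec k" using r y by auto
    have Rmat: "R v = (Bi * Q * Pi) *\<^sub>v v" if "v \<in> carrier_vec k" for v
      using that Bi Q Pi by (simp add: R_def assoc_mult_mat_vec[of _ n n _ k] assoc_mult_mat_vec[of _ n k _ k])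
    have RM: "Bi * Q * Pi \<in> carrier_mat n k" using Bi Q Pi by simp
    have "R (r - \<omega> \<cdot>\<^sub>v y) = R r + (-\<omega>) \<cdot>\<^sub>v R y"
      unfolding Rmat[OF r] Rmat[OF y] Rmat[OF yr] using RM carrier_matD[OF RM] r y
      by (intro eq_vecI) (auto simp del: assoc_mult_mat simp: mult_minus_distrib_mat_vec[of _ n k] mult_mat_vec[of _ n k])
    then have "p (r - \<omega> \<cdot>\<^sub>v y) = p r + 2 * (-\<omega>) * scalar_prod (R r) (B *\<^sub>v R y) + \<omega>\<^sup>2 * p y"
      using qform_add[OF B Rc[OF r] Rc[OF y], of "-\<omega>"] r y yr by (simp add: p_eq)
    \<comment> \<open>Because \<open>Pi y = z\<close>, the vector \<open>B (R y)\<close> is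
      \<open>Q z\<close>; moving \<open>Q\<close> across and using \<open>QT (R r) = r\<close>
      leaves the energy of \<open>A\<close> at \<open>Q r\<close>, where coercivity applies.\<close>
    also have "scalar_prod (R r) (B *\<^sub>v R y) = scalar_prod (Q *\<^sub>v r) (A *\<^sub>v (Q *\<^sub>v r))"
    proof -
      have "scalar_prod (R r) (B *\<^sub>v R y) = scalar_prod (QT *\<^sub>v R r) z"
        using r z y by (simp add: Ry BBi adj)
      also have "\<dots> = scalar_prod (QT *\<^sub>v (A *\<^sub>v (Q *\<^sub>v r))) r"
        using r by (simp add: QTR z_def AQv comm_scalar_prod[of r k])
      also have "\<dots> = scalar_prod (A *\<^sub>v (Q *\<^sub>v r)) (Q *\<^sub>v r)" using r by (simp add: adj)
      finally show ?thesis using r by (simp add: comm_scalar_prod[of _ n])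
    qed
    also have "p r + 2 * (-\<omega>) * scalar_prod (Q *\<^sub>v r) (A *\<^sub>v (Q *\<^sub>v r)) + \<omega>\<^sup>2 * p y
       \<le> p r + 2 * (-\<omega>) * (c * q r) + \<omega>\<^sup>2 * (\<kappa>\<^sup>2 * F * q r)"
      using coercive[of "Q *\<^sub>v r"] pyle r const
      by (intro add_mono mult_left_mono_neg mult_left_mono) (auto simp: q_def \<omega>_def)
    also have "\<dots> = p r - \<delta> * q r"
      using const by (simp add: \<omega>_def \<delta>_def power2_eq_square field_simps)
    also have "\<dots> \<le> p r - \<delta> * p r"
      using pq[OF r] const by (simp add: \<delta>_def mult_left_mono divide_right_mono)
    also have "\<dots> \<le> p r - \<theta> * p r"
      using mult_right_mono[OF \<theta>(1) p_nn[OF r]] by (simp add: \<delta>_def)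
    finally have "p (r - \<omega> \<cdot>\<^sub>v y) \<le> (1 - \<theta>) * p r" by (simp add: algebra_simps)
    moreover have "P * AQ *\<^sub>v r = y" using P AQ r by (simp add: y_def z_def assoc_mult_mat_vec[of _ k k _ k])
    ultimately show ?thesis
      by (simp add: prec_norm_def p_def Pi_def real_sqrt_mult[symmetric])
  qed
  then have "prec_norm P (prec_residual P AQ b (x l)) \<le>
     sqrt (1 - \<theta>) ^ l * prec_norm P (prec_residual P AQ b (x 0))"
    using \<theta>(2) by (intro gmres_convergence[OF P AQ b x0 x]) auto
  \<comment> \<open>Strict positivity of \<open>1 - \<theta>\<close> matters:
    \<open>0 powr 0\<close> is 0, while the zeroth power of 0 is 1.\<close>
  also have "sqrt (1 - \<theta>) ^ l = (1 - \<theta>) powr (real l / 2)"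
  proof -
    have \<theta>': "0 < 1 - \<theta>" using \<theta>(2) by simp
    then have "sqrt (1 - \<theta>) ^ l = sqrt (1 - \<theta>) powr real l" by (subst powr_realpow) auto
    also have "\<dots> = ((1 - \<theta>) powr (1/2)) powr real l" using \<theta>' by (subst powr_half_sqrt) auto
    finally show ?thesis by (simp add: powr_powr)
  qed
  finally show ?thesis .
qed

subsection \<open>Affine functions on convex bodies\<close>

lemma norm_matrix_vector_mult_le:
  fixes G :: "real^'n^'m"
  shows "norm (G *v x) \<le> norm G * norm x"
proof -
  have "(norm (G *v x))\<^sup>2 = (\<Sum>i\<in>UNIV. (G $ i \<bullet> x)\<^sup>2)"
    unfolding power2_norm_eq_inner by (simp add: inner_vec_def matrix_vector_mult_def power2_eq_square)
  also have "\<dots> \<le> (\<Sum>i\<in>UNIV. (norm (G $ i))\<^sup>2 * (norm x)\<^sup>2)"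
    by (intro sum_mono) (metis Cauchy_Schwarz_ineq power2_norm_eq_inner)
  also have "\<dots> = (norm G * norm x)\<^sup>2"
    by (simp add: power_mult_distrib sum_distrib_right[symmetric] power2_norm_eq_inner[of G] inner_vec_def[of G G])
      (simp add: power2_norm_eq_inner)
  finally show ?thesis by (rule power2_le_imp_le) simp
qed

lemma norm_matrix_le_sum_rows:
  fixes G :: "real^'n^'m"
  shows "norm G \<le> (\<Sum>i\<in>UNIV. norm (G $ i))"
  unfolding norm_vec_def[of G] by (rule L2_set_le_sum) simp

text \<open>Preimages of balls under affine maps are convex, so a bound on the generating points
  passes to their hull.\<close>

lemma norm_affine_le_on_hull:
  fixes u :: "real^'n \<Rightarrow> real^'m"
  assumes u: "\<And>x. x \<in> convex hull V \<Longrightarrow> u x = G *v x + d"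
    and V: "\<And>v. v \<in> V \<Longrightarrow> norm (u v) \<le> \<mu>" and x: "x \<in> convex hull V"
  shows "norm (u x) \<le> \<mu>"
proof -
  have "convex {x. norm (G *v x + d) \<le> \<mu>}"
  proof -
    have "{x. norm (G *v x + d) \<le> \<mu>} = (*v) G -` (cball (- d) \<mu>)"
      by (auto simp: dist_norm norm_minus_commute[of "- d"] add.commute)
    then show ?thesis
      by (simp add: convex_linear_vimage matrix_vector_mul_linear)
  qed
  moreover have "V \<subseteq> {x. norm (G *v x + d) \<le> \<mu>}" using V u hull_inc by fastforce
  ultimately have "convex hull V \<subseteq> {x. norm (G *v x + d) \<le> \<mu>}" by (intro hull_minimal) auto
  then show ?thesis using u x by auto
qed

text \<open>On the copy of \<open>S\<close> that is shrunk by the factor 1/4 towards a point of maximal modulus, an affine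
  function keeps at least half of its maximal modulus.\<close>

lemma affine_max_le_integral:
  fixes u :: "real^3 \<Rightarrow> real^3"
  assumes K: "convex K" "compact K" and z: "z \<in> K"
    and u: "\<And>x. x \<in> K \<Longrightarrow> u x = G *v x + d"
    and max: "\<And>x. x \<in> K \<Longrightarrow> norm (u x) \<le> norm (u z)"
  shows "measure lebesgue (interior K) * (norm (u z))\<^sup>2
      \<le> 256 * integral\<^sup>L (lebesgue_on (interior K)) (\<lambda>x. (norm (u x))\<^sup>2)"
proof -
  define S where "S = interior K"
  define f where "f x = (1/4) *\<^sub>R x + (3/4) *\<^sub>R z" for x :: "real^3"
  define \<mu> where "\<mu> = norm (u z)"
  have Slm: "S \<in> lmeasurable" unfolding S_def using K bounded_subset[OF compact_imp_bounded interior_subset]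
    by (intro lmeasurable_open) auto
  have SK: "x \<in> K" if "x \<in> S" for x using that interior_subset S_def by auto
  have m: "measure lebesgue (f ` S) = measure lebesgue S / 64"
    using measure_lebesgue_affine[of "1/4" "(3/4) *\<^sub>R z" S] by (simp add: f_def power_divide)
  have fS: "f ` S \<subseteq> S"
  proof
    fix y assume "y \<in> f ` S"
    then obtain x where x: "x \<in> S" "y = f x" by auto
    have "z - (1/4) *\<^sub>R (z - x) \<in> interior K"
      using mem_interior_convex_shrink[OF K(1) _ z, of x "1/4"] x by (simp add: S_def)
    also have "z - (1/4) *\<^sub>R (z - x) = y"
      unfolding x f_def by (simp add: Finite_Cartesian_Product.vec_eq_iff field_simps)
    finally show "y \<in> S" by (simp add: S_def)
  qed
  have fSm: "f ` S \<in> lmeasurable"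
  proof (rule lmeasurable_open)
    show "bounded (f ` S)" using Slm fS K bounded_subset by (metis S_def compact_imp_bounded interior_subset order.trans)
    have "f ` S = (\<lambda>x. (3/4) *\<^sub>R z + x) ` ((*\<^sub>R) (1/4) ` S)" by (auto simp: f_def image_image add.commute)
    then show "open (f ` S)" by (simp add: S_def open_scaling open_translation)
  qed
  have low: "\<mu>\<^sup>2 / 4 \<le> (norm (u y))\<^sup>2" if y: "y \<in> f ` S" for y
  proof -
    obtain x where x: "x \<in> S" "y = f x" using y by auto
    have "y \<in> K" using y fS SK by auto
    then have "u y = (1/4) *\<^sub>R u x + (3/4) *\<^sub>R u z"
      using u[OF SK[OF x(1)]] u[OF z] u[of y] unfolding x f_def
      by (simp add: matrix_vector_right_distrib scaleR_matrix_vector_assoc[symmetric] matrix_vector_mult_scaleR algebra_simps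
          flip: scaleR_add_left)
    then have "(3/4) *\<^sub>R u z = u y - (1/4) *\<^sub>R u x" by simp
    then have "3/4 * \<mu> \<le> norm (u y) + 1/4 * norm (u x)"
      unfolding \<mu>_def by (metis abs_of_nonneg norm_scaleR norm_triangle_ineq4 zero_le_divide_iff zero_le_numeral zero_le_one)
    also have "norm (u x) \<le> \<mu>" using max[OF SK[OF x(1)]] by (simp add: \<mu>_def)
    finally have "\<mu> / 2 \<le> norm (u y)" by simp
    then have "(\<mu> / 2)\<^sup>2 \<le> (norm (u y))\<^sup>2" by (intro power_mono) (auto simp: \<mu>_def)
    then show ?thesis by (simp add: power_divide)
  qed
  interpret finite_measure "lebesgue_on S" by (rule finite_measure_lebesgue_on[OF Slm])
  have meas: "(\<lambda>x. (norm (u x))\<^sup>2) \<in> borel_measurable (lebesgue_on S)"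
  proof (rule continuous_imp_measurable_on_sets_lebesgue)
    have "continuous_on S (\<lambda>x. (norm (G *v x + d))\<^sup>2)"
      by (intro continuous_intros linear_continuous_on linear_conv_bounded_linear[THEN iffD1] matrix_vector_mul_linear)
    then show "continuous_on S (\<lambda>x. (norm (u x))\<^sup>2)"
      by (rule continuous_on_eq) (use u SK in auto)
  qed (use Slm in auto)
  have int: "integrable (lebesgue_on S) (\<lambda>x. (norm (u x))\<^sup>2)"
  proof (rule integrable_const_bound[OF _ meas])
    show "AE x in lebesgue_on S. norm ((norm (u x))\<^sup>2) \<le> \<mu>\<^sup>2"
      by (rule AE_I2) (use max SK in \<open>auto simp: \<mu>_def intro!: power_mono\<close>)
  qed
  \<comment> \<open>The constant 256 is 64 times 4: shrinking by 1/4 costs the cube of 4 in volume,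
    and the modulus on the copy is at least 3/4 - 1/4 = 1/2 of the maximum, which is
    squared.\<close>
  have "measure lebesgue S / 64 * (\<mu>\<^sup>2 / 4) = integral\<^sup>L (lebesgue_on S) (\<lambda>x. indicator (f ` S) x * (\<mu>\<^sup>2 / 4))"
    using fSm fS Slm m by (simp add: measure_restrict_space Int_absorb2)
  also have "\<dots> \<le> integral\<^sup>L (lebesgue_on S) (\<lambda>x. (norm (u x))\<^sup>2)"
  proof (rule integral_mono[OF _ int])
    show "integrable (lebesgue_on S) (\<lambda>x. indicator (f ` S) x * (\<mu>\<^sup>2 / 4))"
      using fSm fS Slm by (intro integrable_mult_left integrable_real_indicator)
        (auto simp: sets_restrict_space_iff emeasure_restrict_space fmeasurable_def)
    show "indicator (f ` S) x * (\<mu>\<^sup>2 / 4) \<le> (norm (u x))\<^sup>2" for x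
      using low by (auto simp: indicator_def)
  qed
  finally show ?thesis by (simp add: S_def \<mu>_def)
qed

text \<open>After rotating \<open>a\<close> to the first axis, the set fits into a box with
  half-widths \<open>\<delta> / norm a\<close>, \<open>d\<close> and \<open>d\<close>. Read
  backwards, a lower bound for the volume limits how steep a linear function of oscillation
  \<open>\<delta>\<close> can be.\<close>

lemma measure_le_width:
  fixes S :: "(real^3) set"
  assumes S: "S \<in> lmeasurable" "S \<noteq> {}" and d: "\<And>x y. x \<in> S \<Longrightarrow> y \<in> S \<Longrightarrow> norm (x - y) \<le> d"
    and w: "\<And>x y. x \<in> S \<Longrightarrow> y \<in> S \<Longrightarrow> \<bar>a \<bullet> (x - y)\<bar> \<le> \<delta>"
  shows "norm a * measure lebesgue S \<le> 8 * d\<^sup>2 * \<delta>"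
proof (cases "a = 0")
  case True
  then show ?thesis using w \<open>S \<noteq> {}\<close> by fastforce
next
  case False
  from \<open>S \<noteq> {}\<close> obtain x0 where x0: "x0 \<in> S" by auto
  have a: "norm a > 0" using False by simp
  have n1: "norm (a /\<^sub>R norm a) = 1" "norm (axis 1 (1::real) :: real^3) = 1" using a by auto
  obtain f :: "real^3 \<Rightarrow> real^3" where f: "orthogonal_transformation f" "f (a /\<^sub>R norm a) = axis 1 (1::real)"
    by (rule orthogonal_transformation_exists_1[OF n1])
  define r :: "real^3" where "r = (\<chi> i. if i = 1 then \<delta> / norm a else d)"
  have "f ` S \<subseteq> cbox (f x0 - r) (f x0 + r)"
  proof
    fix y assume "y \<in> f ` S"
    then obtain x where x: "x \<in> S" "y = f x" by auto
    have lin: "y - f x0 = f (x - x0)" using f(1) x by (simp add: orthogonal_transformation_def linear_diff)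
    have "\<bar>(y - f x0) $ i\<bar> \<le> r $ i" for i
    proof (cases "i = 1")
      case True
      have "(y - f x0) $ 1 = f (x - x0) \<bullet> f (a /\<^sub>R norm a)" unfolding lin f(2) by (simp add: cart_eq_inner_axis)
      also have "\<dots> = (a \<bullet> (x - x0)) / norm a" using f(1)
        by (simp add: orthogonal_transformation_def inner_commute divide_inverse mult.commute)
      finally show ?thesis using w[OF x(1) x0] a True by (simp add: r_def divide_right_mono)
    next
      case False
      have "\<bar>(y - f x0) $ i\<bar> \<le> norm (f (x - x0))" unfolding lin by (rule component_le_norm_cart)
      also have "\<dots> = norm (x - x0)" using f(1) by (simp add: orthogonal_transformation)
      finally show ?thesis using d[OF x(1) x0] False by (simp add: r_def)
    qed
    then show "y \<in> cbox (f x0 - r) (f x0 + r)" by (simp add: mem_box_cart abs_diff_le_iff algebra_simps abs_le_iff)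
  qed
  then have "measure lebesgue (f ` S) \<le> measure lebesgue (cbox (f x0 - r) (f x0 + r))"
    by (intro measure_mono_fmeasurable) (use S f measurable_orthogonal_image in auto)
  also have "measure lebesgue (f ` S) = measure lebesgue S" by (rule measure_orthogonal_image[OF f(1) S(1)])
  also have "measure lebesgue (cbox (f x0 - r) (f x0 + r)) = measure lborel (cbox (f x0 - r) (f x0 + r))" by simp
  also have "\<dots> = 8 * d\<^sup>2 * (\<delta> / norm a)"
  proof -
    have "x0 \<in> S \<Longrightarrow> 0 \<le> d" "0 \<le> \<delta>" using d[OF x0 x0] w[OF x0 x0] by auto
    then have "cbox (f x0 - r) (f x0 + r) \<noteq> {}" using x0
      by (auto simp: r_def interval_ne_empty_cart)
    then have "measure lborel (cbox (f x0 - r) (f x0 + r)) = 8 * (\<Prod>i\<in>UNIV. r $ i)"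
      by (simp add: content_cbox_cart prod.distrib)
    also have "(\<Prod>i\<in>UNIV. r $ i) = \<delta> / norm a * d\<^sup>2"
      unfolding UNIV_3 by (simp add: r_def power2_eq_square)
    finally show ?thesis by simp
  qed
  finally have "measure lebesgue S \<le> (8 * d\<^sup>2 * \<delta>) / norm a" by simp
  then show ?thesis using pos_le_divide_eq[OF a] by (simp add: mult.commute)
qed

subsection \<open>Finite elements on a quasi-uniform mesh\<close>

text \<open>A Lipschitz domain lies on one side of its boundary, so no boundary point is interior to
  the closure. The mesh covers \<open>closure \<Omega>\<close> while the integrals are over
  \<open>\<Omega>\<close>; this identity puts the interiors of the elements inside
  \<open>\<Omega>\<close>.\<close>

lemma interior_closure_Lipschitz_domain:
  assumes "bounded_Lipschitz_domain \<Omega>"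
  shows "interior (closure \<Omega>) = \<Omega>"
proof
  have op: "open \<Omega>" using assms by (simp add: bounded_Lipschitz_domain_def)
  then show "\<Omega> \<subseteq> interior (closure \<Omega>)" by (simp add: closure_subset interior_maximal)
  show "interior (closure \<Omega>) \<subseteq> \<Omega>"
  proof
    fix x assume x: "x \<in> interior (closure \<Omega>)"
    show "x \<in> \<Omega>"
    proof (rule ccontr)
      assume nx: "x \<notin> \<Omega>"
      have "x \<in> closure \<Omega>" using x interior_subset by auto
      then have "x \<in> frontier \<Omega>" using nx op by (simp add: frontier_def interior_open)
      then have "\<exists>r>0. \<exists>R :: real^3 \<Rightarrow> real^3. \<exists>g :: real \<times> real \<Rightarrow> real. \<exists>B.
          orthogonal_transformation R \<and> B-lipschitz_on UNIV g \<and>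
          \<Omega> \<inter> ball x r = {y \<in> ball x r. g (R y $ 1, R y $ 2) < R y $ 3}"
        using assms unfolding bounded_Lipschitz_domain_def by simp
      then obtain r R g B where r: "r > 0" and R: "orthogonal_transformation (R :: real^3 \<Rightarrow> real^3)"
        and g: "B-lipschitz_on UNIV (g :: real \<times> real \<Rightarrow> real)"
        and eq: "\<Omega> \<inter> ball x r = {y \<in> ball x r. g (R y $ 1, R y $ 2) < R y $ 3}"
        by blast
      have ge: "R x $ 3 \<le> g (R x $ 1, R x $ 2)" using nx eq r by force
      obtain e where e: "e > 0" "ball x e \<subseteq> closure \<Omega>" using x by (meson mem_interior)
      define t where "t = min r e / 2"
      have t: "0 < t" "t < r" "t < e" using r e by (auto simp: t_def)
      \<comment> \<open>Moving from the boundary point against the graph direction \<open>w\<close>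
        leads strictly below the graph, into an open set disjoint from the domain.\<close>
      obtain w where w: "R w = axis 3 1" using R orthogonal_transformation_surj by (metis surjD)
      have nw: "norm w = 1" using R w by (metis norm_axis_1 orthogonal_transformation_norm)
      define y where "y = x - t *\<^sub>R w"
      have Ry: "R y = R x - t *\<^sub>R axis 3 1"
        using R by (simp add: y_def w[symmetric] orthogonal_transformation_def linear_diff linear_cmul)
      have dy: "dist x y = t" using nw t by (simp add: y_def dist_norm)
      have lin: "linear R" using R by (simp add: orthogonal_transformation_def)
      have contR: "continuous_on UNIV R" using lin linear_continuous_on linear_conv_bounded_linear by blast
      have contg: "continuous_on UNIV g" using g by (rule lipschitz_on_continuous_on)
      have "continuous_on UNIV (\<lambda>z. g (R z $ 1, R z $ 2) - R z $ 3)"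
        by (intro continuous_intros continuous_on_compose2[OF contg] contR) auto
      then have "open {z. 0 < g (R z $ 1, R z $ 2) - R z $ 3}"
        by (intro open_Collect_less) auto
      then have "open ({z. 0 < g (R z $ 1, R z $ 2) - R z $ 3} \<inter> ball x r)" by auto
      moreover have "y \<in> {z. 0 < g (R z $ 1, R z $ 2) - R z $ 3} \<inter> ball x r"
        using Ry ge t dy by (simp add: axis_def)
      moreover have "{z. 0 < g (R z $ 1, R z $ 2) - R z $ 3} \<inter> ball x r \<inter> \<Omega> = {}"
        using eq by force
      ultimately have "y \<notin> closure \<Omega>" by (metis (no_types, lifting) Int_commute IntI empty_iff open_Int_closure_eq_empty)
      moreover have "y \<in> closure \<Omega>" using e(2) dy t by auto
      ultimately show False by simp
    qed
  qed
qed

locale fem_mesh =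
  fixes c h :: real and \<Omega> :: "(real^3) set" and \<T> :: "(real^3) set set"
  assumes domain: "bounded_Lipschitz_domain \<Omega>" and mesh: "quasi_uniform_mesh c h \<Omega> \<T>"
begin

section \<open>Elementary geometry of the mesh\<close>

lemma h_pos: "h > 0" and fin: "finite \<T>" and Union_mesh: "\<Union>\<T> = closure \<Omega>"
  using mesh by (auto simp: quasi_uniform_mesh_def triangulation_def)

lemma open_domain: "open \<Omega>" and domain_nonempty: "\<Omega> \<noteq> {}" and domain_lmeasurable: "\<Omega> \<in> lmeasurable"
  using domain by (auto simp: bounded_Lipschitz_domain_def intro: lmeasurable_open)

lemma domain_sets[measurable]: "\<Omega> \<in> sets lebesgue"
  using domain_lmeasurable by auto

lemma mesh_nonempty: "\<T> \<noteq> {}"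
  using Union_mesh domain_nonempty by (metis Union_empty closure_eq_empty)

lemma element:
  assumes "K \<in> \<T>"
  shows compact_element: "compact K" and convex_element: "convex K"
    and hull_element: "K = convex hull {v. v extreme_point_of K}"
    and finite_vertices: "finite {v. v extreme_point_of K}"
proof -
  obtain n where n: "n simplex K" using mesh assms by (auto simp: quasi_uniform_mesh_def)
  then show "compact K" "convex K" by (auto simp: compact_simplex convex_simplex)
  then show "K = convex hull {v. v extreme_point_of K}" by (rule Krein_Milman_Minkowski)
  show "finite {v. v extreme_point_of K}"
    using n simplex_imp_polytope finite_polyhedron_extreme_points polytope_imp_polyhedron by blast
qed

lemma interior_subset_domain: "K \<in> \<T> \<Longrightarrow> interior K \<subseteq> \<Omega>"
  using interior_closure_Lipschitz_domain[OF domain] Union_mesh interior_mono[of K "closure \<Omega>"] by auto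

lemma interior_lmeasurable: "K \<in> \<T> \<Longrightarrow> interior K \<in> lmeasurable"
  by (meson bounded_interior compact_element compact_imp_bounded lmeasurable_open open_interior)

lemma measure_interior_ge: assumes K: "K \<in> \<T>" shows "h ^ 3 \<le> measure lebesgue (interior K)"
proof -
  have "measure lebesgue (interior K) = measure lebesgue K"
    using K by (intro measure_interior negligible_convex_frontier)
      (auto simp: convex_element compact_element compact_imp_bounded)
  moreover have "h \<le> root 3 (measure lebesgue K)" using mesh K by (auto simp: quasi_uniform_mesh_def)
  then have "h ^ 3 \<le> (root 3 (measure lebesgue K)) ^ 3" using h_pos by (intro power_mono) auto
  ultimately show ?thesis by simp
qed

lemma interior_nonempty: "K \<in> \<T> \<Longrightarrow> interior K \<noteq> {}"
  using measure_interior_ge[of K] h_pos by (metis measure_empty not_less zero_less_power)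

lemma element_nonempty: "K \<in> \<T> \<Longrightarrow> K \<noteq> {}"
  using interior_nonempty interior_subset by blast

lemma element_diameter: assumes "K \<in> \<T>" "x \<in> K" "y \<in> K" shows "norm (x - y) \<le> c * h"
proof -
  have "dist x y \<le> diameter K" using assms compact_element compact_imp_bounded diameter_bounded_bound by blast
  also have "\<dots> \<le> c * h" using mesh assms by (auto simp: quasi_uniform_mesh_def)
  finally show ?thesis by (simp add: dist_norm)
qed

text \<open>The chain of inequalities in quasi-uniformity forces this as soon as one element exists;
  it is what allows powers of \<open>c\<close> to be enlarged later.\<close>

lemma c_ge_1: "c \<ge> 1"
proof -
  obtain K where "K \<in> \<T>" using mesh_nonempty by auto
  then have "h \<le> root 3 (measure lebesgue K) \<and> root 3 (measure lebesgue K) \<le> diameter K \<and> diameter K \<le> c * h"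
    using mesh unfolding quasi_uniform_mesh_def by blast
  then have "h \<le> c * h" by linarith
  then show ?thesis using h_pos by simp
qed

text \<open>Two elements meet in a common face, and a proper face misses the interior. If the face
  is all of \<open>K\<close>, it is a proper face of the other element because the elements
  differ.\<close>

lemma disjoint_interiors: "disjoint_family_on interior \<T>"
  unfolding disjoint_family_on_def
proof (intro ballI impI)
  fix K K' assume K: "K \<in> \<T>" "K' \<in> \<T>" "K \<noteq> K'"
  have f: "(K \<inter> K') face_of K" "(K' \<inter> K) face_of K'"
    using mesh K by (auto simp: quasi_uniform_mesh_def triangulation_def)
  show "interior K \<inter> interior K' = {}"
  proof (cases "K \<inter> K' = K")
    case False
    then have "(K \<inter> K') \<inter> interior K = {}" using f by (intro face_of_disjoint_interior)
    then show ?thesis using interior_subset by blast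
  next
    case True
    then have "K' \<inter> K \<noteq> K'" using K by auto
    then have "(K' \<inter> K) \<inter> interior K' = {}" using f by (intro face_of_disjoint_interior)
    then show ?thesis using interior_subset by blast
  qed
qed

text \<open>What is left over lies in finitely many frontiers of convex sets, hence in a null set.
  Integrals over the domain can therefore be computed where finite element functions are affine and
  differentiable.\<close>

lemma AE_domain_interior: "AE x in lebesgue. (x \<in> \<Omega>) = (x \<in> (\<Union>K\<in>\<T>. interior K))"
proof -
  have "negligible (\<Union>K\<in>\<T>. frontier K)"
    using fin convex_element by (intro negligible_Union) (auto intro: negligible_convex_frontier)
  then have "(\<Union>K\<in>\<T>. frontier K) \<in> null_sets lebesgue" by (simp add: negligible_iff_null_sets)
  moreover have "{x \<in> space lebesgue. \<not> (x \<in> \<Omega>) = (x \<in> (\<Union>K\<in>\<T>. interior K))} \<subseteq> (\<Union>K\<in>\<T>. frontier K)"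
  proof
    fix x assume "x \<in> {x \<in> space lebesgue. \<not> (x \<in> \<Omega>) = (x \<in> (\<Union>K\<in>\<T>. interior K))}"
    then have x: "x \<in> \<Omega>" "x \<notin> (\<Union>K\<in>\<T>. interior K)" using interior_subset_domain by auto
    then have "x \<in> \<Union>\<T>" using Union_mesh subsetD[OF closure_subset] by auto
    then obtain K where "K \<in> \<T>" "x \<in> K" by auto
    then show "x \<in> (\<Union>K\<in>\<T>. frontier K)" using x closure_subset by (auto simp: frontier_def)
  qed
  ultimately show ?thesis by (intro AE_I') auto
qed

lemma AE_mesh:
  assumes "\<And>K x. K \<in> \<T> \<Longrightarrow> x \<in> interior K \<Longrightarrow> P x"
  shows "AE x in lebesgue_on \<Omega>. P x"
  using AE_domain_interior assms by (auto simp: AE_restrict_space_iff)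

text \<open>A nonempty open set is not negligible. Applied to piecewise constant gradients, one such
  point per element turns an essential bound into a bound throughout the interior.\<close>

lemma AE_interior:
  assumes "AE x in lebesgue_on \<Omega>. P x" "K \<in> \<T>"
  obtains x where "x \<in> interior K" "P x"
proof -
  have "\<exists>x\<in>interior K. P x"
  proof (rule ccontr)
    assume "\<not> (\<exists>x\<in>interior K. P x)"
    moreover have "AE x in lebesgue. x \<in> \<Omega> \<longrightarrow> P x" using assms by (simp add: AE_restrict_space_iff)
    ultimately have "AE x in lebesgue. x \<notin> interior K"
      using interior_subset_domain[OF assms(2)] by (auto elim!: eventually_mono)
    then have "negligible (interior K)"
      unfolding negligible_iff_null_sets by (simp add: AE_iff_null_sets null_setsI)
    then show False using interior_nonempty[OF assms(2)] open_not_negligible by blast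
  qed
  then show ?thesis using that by auto
qed

lemma indicator_sum_interiors:
  "indicator (\<Union>K\<in>\<T>. interior K) x *\<^sub>R (f x :: 'b::real_vector) = (\<Sum>K\<in>\<T>. indicator (interior K) x *\<^sub>R f x)"
proof -
  have "indicator (\<Union>K\<in>\<T>. interior K) x = (\<Sum>K\<in>\<T>. indicator (interior K) x :: real)"
    by (rule indicator_UN_disjoint[OF fin disjoint_interiors])
  then show ?thesis by (simp add: scaleR_sum_left)
qed

lemma borel_measurable_mesh:
  fixes f :: "real^3 \<Rightarrow> 'b::euclidean_space"
  assumes "\<And>K. K \<in> \<T> \<Longrightarrow> f \<in> borel_measurable (lebesgue_on (interior K))"
  shows "f \<in> borel_measurable (lebesgue_on \<Omega>)"
proof -
  have "(\<lambda>x. indicator (\<Union>K\<in>\<T>. interior K) x *\<^sub>R f x) \<in> borel_measurable lebesgue"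
    unfolding indicator_sum_interiors
    using assms by (intro borel_measurable_sum) (simp add: borel_measurable_restrict_space_iff)
  moreover have "AE x in lebesgue. indicator (\<Union>K\<in>\<T>. interior K) x *\<^sub>R f x = indicator \<Omega> x *\<^sub>R f x"
    using AE_domain_interior by eventually_elim (simp add: indicator_def)
  ultimately have "(\<lambda>x. indicator \<Omega> x *\<^sub>R f x) \<in> borel_measurable lebesgue" by (rule borel_measurable_AE)
  then show ?thesis by (simp add: borel_measurable_restrict_space_iff)
qed

lemma integral_mesh:
  fixes f :: "real^3 \<Rightarrow> 'b::euclidean_space"
  assumes "\<And>K. K \<in> \<T> \<Longrightarrow> integrable (lebesgue_on (interior K)) f"
  shows "integrable (lebesgue_on \<Omega>) f"
    and "integral\<^sup>L (lebesgue_on \<Omega>) f = (\<Sum>K\<in>\<T>. integral\<^sup>L (lebesgue_on (interior K)) f)"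
proof -
  have m: "(\<lambda>x. indicator \<Omega> x *\<^sub>R f x) \<in> borel_measurable lebesgue"
    using borel_measurable_mesh[of f] assms borel_measurable_integrable
    by (auto simp: borel_measurable_restrict_space_iff[symmetric])
  have i: "integrable lebesgue (\<lambda>x. indicator (interior K) x *\<^sub>R f x)" if "K \<in> \<T>" for K
    using assms[OF that] by (simp add: integrable_restrict_space)
  have ae: "AE x in lebesgue. (\<Sum>K\<in>\<T>. indicator (interior K) x *\<^sub>R f x) = indicator \<Omega> x *\<^sub>R f x"
    using AE_domain_interior unfolding indicator_sum_interiors[symmetric] by eventually_elim (simp add: indicator_def)
  have is': "integrable lebesgue (\<lambda>x. \<Sum>K\<in>\<T>. indicator (interior K) x *\<^sub>R f x)"
    using i by (rule Bochner_Integration.integrable_sum)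
  then have "integrable lebesgue (\<lambda>x. indicator \<Omega> x *\<^sub>R f x)"
    using integrable_cong_AE[OF borel_measurable_integrable[OF is'] m ae] by simp
  then show "integrable (lebesgue_on \<Omega>) f" by (simp add: integrable_restrict_space)
  have "integral\<^sup>L (lebesgue_on \<Omega>) f = integral\<^sup>L lebesgue (\<lambda>x. \<Sum>K\<in>\<T>. indicator (interior K) x *\<^sub>R f x)"
    using integral_cong_AE[OF borel_measurable_integrable[OF is'] m ae] by (simp add: integral_restrict_space)
  also have "\<dots> = (\<Sum>K\<in>\<T>. integral\<^sup>L (lebesgue_on (interior K)) f)"
    using i by (simp add: Bochner_Integration.integral_sum integral_restrict_space)
  finally show "integral\<^sup>L (lebesgue_on \<Omega>) f = (\<Sum>K\<in>\<T>. integral\<^sup>L (lebesgue_on (interior K)) f)" .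
qed

section \<open>Finite element functions on a single element\<close>

lemma fe_affine:
  assumes u: "u \<in> S_h_vec \<Omega> \<T>" and K: "K \<in> \<T>"
  obtains G d where "\<And>x. x \<in> K \<Longrightarrow> u x = G *v x + d"
    and "\<And>x. x \<in> interior K \<Longrightarrow> (u has_derivative (\<lambda>y. G *v y)) (at x)"
    and "\<And>x. x \<in> interior K \<Longrightarrow> grad u x = G"
proof -
  have "\<forall>i. \<exists>a b. \<forall>x\<in>K. u x $ i = a \<bullet> x + b" using u K by (auto simp: S_h_vec_def S_h_def)
  then obtain a b where ab: "\<And>i x. x \<in> K \<Longrightarrow> u x $ i = a i \<bullet> x + b i" by metis
  define G :: "real^3^3" where "G = (\<chi> i. a i)"
  define d :: "real^3" where "d = (\<chi> i. b i)"
  have 1: "u x = G *v x + d" if "x \<in> K" for x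
    using ab[OF that]
    by (simp add: Finite_Cartesian_Product.vec_eq_iff G_def d_def matrix_vector_mult_def inner_vec_def)
  have 2: "(u has_derivative (\<lambda>y. G *v y)) (at x)" if x: "x \<in> interior K" for x
  proof (rule has_derivative_transform_within_open[OF _ open_interior x])
    show "((\<lambda>x. G *v x + d) has_derivative (\<lambda>y. G *v y)) (at x)"
      by (intro has_derivative_add_const bounded_linear_imp_has_derivative
          linear_conv_bounded_linear[THEN iffD1] matrix_vector_mul_linear)
    show "G *v y + d = u y" if "y \<in> interior K" for y
      by (rule 1[symmetric]) (rule subsetD[OF interior_subset that])
  qed
  have 3: "grad u x = G" if "x \<in> interior K" for x
  proof -
    have "frechet_derivative u (at x) = (\<lambda>y. G *v y)" by (rule frechet_derivative_at[OF 2[OF that], symmetric])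
    then show ?thesis unfolding grad_def by (simp only: matrix_of_matrix_vector_mul)
  qed
  show ?thesis by (rule that[OF 1 2 3])
qed

text \<open>The element is the hull of its finitely many vertices, so an affine function has maximal
  modulus at one of them. That the point is a vertex makes nodal conditions applicable to
  it.\<close>

lemma fe_maximum:
  assumes u: "u \<in> S_h_vec \<Omega> \<T>" and K: "K \<in> \<T>"
  obtains z where "z extreme_point_of K" "z \<in> K" "\<And>x. x \<in> K \<Longrightarrow> norm (u x) \<le> norm (u z)"
proof -
  let ?V = "{v. v extreme_point_of K}"
  have "?V \<noteq> {}" using hull_element[OF K] element_nonempty[OF K] by (metis convex_hull_eq_empty)
  then obtain z where z: "z \<in> ?V" "\<And>v. v \<in> ?V \<Longrightarrow> norm (u v) \<le> norm (u z)"
  proof -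
    have "Max ((\<lambda>v. norm (u v)) ` ?V) \<in> (\<lambda>v. norm (u v)) ` ?V"
      using finite_vertices[OF K] \<open>?V \<noteq> {}\<close> by (intro Max_in) auto
    then obtain z where "z \<in> ?V" "norm (u z) = Max ((\<lambda>v. norm (u v)) ` ?V)" by auto
    then show ?thesis using finite_vertices[OF K] by (intro that[of z]) auto
  qed
  obtain G d where "\<And>x. x \<in> K \<Longrightarrow> u x = G *v x + d" using fe_affine[OF u K] by metis
  then have "norm (u x) \<le> norm (u z)" if "x \<in> K" for x
    using norm_affine_le_on_hull[of ?V u G d "norm (u z)" x] hull_element[OF K] z that by auto
  moreover have "z \<in> K" using z by (simp add: extreme_point_of_def)
  ultimately show ?thesis using that z by auto
qed

text \<open>Each row of \<open>G\<close> is the slope of a component with oscillation at most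
  \<open>\<delta>\<close>; width against volume, with diameter \<open>c * h\<close> and volume at
  least \<open>h ^ 3\<close>, bounds it by \<open>8 * c\<^sup>2 * \<delta> / h\<close>. The three
  rows add up to 24.\<close>

lemma fe_gradient_le:
  fixes u :: "real^3 \<Rightarrow> real^3"
  assumes K: "K \<in> \<T>" and u: "\<And>x. x \<in> K \<Longrightarrow> u x = G *v x + d"
    and \<delta>: "\<And>v w. v extreme_point_of K \<Longrightarrow> w extreme_point_of K \<Longrightarrow> norm (u v - u w) \<le> \<delta>"
  shows "norm G \<le> 24 * c\<^sup>2 * \<delta> / h"
proof -
  let ?V = "{v. v extreme_point_of K}"
  have VK: "v \<in> K" if "v \<in> ?V" for v using that by (simp add: extreme_point_of_def)
  \<comment> \<open>The oscillation bound spreads from vertices to all points one argument at a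
    time.\<close>
  have 1: "norm (u x - u w) \<le> \<delta>" if "x \<in> K" "w \<in> ?V" for x w
    by (rule norm_affine_le_on_hull[where V="?V" and G=G and d="d - u w" and u="\<lambda>x. u x - u w"])
      (use that u \<delta> hull_element[OF K] in auto)
  have 2: "norm (u x - u y) \<le> \<delta>" if "x \<in> K" "y \<in> K" for x y
  proof -
    have "norm (u y - u x) \<le> \<delta>"
    proof (rule norm_affine_le_on_hull[where V="?V" and G=G and d="d - u x" and u="\<lambda>y. u y - u x"])
      show "norm (u v - u x) \<le> \<delta>" if "v \<in> ?V" for v
        using 1[OF \<open>x \<in> K\<close> that] by (simp add: norm_minus_commute)
    qed (use that u hull_element[OF K] in auto)
    then show ?thesis by (simp add: norm_minus_commute)
  qed
  have "norm (G $ i) \<le> 8 * c\<^sup>2 * \<delta> / h" for i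
  proof -
    have int: "x \<in> K" if "x \<in> interior K" for x using that interior_subset by auto
    have "norm (G $ i) * measure lebesgue (interior K) \<le> 8 * (c * h)\<^sup>2 * \<delta>"
    proof (rule measure_le_width[OF interior_lmeasurable[OF K] interior_nonempty[OF K]])
      fix x y assume "x \<in> interior K" "y \<in> interior K"
      then have xy: "x \<in> K" "y \<in> K" using int by auto
      show "norm (x - y) \<le> c * h" by (rule element_diameter[OF K xy])
      have "G $ i \<bullet> (x - y) = (u x - u y) $ i"
        using xy u by (simp add: matrix_vector_mult_def inner_vec_def algebra_simps sum_subtractf)
      then show "\<bar>G $ i \<bullet> (x - y)\<bar> \<le> \<delta>" using 2[OF xy] component_le_norm_cart[of "u x - u y" i] by simp
    qed
    moreover have "norm (G $ i) * h ^ 3 \<le> norm (G $ i) * measure lebesgue (interior K)"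
      by (intro mult_left_mono measure_interior_ge K) auto
    ultimately have "norm (G $ i) * h ^ 3 \<le> 8 * (c * h)\<^sup>2 * \<delta>" by linarith
    then show ?thesis using h_pos by (simp add: field_simps power2_eq_square power3_eq_cube)
  qed
  then have "(\<Sum>i\<in>UNIV. norm (G $ i)) \<le> (\<Sum>i\<in>(UNIV::3 set). 8 * c\<^sup>2 * \<delta> / h)" by (rule sum_mono)
  then show ?thesis using norm_matrix_le_sum_rows[of G] by simp
qed


text \<open>A class that contains all ingredients of the matrices and is preserved by the products
  and sums formed from them. On the domain, which has finite measure, it yields integrability, and
  on it \<open>Linf_norm\<close> is a genuine bound.\<close>

definition ess_bounded :: "(real^3 \<Rightarrow> 'b::euclidean_space) \<Rightarrow> bool" where
  "ess_bounded f \<longleftrightarrow> f \<in> borel_measurable (lebesgue_on \<Omega>) \<and> (\<exists>B. AE x in lebesgue_on \<Omega>. norm (f x) \<le> B)"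

lemma ess_boundedI:
  assumes "f \<in> borel_measurable (lebesgue_on \<Omega>)" "AE x in lebesgue_on \<Omega>. norm (f x) \<le> B"
  shows "ess_bounded f"
  using assms by (auto simp: ess_bounded_def)

lemma ess_bounded_integrable: "ess_bounded f \<Longrightarrow> integrable (lebesgue_on \<Omega>) f"
  using finite_measure.integrable_const_bound[OF finite_measure_lebesgue_on[OF domain_lmeasurable]]
  by (auto simp: ess_bounded_def)

lemma ess_bounded_bilinear:
  assumes "bounded_bilinear b" "ess_bounded f" "ess_bounded g"
    and [measurable]: "(\<lambda>x. b (f x) (g x)) \<in> borel_measurable (lebesgue_on \<Omega>)"
  shows "ess_bounded (\<lambda>x. b (f x) (g x))"
proof -
  obtain C where C: "C \<ge> 0" "\<And>x y. norm (b x y) \<le> norm x * norm y * C"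
    using bounded_bilinear.nonneg_bounded[OF assms(1)] by auto
  obtain B1 B2 where "AE x in lebesgue_on \<Omega>. norm (f x) \<le> B1" "AE x in lebesgue_on \<Omega>. norm (g x) \<le> B2"
    using assms by (auto simp: ess_bounded_def)
  then have "AE x in lebesgue_on \<Omega>. norm (b (f x) (g x)) \<le> B1 * B2 * C"
  proof eventually_elim
    case (elim x)
    have "norm (b (f x) (g x)) \<le> norm (f x) * norm (g x) * C" by (rule C)
    also have "\<dots> \<le> B1 * B2 * C" using elim C(1) order.trans[OF norm_ge_zero elim(1)]
      by (intro mult_right_mono mult_mono) auto
    finally show ?case .
  qed
  then show ?thesis using assms(4) by (rule ess_boundedI[rotated])
qed

lemma ess_bounded_inner: "ess_bounded f \<Longrightarrow> ess_bounded g \<Longrightarrow> ess_bounded (\<lambda>x. f x \<bullet> g x)"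
  by (rule ess_bounded_bilinear[OF bounded_bilinear_inner]) (auto simp: ess_bounded_def intro: borel_measurable_inner)

lemma ess_bounded_scaleR: "ess_bounded f \<Longrightarrow> ess_bounded g \<Longrightarrow> ess_bounded (\<lambda>x. f x *\<^sub>R g x)"
  by (rule ess_bounded_bilinear[OF bounded_bilinear_scaleR]) (auto simp: ess_bounded_def intro: borel_measurable_scaleR)

lemma ess_bounded_cross3: "ess_bounded f \<Longrightarrow> ess_bounded g \<Longrightarrow> ess_bounded (\<lambda>x. cross3 (f x) (g x))"
proof -
  assume fg: "ess_bounded f" "ess_bounded g"
  then have "f \<in> borel_measurable (lebesgue_on \<Omega>)" "g \<in> borel_measurable (lebesgue_on \<Omega>)"
    by (auto simp: ess_bounded_def)
  then have "(\<lambda>x. cross3 (f x) (g x)) \<in> borel_measurable (lebesgue_on \<Omega>)"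
    by (rule borel_measurable_continuous_Pair) (intro continuous_on_cross continuous_intros)
  then show ?thesis
    using ess_bounded_bilinear[of cross3 f g] fg bilinear_conv_bounded_bilinear bilinear_cross by blast
qed

lemma ess_bounded_add: assumes "ess_bounded f" "ess_bounded g" shows "ess_bounded (\<lambda>x. f x + g x)"
proof -
  obtain B1 B2 where "AE x in lebesgue_on \<Omega>. norm (f x) \<le> B1" "AE x in lebesgue_on \<Omega>. norm (g x) \<le> B2"
    using assms by (auto simp: ess_bounded_def)
  then have "AE x in lebesgue_on \<Omega>. norm (f x + g x) \<le> B1 + B2"
    by eventually_elim (metis add_mono norm_triangle_le)
  then show ?thesis using assms by (intro ess_boundedI) (auto simp: ess_bounded_def)
qed

lemma ess_bounded_const: "ess_bounded (\<lambda>x. a)"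
  by (rule ess_boundedI[of _ "norm a"]) auto

lemma fe_continuous: "u \<in> S_h_vec \<Omega> \<T> \<Longrightarrow> continuous_on (closure \<Omega>) u"
  using continuous_on_vec_lambda[of "closure \<Omega>" "\<lambda>i x. u x $ i"] by (auto simp: S_h_vec_def S_h_def)

lemma fe_ess_bounded:
  assumes u: "u \<in> S_h_vec \<Omega> \<T>" shows "ess_bounded u"
proof -
  have c: "continuous_on \<Omega> u" using fe_continuous[OF u] continuous_on_subset closure_subset by blast
  have "compact (closure \<Omega>)" using domain by (auto simp: bounded_Lipschitz_domain_def compact_closure)
  then have "bounded (u ` closure \<Omega>)" using fe_continuous[OF u] compact_continuous_image compact_imp_bounded by blast
  then obtain B where "\<And>x. x \<in> closure \<Omega> \<Longrightarrow> norm (u x) \<le> B" by (auto simp: bounded_iff)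
  then have "AE x in lebesgue_on \<Omega>. norm (u x) \<le> B"
    using subsetD[OF closure_subset[of \<Omega>]] by (intro AE_I2) auto
  then show ?thesis
    using continuous_imp_measurable_on_sets_lebesgue[OF c] by (intro ess_boundedI) auto
qed

lemma fe_grad_ess_bounded:
  assumes u: "u \<in> S_h_vec \<Omega> \<T>" shows "ess_bounded (grad u)"
proof -
  have "\<exists>G. \<forall>x\<in>interior K. grad u x = G" if "K \<in> \<T>" for K using fe_affine[OF u that] by metis
  then obtain G where G: "\<And>K x. K \<in> \<T> \<Longrightarrow> x \<in> interior K \<Longrightarrow> grad u x = G K" by metis
  have "grad u \<in> borel_measurable (lebesgue_on (interior K))" if "K \<in> \<T>" for K
  proof -
    have "(\<lambda>x. G K) \<in> borel_measurable (lebesgue_on (interior K))" by simp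
    then show ?thesis by (rule measurable_cong[THEN iffD1, rotated]) (use G[OF that] in auto)
  qed
  then have "grad u \<in> borel_measurable (lebesgue_on \<Omega>)" by (rule borel_measurable_mesh)
  moreover have "norm (grad u x) \<le> (\<Sum>K\<in>\<T>. norm (G K))" if "K \<in> \<T>" "x \<in> interior K" for K x
    using G[OF that] member_le_sum[of K \<T> "\<lambda>K. norm (G K)"] that fin by simp
  then have "AE x in lebesgue_on \<Omega>. norm (grad u x) \<le> (\<Sum>K\<in>\<T>. norm (G K))" by (rule AE_mesh)
  ultimately show ?thesis by (rule ess_boundedI)
qed

text \<open>Boundedness excludes an infinite essential supremum, for which
  \<open>real_of_ereal\<close> would return 0. Nonnegativity follows by evaluating the bound at one
  point.\<close>

lemma ess_bounded_Linf:
  assumes f: "ess_bounded f"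
  shows "AE x in lebesgue_on \<Omega>. norm (f x) \<le> Linf_norm \<Omega> f" and "0 \<le> Linf_norm \<Omega> f"
proof -
  obtain B where B: "AE x in lebesgue_on \<Omega>. norm (f x) \<le> B" and m: "f \<in> borel_measurable (lebesgue_on \<Omega>)"
    using f by (auto simp: ess_bounded_def)
  define e where "e = esssup (lebesgue_on \<Omega>) (\<lambda>x. ereal (norm (f x)))"
  have "e \<le> ereal B" unfolding e_def using B m by (intro esssup_I) auto
  then have "e \<noteq> \<infinity>" by auto
  have ae: "AE x in lebesgue_on \<Omega>. ereal (norm (f x)) \<le> e" unfolding e_def by (rule esssup_AE)
  show *: "AE x in lebesgue_on \<Omega>. norm (f x) \<le> Linf_norm \<Omega> f"
    using ae
  proof eventually_elim
    case (elim x)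
    then show ?case using \<open>e \<noteq> \<infinity>\<close> unfolding Linf_norm_def e_def[symmetric] by (cases e) auto
  qed
  obtain K where "K \<in> \<T>" using mesh_nonempty by auto
  with * obtain x where "norm (f x) \<le> Linf_norm \<Omega> f" by (rule AE_interior)
  then show "0 \<le> Linf_norm \<Omega> f" using norm_ge_zero order.trans by blast
qed

text \<open>Between the nodes the field may shorten but never lengthen, since the maximal modulus is
  attained at a vertex. This controls the cross product term.\<close>

lemma fe_norm_le_1:
  assumes m: "m \<in> M_h \<Omega> \<T>" and K: "K \<in> \<T>" "x \<in> K"
  shows "norm (m x) \<le> 1"
proof -
  have u: "m \<in> S_h_vec \<Omega> \<T>" using m by (simp add: M_h_def)
  obtain z where "z extreme_point_of K" "\<And>x. x \<in> K \<Longrightarrow> norm (m x) \<le> norm (m z)"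
    using fe_maximum[OF u K(1)] by metis
  moreover then have "norm (m z) = 1" using m K by (auto simp: M_h_def mesh_nodes_def)
  ultimately show ?thesis using K by metis
qed

lemma fe_max_le_integral:
  assumes u: "u \<in> S_h_vec \<Omega> \<T>" and K: "K \<in> \<T>" and x: "x \<in> K"
  shows "measure lebesgue (interior K) * (norm (u x))\<^sup>2
    \<le> 256 * integral\<^sup>L (lebesgue_on (interior K)) (\<lambda>x. (norm (u x))\<^sup>2)"
proof -
  obtain z where z: "z \<in> K" "\<And>x. x \<in> K \<Longrightarrow> norm (u x) \<le> norm (u z)" using fe_maximum[OF u K] by metis
  obtain G d where "\<And>x. x \<in> K \<Longrightarrow> u x = G *v x + d" using fe_affine[OF u K] by metis
  then have "measure lebesgue (interior K) * (norm (u z))\<^sup>2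
    \<le> 256 * integral\<^sup>L (lebesgue_on (interior K)) (\<lambda>x. (norm (u x))\<^sup>2)"
    using z K by (intro affine_max_le_integral) (auto simp: convex_element compact_element)
  moreover have "measure lebesgue (interior K) * (norm (u x))\<^sup>2 \<le> measure lebesgue (interior K) * (norm (u z))\<^sup>2"
    using z x by (intro mult_left_mono power_mono) auto
  ultimately show ?thesis by linarith
qed

lemma ess_bounded_integrable_interior:
  assumes "ess_bounded f" "K \<in> \<T>"
  shows "integrable (lebesgue_on (interior K)) f"
proof -
  have "integrable lebesgue (\<lambda>x. indicator (interior K) x *\<^sub>R (indicator \<Omega> x *\<^sub>R f x))"
    using ess_bounded_integrable[OF assms(1)]
    by (intro integrable_mult_indicator[of "interior K" lebesgue "\<lambda>x. indicator \<Omega> x *\<^sub>R f x"])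
      (simp_all add: integrable_restrict_space)
  also have "(\<lambda>x. indicator (interior K) x *\<^sub>R (indicator \<Omega> x *\<^sub>R f x)) = (\<lambda>x. indicator (interior K) x *\<^sub>R f x)"
    using interior_subset_domain[OF assms(2)] by (auto simp: indicator_def fun_eq_iff)
  finally show ?thesis by (simp add: integrable_restrict_space)
qed

lemma norm_sq_integrable_interior:
  "ess_bounded f \<Longrightarrow> K \<in> \<T> \<Longrightarrow> integrable (lebesgue_on (interior K)) (\<lambda>x. (norm (f x))\<^sup>2)"
  unfolding power2_norm_eq_inner by (intro ess_bounded_integrable_interior ess_bounded_inner)

lemma fe_grad_integral:
  assumes u: "u \<in> S_h_vec \<Omega> \<T>" and K: "K \<in> \<T>" and G: "\<And>x. x \<in> interior K \<Longrightarrow> grad u x = G"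
  shows "integral\<^sup>L (lebesgue_on (interior K)) (\<lambda>x. (norm (grad u x))\<^sup>2) = measure lebesgue (interior K) * (norm G)\<^sup>2"
proof -
  have "integral\<^sup>L (lebesgue_on (interior K)) (\<lambda>x. (norm (grad u x))\<^sup>2) = integral\<^sup>L (lebesgue_on (interior K)) (\<lambda>x. (norm G)\<^sup>2)"
    by (rule Bochner_Integration.integral_cong) (use G in auto)
  also have "\<dots> = measure lebesgue (interior K) * (norm G)\<^sup>2"
    by (simp add: measure_restrict_space)
  finally show ?thesis .
qed

text \<open>The nodal projection onto the planes orthogonal to \<open>m\<close>. For \<open>\<kappa> = 1 / h\<close> the second bound is an
  inverse estimate; otherwise the oscillation of the nodal values of \<open>(m \<bullet> u) m\<close> is controlled by the gradient of \<open>m\<close>.\<close>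

lemma projection_stability_element:
  assumes u: "u \<in> S_h_vec \<Omega> \<T>" and w: "w \<in> S_h_vec \<Omega> \<T>" and m: "m \<in> M_h \<Omega> \<T>" and K: "K \<in> \<T>"
    and proj: "\<And>z. z \<in> mesh_nodes \<T> \<Longrightarrow> w z = u z - (m z \<bullet> u z) *\<^sub>R m z"
    and \<kappa>: "\<kappa> \<ge> 0" "\<kappa> = 1 / h \<or> (\<forall>x\<in>interior K. norm (grad m x) \<le> \<kappa>)"
  shows "integral\<^sup>L (lebesgue_on (interior K)) (\<lambda>x. (norm (w x))\<^sup>2)
      \<le> 256 * integral\<^sup>L (lebesgue_on (interior K)) (\<lambda>x. (norm (u x))\<^sup>2)" (is ?A)
    and "integral\<^sup>L (lebesgue_on (interior K)) (\<lambda>x. (norm (grad w x))\<^sup>2)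
      \<le> 1179648 * c ^ 6 * (integral\<^sup>L (lebesgue_on (interior K)) (\<lambda>x. (norm (grad u x))\<^sup>2)
          + \<kappa>\<^sup>2 * integral\<^sup>L (lebesgue_on (interior K)) (\<lambda>x. (norm (u x))\<^sup>2))" (is ?B)
proof -
  have ms: "m \<in> S_h_vec \<Omega> \<T>" using m by (simp add: M_h_def)
  define meas where "meas = measure lebesgue (interior K)"
  have meas: "meas \<ge> 0" by (simp add: meas_def)
  obtain z where z: "z \<in> K" "\<And>x. x \<in> K \<Longrightarrow> norm (u x) \<le> norm (u z)" using fe_maximum[OF u K] by metis
  define \<mu> where "\<mu> = norm (u z)"
  have \<mu>: "\<mu> \<ge> 0" "\<And>x. x \<in> K \<Longrightarrow> norm (u x) \<le> \<mu>" using z by (auto simp: \<mu>_def)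
  have L2: "meas * \<mu>\<^sup>2 \<le> 256 * integral\<^sup>L (lebesgue_on (interior K)) (\<lambda>x. (norm (u x))\<^sup>2)"
    unfolding meas_def \<mu>_def by (rule fe_max_le_integral[OF u K z(1)])
  have nodeK: "v \<in> K" "norm (m v) = 1" "w v = u v - (m v \<bullet> u v) *\<^sub>R m v" if "v extreme_point_of K" for v
    using that K m proj[of v] by (auto simp: M_h_def mesh_nodes_def extreme_point_of_def)
  \<comment> \<open>At a node \<open>m v\<close> is a unit vector, so \<open>w v\<close> is an
    orthogonal projection of \<open>u v\<close>.\<close>
  have wv: "norm (w v) \<le> norm (u v)" if "v extreme_point_of K" for v
  proof -
    note n = nodeK[OF that]
    have "(norm (w v))\<^sup>2 = (norm (u v))\<^sup>2 - (m v \<bullet> u v)\<^sup>2"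
      using n(2) unfolding power2_norm_eq_inner n(3) norm_eq_1
      by (simp add: inner_diff_left inner_diff_right inner_commute power2_eq_square)
    then have "(norm (w v))\<^sup>2 \<le> (norm (u v))\<^sup>2" by simp
    then show ?thesis by (rule power2_le_imp_le) simp
  qed
  obtain Gw dw where Gw: "\<And>x. x \<in> K \<Longrightarrow> w x = Gw *v x + dw" "\<And>x. x \<in> interior K \<Longrightarrow> grad w x = Gw"
    using fe_affine[OF w K] by metis
  obtain Gu du where Gu: "\<And>x. x \<in> K \<Longrightarrow> u x = Gu *v x + du" "\<And>x. x \<in> interior K \<Longrightarrow> grad u x = Gu"
    using fe_affine[OF u K] by metis
  obtain Gm dm where Gm: "\<And>x. x \<in> K \<Longrightarrow> m x = Gm *v x + dm" "\<And>x. x \<in> interior K \<Longrightarrow> grad m x = Gm"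
    using fe_affine[OF ms K] by metis
  have w\<mu>: "norm (w x) \<le> \<mu>" if "x \<in> K" for x
    using norm_affine_le_on_hull[of "{v. v extreme_point_of K}" w Gw dw \<mu> x] hull_element[OF K] that Gw(1)
      wv \<mu>(2) nodeK(1) by (metis (no_types, lifting) mem_Collect_eq order_trans)
  have "integral\<^sup>L (lebesgue_on (interior K)) (\<lambda>x. (norm (w x))\<^sup>2) \<le> integral\<^sup>L (lebesgue_on (interior K)) (\<lambda>x. \<mu>\<^sup>2)"
  proof (rule integral_mono)
    show "integrable (lebesgue_on (interior K)) (\<lambda>x. (norm (w x))\<^sup>2)"
      by (rule norm_sq_integrable_interior[OF fe_ess_bounded[OF w] K])
    show "integrable (lebesgue_on (interior K)) (\<lambda>x. \<mu>\<^sup>2)"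
      by (rule ess_bounded_integrable_interior[OF ess_bounded_const K])
    show "(norm (w x))\<^sup>2 \<le> \<mu>\<^sup>2" if "x \<in> space (lebesgue_on (interior K))" for x
      using that interior_subset[of K] by (intro power_mono w\<mu>) auto
  qed
  also have "\<dots> = meas * \<mu>\<^sup>2" by (simp add: measure_restrict_space meas_def)
  finally show ?A using L2 by linarith
  have lip: "norm (v x - v y) \<le> norm G * (c * h)"
    if "\<And>x. x \<in> K \<Longrightarrow> v x = G *v x + d" "x \<in> K" "y \<in> K" for v :: "real^3 \<Rightarrow> real^3" and G d x y
  proof -
    have "norm (v x - v y) = norm (G *v (x - y))" using that by (simp add: matrix_vector_mult_diff_distrib)
    also have "\<dots> \<le> norm G * norm (x - y)" by (rule norm_matrix_vector_mult_le)
    also have "\<dots> \<le> norm G * (c * h)" by (intro mult_left_mono element_diameter[OF K]) (use that in auto)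
    finally show ?thesis .
  qed
  have Gwle: "norm Gw \<le> 48 * c ^ 3 * (norm Gu + \<kappa> * \<mu>)"
  proof (cases "\<kappa> = 1 / h")
    case True
    \<comment> \<open>Inverse estimate: values bounded by \<open>\<mu>\<close> oscillate by at most
      \<open>2 * \<mu>\<close>.\<close>
    have "norm Gw \<le> 24 * c\<^sup>2 * (2 * \<mu>) / h"
    proof (rule fe_gradient_le[OF K Gw(1)])
      fix v v' assume v: "v extreme_point_of K" "v' extreme_point_of K"
      show "norm (w v - w v') \<le> 2 * \<mu>"
        using norm_triangle_ineq4[of "w v" "w v'"] w\<mu>[of v] w\<mu>[of v'] nodeK(1) v by fastforce
    qed
    also have "\<dots> = 48 * (c\<^sup>2 * (\<kappa> * \<mu>))" using True by simp
    \<comment> \<open>Weakened to the form of the other case, where the diameter contributes one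
      more factor \<open>c\<close>.\<close>
    also have "\<dots> \<le> 48 * (c ^ 3 * (norm Gu + \<kappa> * \<mu>))"
      using c_ge_1 \<kappa> \<mu> by (intro mult_left_mono mult_mono power_increasing) auto
    finally show ?thesis by simp
  next
    case False
    obtain x where "x \<in> interior K" using interior_nonempty[OF K] by auto
    then have gm: "norm Gm \<le> \<kappa>" using False \<kappa> Gm(2) by metis
    have "norm Gw \<le> 24 * c\<^sup>2 * (2 * (norm Gu * (c * h)) + 2 * (\<kappa> * (c * h)) * \<mu>) / h"
    proof (rule fe_gradient_le[OF K Gw(1)])
      fix v v' assume v: "v extreme_point_of K" "v' extreme_point_of K"
      note n = nodeK[OF v(1)] and n' = nodeK[OF v(2)]
      have du: "norm (u v - u v') \<le> norm Gu * (c * h)" using lip[OF Gu(1)] n n' by blast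
      have dm: "norm (m v - m v') \<le> \<kappa> * (c * h)"
        by (rule order.trans[OF lip[OF Gm(1) n(1) n'(1)] mult_right_mono[OF gm]]) (use c_ge_1 h_pos in auto)
      \<comment> \<open>Telescoping of the product in \<open>m\<close>, \<open>m\<close> and
        \<open>u\<close>: each summand contains exactly one difference of nodal values, controlled
        by \<open>norm Gu\<close> or by the gradient of \<open>m\<close>.\<close>
      have "w v - w v' = (u v - u v') - ((m v \<bullet> (u v - u v')) *\<^sub>R m v + ((m v - m v') \<bullet> u v') *\<^sub>R m v
          + (m v' \<bullet> u v') *\<^sub>R (m v - m v'))"
        unfolding n(3) n'(3) by (simp add: inner_diff_left inner_diff_right algebra_simps)
      also have "norm \<dots> \<le> norm (u v - u v') + (norm ((m v \<bullet> (u v - u v')) *\<^sub>R m v) + norm (((m v - m v') \<bullet> u v') *\<^sub>R m v)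
          + norm ((m v' \<bullet> u v') *\<^sub>R (m v - m v')))"
        by (intro order.trans[OF norm_triangle_ineq4] order.trans[OF norm_triangle_ineq] add_mono order.refl)
      also have "norm ((m v \<bullet> (u v - u v')) *\<^sub>R m v) \<le> norm (u v - u v')"
        using Cauchy_Schwarz_ineq2[of "m v" "u v - u v'"] n(2) by simp
      also have "norm (((m v - m v') \<bullet> u v') *\<^sub>R m v) \<le> norm (m v - m v') * \<mu>"
        using Cauchy_Schwarz_ineq2[of "m v - m v'" "u v'"] n(2) \<mu>(2)[OF n'(1)]
          mult_left_mono[OF \<mu>(2)[OF n'(1)], of "norm (m v - m v')"] by simp
      also have "norm ((m v' \<bullet> u v') *\<^sub>R (m v - m v')) \<le> \<mu> * norm (m v - m v')"
        using Cauchy_Schwarz_ineq2[of "m v'" "u v'"] n'(2) \<mu>(2)[OF n'(1)] by (simp add: mult_right_mono)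
      finally have "norm (w v - w v') \<le> 2 * norm (u v - u v') + 2 * norm (m v - m v') * \<mu>" by (simp add: algebra_simps)
      also have "\<dots> \<le> 2 * (norm Gu * (c * h)) + 2 * (\<kappa> * (c * h)) * \<mu>"
        using du dm \<mu>(1) by (intro add_mono mult_left_mono mult_right_mono) auto
      finally show "norm (w v - w v') \<le> 2 * (norm Gu * (c * h)) + 2 * (\<kappa> * (c * h)) * \<mu>" .
    qed
    also have "\<dots> = 48 * c ^ 3 * (norm Gu + \<kappa> * \<mu>)"
      using h_pos by (simp add: field_simps power2_eq_square power3_eq_cube)
    finally show ?thesis .
  qed
  \<comment> \<open>The constant 1179648 is 2304 * 2 * 256: the square of 48, the factor of
    \<open>(a + b)\<^sup>2 \<le> 2 * a\<^sup>2 + 2 * b\<^sup>2\<close>, and the 256 of the maximum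
    bound. On the gradient term the 256 is slack, taken for a common factor.\<close>
  have "(norm Gw)\<^sup>2 \<le> (48 * c ^ 3 * (norm Gu + \<kappa> * \<mu>))\<^sup>2" using Gwle by (intro power_mono) auto
  also have "\<dots> = 2304 * c ^ 6 * (norm Gu + \<kappa> * \<mu>)\<^sup>2" by (simp add: power_mult_distrib flip: power_mult)
  also have "\<dots> \<le> 2304 * c ^ 6 * (2 * (norm Gu)\<^sup>2 + 2 * (\<kappa>\<^sup>2 * \<mu>\<^sup>2))"
  proof (rule mult_left_mono)
    have "0 \<le> (norm Gu - \<kappa> * \<mu>)\<^sup>2" by simp
    then show "(norm Gu + \<kappa> * \<mu>)\<^sup>2 \<le> 2 * (norm Gu)\<^sup>2 + 2 * (\<kappa>\<^sup>2 * \<mu>\<^sup>2)"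
      by (simp add: power2_sum power2_diff power_mult_distrib)
  qed simp
  finally have "meas * (norm Gw)\<^sup>2 \<le> meas * (2304 * c ^ 6 * (2 * (norm Gu)\<^sup>2 + 2 * (\<kappa>\<^sup>2 * \<mu>\<^sup>2)))"
    using meas by (rule mult_left_mono)
  also have "\<dots> = 4608 * c ^ 6 * (meas * (norm Gu)\<^sup>2 + \<kappa>\<^sup>2 * (meas * \<mu>\<^sup>2))" by (simp add: algebra_simps)
  also have "\<dots> \<le> 4608 * c ^ 6 * (256 * (meas * (norm Gu)\<^sup>2) +
      \<kappa>\<^sup>2 * (256 * integral\<^sup>L (lebesgue_on (interior K)) (\<lambda>x. (norm (u x))\<^sup>2)))"
    using L2 meas by (intro mult_left_mono add_mono) auto
  also have "\<dots> = 1179648 * c ^ 6 * (meas * (norm Gu)\<^sup>2 +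
      \<kappa>\<^sup>2 * integral\<^sup>L (lebesgue_on (interior K)) (\<lambda>x. (norm (u x))\<^sup>2))" by (simp add: algebra_simps)
  finally show ?B
    using fe_grad_integral[OF w K Gw(2)] fe_grad_integral[OF u K Gu(2)] by (simp add: meas_def)
qed

lemma projection_stability:
  assumes u: "u \<in> S_h_vec \<Omega> \<T>" and w: "w \<in> S_h_vec \<Omega> \<T>" and m: "m \<in> M_h \<Omega> \<T>"
    and proj: "\<And>z. z \<in> mesh_nodes \<T> \<Longrightarrow> w z = u z - (m z \<bullet> u z) *\<^sub>R m z"
    and \<kappa>: "\<kappa> = 1 / h \<or> \<kappa> = Linf_norm \<Omega> (grad m)"
  shows "L2_inner \<Omega> w w \<le> 256 * L2_inner \<Omega> u u"
    and "L2_inner \<Omega> (grad w) (grad w) \<le> 1179648 * c ^ 6 * (L2_inner \<Omega> (grad u) (grad u) + \<kappa>\<^sup>2 * L2_inner \<Omega> u u)"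
proof -
  have ms: "m \<in> S_h_vec \<Omega> \<T>" using m by (simp add: M_h_def)
  note Linf = ess_bounded_Linf[OF fe_grad_ess_bounded[OF ms]]
  have \<kappa>0: "\<kappa> \<ge> 0" using \<kappa> Linf(2) h_pos by auto
  \<comment> \<open>The gradient of \<open>m\<close> is constant on the interior of an element, so
    one point satisfying the essential bound settles all of them.\<close>
  have \<kappa>K: "\<kappa> = 1 / h \<or> (\<forall>x\<in>interior K. norm (grad m x) \<le> \<kappa>)" if K: "K \<in> \<T>" for K
  proof (cases "\<kappa> = 1 / h")
    case False
    obtain G where G: "\<And>x. x \<in> interior K \<Longrightarrow> grad m x = G" using fe_affine[OF ms K] by metis
    obtain x where "x \<in> interior K" "norm (grad m x) \<le> Linf_norm \<Omega> (grad m)" using AE_interior[OF Linf(1) K] by metis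
    then show ?thesis using G \<kappa> False by metis
  qed simp
  have sq: "L2_inner \<Omega> f f = (\<Sum>K\<in>\<T>. integral\<^sup>L (lebesgue_on (interior K)) (\<lambda>x. (norm (f x))\<^sup>2))"
    if "ess_bounded f" for f :: "real^3 \<Rightarrow> 'b::euclidean_space"
    using integral_mesh(2)[OF norm_sq_integrable_interior[OF that]]
    by (simp add: L2_inner_def power2_norm_eq_inner)
  note sqs = sq[OF fe_ess_bounded[OF u]] sq[OF fe_ess_bounded[OF w]]
    sq[OF fe_grad_ess_bounded[OF u]] sq[OF fe_grad_ess_bounded[OF w]]
  note E = projection_stability_element[OF u w m _ proj \<kappa>0 \<kappa>K]
  show "L2_inner \<Omega> w w \<le> 256 * L2_inner \<Omega> u u"
    unfolding sqs sum_distrib_left by (intro sum_mono E)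
  show "L2_inner \<Omega> (grad w) (grad w) \<le> 1179648 * c ^ 6 * (L2_inner \<Omega> (grad u) (grad u) + \<kappa>\<^sup>2 * L2_inner \<Omega> u u)"
    unfolding sqs sum_distrib_left sum.distrib[symmetric] by (intro sum_mono E)
qed

end

subsection \<open>Finite element functions are weakly differentiable\<close>

text \<open>Mean value theorem along a segment. The bound is required on the segment alone because
  the derivative of the test function will be bounded only over the domain.\<close>

lemma directional_lipschitz:
  fixes \<psi> :: "real^3 \<Rightarrow> real"
  assumes d: "\<And>x. \<psi> differentiable (at x)" and t: "0 < t"
    and B: "\<And>s. 0 \<le> s \<Longrightarrow> s \<le> t \<Longrightarrow> \<bar>frechet_derivative \<psi> (at (x + s *\<^sub>R e)) e\<bar> \<le> B"
  shows "\<bar>\<psi> (x + t *\<^sub>R e) - \<psi> x\<bar> \<le> B * t"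
proof -
  define \<phi> where "\<phi> s = \<psi> (x + s *\<^sub>R e)" for s
  define \<phi>' where "\<phi>' s = frechet_derivative \<psi> (at (x + s *\<^sub>R e)) e" for s
  have "(\<phi> has_real_derivative \<phi>' s) (at s)" for s
  proof -
    have "(\<psi> has_derivative frechet_derivative \<psi> (at (x + s *\<^sub>R e))) (at (x + s *\<^sub>R e))"
      using d frechet_derivative_works by blast
    moreover have "((\<lambda>s. x + s *\<^sub>R e) has_derivative (\<lambda>h. h *\<^sub>R e)) (at s)"
      by (auto intro!: derivative_eq_intros)
    ultimately have "(\<phi> has_derivative (\<lambda>h. frechet_derivative \<psi> (at (x + s *\<^sub>R e)) (h *\<^sub>R e))) (at s)"
      unfolding \<phi>_def using has_derivative_compose by blast
    moreover have "linear (frechet_derivative \<psi> (at (x + s *\<^sub>R e)))"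
      using d linear_frechet_derivative by blast
    then have "(\<lambda>h. frechet_derivative \<psi> (at (x + s *\<^sub>R e)) (h *\<^sub>R e)) = (*) (\<phi>' s)"
      by (auto simp: linear_cmul \<phi>'_def)
    ultimately show ?thesis by (simp add: has_field_derivative_def)
  qed
  then obtain z where z: "0 < z" "z < t" "\<phi> t - \<phi> 0 = (t - 0) * \<phi>' z" using MVT2[OF t, of \<phi> \<phi>'] by blast
  have "\<bar>\<phi> t - \<phi> 0\<bar> = t * \<bar>\<phi>' z\<bar>" using z t by (simp add: abs_mult)
  also have "\<dots> \<le> t * B" using B[of z] z t by (intro mult_left_mono) (auto simp: \<phi>'_def)
  finally show ?thesis by (simp add: \<phi>_def mult.commute)
qed

text \<open>Borel measurability of \<open>w\<close> lets the integral pass to \<open>lborel\<close>,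
  whose translates coincide with it, and back to the completion.\<close>

lemma integral_lebesgue_translation:
  fixes w :: "real^3 \<Rightarrow> real^3"
  assumes "w \<in> borel_measurable borel"
  shows "integral\<^sup>L lebesgue (\<lambda>x. w (x + c)) = integral\<^sup>L lebesgue w"
proof -
  have "integral\<^sup>L lebesgue (\<lambda>x. w (x + c)) = integral\<^sup>L lborel (\<lambda>x. w (x + c))"
    using assms by (intro integral_completion) simp
  also have "\<dots> = integral\<^sup>L (distr lborel borel ((+) c)) w"
    using assms by (subst integral_distr) (auto simp: add.commute)
  also have "\<dots> = integral\<^sup>L lebesgue w"
    using assms by (simp add: lborel_distr_plus integral_completion)
  finally show ?thesis .
qed

context fem_mesh
begin

text \<open>Along a segment inside the domain, the preimages of the elements form a finite closed
  cover of an interval, with a uniform Lipschitz constant on each piece, and these bounds glue. The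
  segment condition stands in for convexity of the domain.\<close>

lemma fe_lipschitz_segment:
  assumes u: "u \<in> S_h_vec \<Omega> \<T>"
  obtains L where "L \<ge> 0" "\<And>x e t. norm e = 1 \<Longrightarrow> 0 \<le> t \<Longrightarrow> (\<And>s. 0 \<le> s \<Longrightarrow> s \<le> t \<Longrightarrow> x + s *\<^sub>R e \<in> \<Omega>) \<Longrightarrow>
     norm (u (x + t *\<^sub>R e) - u x) \<le> L * t"
proof -
  have "\<exists>G d. \<forall>x\<in>K. u x = G *v x + d" if "K \<in> \<T>" for K using fe_affine[OF u that] by metis
  then obtain G d where G: "\<And>K x. K \<in> \<T> \<Longrightarrow> x \<in> K \<Longrightarrow> u x = G K *v x + d K" by metis
  define L where "L = (\<Sum>K\<in>\<T>. norm (G K))"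
  have L: "L \<ge> 0" by (auto simp: L_def intro: sum_nonneg)
  have GL: "norm (G K) \<le> L" if "K \<in> \<T>" for K
    using member_le_sum[of K \<T> "\<lambda>K. norm (G K)"] that fin by (simp add: L_def)
  have "norm (u (x + t *\<^sub>R e) - u x) \<le> L * t"
    if e: "norm e = 1" and t: "0 \<le> t" and seg: "\<And>s. 0 \<le> s \<Longrightarrow> s \<le> t \<Longrightarrow> x + s *\<^sub>R e \<in> \<Omega>" for x e t
  proof -
    have "L-lipschitz_on {0..t} (\<lambda>s. u (x + s *\<^sub>R e))"
    proof (rule lipschitz_on_closed_Union[where I=\<T> and U="\<lambda>K. (\<lambda>s. x + s *\<^sub>R e) -` K"])
      fix K assume K: "K \<in> \<T>"
      show "L-lipschitz_on ((\<lambda>s. x + s *\<^sub>R e) -` K) (\<lambda>s. u (x + s *\<^sub>R e))"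
      proof (rule lipschitz_onI[OF _ L])
        fix s s' assume s: "s \<in> (\<lambda>s. x + s *\<^sub>R e) -` K" "s' \<in> (\<lambda>s. x + s *\<^sub>R e) -` K"
        have "u (x + s *\<^sub>R e) - u (x + s' *\<^sub>R e) = G K *v ((s - s') *\<^sub>R e)"
          using s by (simp add: G[OF K] matrix_vector_mult_diff_distrib[symmetric] scaleR_diff_left)
        then have "dist (u (x + s *\<^sub>R e)) (u (x + s' *\<^sub>R e)) \<le> norm (G K) * norm ((s - s') *\<^sub>R e)"
          unfolding dist_norm using norm_matrix_vector_mult_le by metis
        also have "\<dots> \<le> L * dist s s'" using e GL[OF K] by (simp add: dist_norm mult_right_mono)
        finally show "dist (u (x + s *\<^sub>R e)) (u (x + s' *\<^sub>R e)) \<le> L * dist s s'" .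
      qed
      show "closed ((\<lambda>s. x + s *\<^sub>R e) -` K)"
        using compact_element[OF K] compact_imp_closed
        by (intro continuous_closed_vimage) (auto intro!: continuous_intros)
    next
      show "{0..t} \<subseteq> (\<Union>K\<in>\<T>. (\<lambda>s. x + s *\<^sub>R e) -` K)"
      proof
        fix s assume "s \<in> {0..t}"
        then have "x + s *\<^sub>R e \<in> \<Union>\<T>" using seg[of s] subsetD[OF closure_subset[of \<Omega>]] Union_mesh by auto
        then show "s \<in> (\<Union>K\<in>\<T>. (\<lambda>s. x + s *\<^sub>R e) -` K)" by auto
      qed
    qed (use fin L in auto)
    from lipschitz_onD[OF this, of t 0] show ?thesis using t by (simp add: dist_norm)
  qed
  with L show ?thesis by (rule that)
qed

text \<open>Integration by parts: the integral of a difference quotient of \<open>\<psi> u\<close> vanishes, and the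
  difference quotients are dominated since \<open>u\<close> is Lipschitz along segments in \<open>\<Omega>\<close>.\<close>

lemma fe_integration_by_parts:
  assumes u: "u \<in> S_h_vec \<Omega> \<T>" and \<psi>: "test_function \<Omega> \<psi>"
  shows "integral\<^sup>L (lebesgue_on \<Omega>) (\<lambda>x. frechet_derivative \<psi> (at x) (axis i 1) *\<^sub>R u x) =
        - integral\<^sup>L (lebesgue_on \<Omega>) (\<lambda>x. \<psi> x *\<^sub>R column i (grad u x))"
proof -
  define e :: "real^3" where "e = axis i 1"
  have e: "norm e = 1" by (simp add: e_def)
  define D where "D x = frechet_derivative \<psi> (at x) e" for x
  define S where "S = closure {x. \<psi> x \<noteq> 0}"
  have S: "compact S" "S \<subseteq> \<Omega>" using \<psi> by (auto simp: test_function_def S_def)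
  have \<psi>S: "\<psi> x = 0" if "x \<notin> S" for x using that subsetD[OF closure_subset, of x "{x. \<psi> x \<noteq> 0}"] by (auto simp: S_def)
  have "C_diff 0 \<psi>" "C_diff (Suc 0) \<psi>" using \<psi> unfolding test_function_def by blast+
  then have cont\<psi>: "continuous_on UNIV \<psi>" and diff\<psi>: "\<And>x. \<psi> differentiable (at x)" and contD: "continuous_on UNIV D"
    by (auto simp: D_def[abs_def] e_def)
  have cpt: "compact (closure \<Omega>)" using domain by (auto simp: bounded_Lipschitz_domain_def compact_closure)
  have bdd: "\<exists>B. \<forall>x\<in>closure \<Omega>. norm (f x) \<le> B" if "continuous_on (closure \<Omega>) f" for f :: "real^3 \<Rightarrow> 'b::euclidean_space"
    using compact_imp_bounded[OF compact_continuous_image[OF that cpt]] by (auto simp: bounded_iff)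
  have clo: "x \<in> closure \<Omega>" if "x \<in> \<Omega>" for x using subsetD[OF closure_subset that] .
  obtain Bu where Bu: "\<And>x. x \<in> \<Omega> \<Longrightarrow> norm (u x) \<le> Bu" using bdd[OF fe_continuous[OF u]] clo by metis
  obtain B\<psi> where B\<psi>: "\<And>x. x \<in> \<Omega> \<Longrightarrow> norm (\<psi> x) \<le> B\<psi>"
    using bdd[of \<psi>] continuous_on_subset[OF cont\<psi>] clo by (metis subset_UNIV)
  obtain BD where BD: "\<And>x. x \<in> \<Omega> \<Longrightarrow> norm (D x) \<le> BD"
    using bdd[of D] continuous_on_subset[OF contD] clo by (metis subset_UNIV)
  obtain Lu where Lu: "Lu \<ge> 0" "\<And>x e t. norm e = 1 \<Longrightarrow> 0 \<le> t \<Longrightarrow> (\<And>s. 0 \<le> s \<Longrightarrow> s \<le> t \<Longrightarrow> x + s *\<^sub>R e \<in> \<Omega>) \<Longrightarrow>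
     norm (u (x + t *\<^sub>R e) - u x) \<le> Lu * t" using fe_lipschitz_segment[OF u] by metis
  obtain x0 where x0: "x0 \<in> \<Omega>" using domain_nonempty by auto
  have nn: "0 \<le> Bu" "0 \<le> B\<psi>" "0 \<le> BD"
    using Bu[OF x0] B\<psi>[OF x0] BD[OF x0] norm_ge_zero order.trans by blast+
  define L where "L = BD * Bu + B\<psi> * Lu"
  have Lnn: "L \<ge> 0" using nn Lu(1) by (simp add: L_def)
  \<comment> \<open>The values of \<open>u\<close> away from the closed domain are arbitrary;
    multiplication by \<open>\<psi>\<close>, which vanishes off \<open>S\<close>, makes
    \<open>w\<close> a continuous function on the whole space.\<close>
  define w where "w x = \<psi> x *\<^sub>R u x" for x
  have wS: "w x = 0" if "x \<notin> S" for x using \<psi>S[OF that] by (simp add: w_def)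
  obtain r where r: "r > 0" "(\<Union>x\<in>S. ball x r) \<subseteq> \<Omega>"
    using compact_subset_open_imp_ball_epsilon_subset[OF S(1) open_domain S(2)] by metis
  have wlip: "norm (w (x + t *\<^sub>R e) - w x) \<le> L * t" if t: "0 < t" "t < r" for x t
  proof (cases "x \<in> S \<or> x + t *\<^sub>R e \<in> S")
    case False
    then show ?thesis using wS t Lnn by simp
  next
    case True
    \<comment> \<open>One endpoint lies in \<open>S\<close>, and its ball of radius
      \<open>r\<close>, contained in the domain, covers the whole segment.\<close>
    have seg: "x + s *\<^sub>R e \<in> \<Omega>" if s: "0 \<le> s" "s \<le> t" for s
    proof -
      have d: "dist x (x + s *\<^sub>R e) < r" "dist (x + t *\<^sub>R e) (x + s *\<^sub>R e) < r"
        using s t e by (auto simp: dist_norm scaleR_diff_left[symmetric])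
      have "x + s *\<^sub>R e \<in> (\<Union>x\<in>S. ball x r)" using True d by (metis UN_I mem_ball)
      then show ?thesis by (rule subsetD[OF r(2)])
    qed
    have x: "x \<in> \<Omega>" "x + t *\<^sub>R e \<in> \<Omega>" using seg[of 0] seg[of t] t by auto
    have "w (x + t *\<^sub>R e) - w x = (\<psi> (x + t *\<^sub>R e) - \<psi> x) *\<^sub>R u (x + t *\<^sub>R e) + \<psi> x *\<^sub>R (u (x + t *\<^sub>R e) - u x)"
      by (simp add: w_def algebra_simps)
    also have "norm \<dots> \<le> \<bar>\<psi> (x + t *\<^sub>R e) - \<psi> x\<bar> * norm (u (x + t *\<^sub>R e)) + \<bar>\<psi> x\<bar> * norm (u (x + t *\<^sub>R e) - u x)"
      by (rule order.trans[OF norm_triangle_ineq]) simp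
    also have "\<dots> \<le> (BD * t) * Bu + B\<psi> * (Lu * t)"
    proof (intro add_mono mult_mono)
      show "\<bar>\<psi> (x + t *\<^sub>R e) - \<psi> x\<bar> \<le> BD * t"
        by (rule directional_lipschitz[OF diff\<psi> t(1)]) (use seg BD in \<open>auto simp: D_def\<close>)
      show "norm (u (x + t *\<^sub>R e) - u x) \<le> Lu * t" using Lu(2)[OF e _ seg] t by auto
    qed (use Bu[OF x(2)] B\<psi>[OF x(1)] nn Lu(1) t in auto)
    also have "\<dots> = L * t" by (simp add: L_def algebra_simps)
    finally show ?thesis .
  qed
  \<comment> \<open>Gluing over two open sets: on the domain \<open>w\<close> is a product of
    continuous functions, off \<open>S\<close> it is zero, and together they cover the
    space.\<close>
  have "continuous_on (\<Omega> \<union> - S) w"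
  proof (rule continuous_on_open_Un[OF open_domain])
    show "open (- S)" by (intro open_Compl compact_imp_closed S(1))
    have "continuous_on \<Omega> u" using continuous_on_subset[OF fe_continuous[OF u] closure_subset] .
    then show "continuous_on \<Omega> w" unfolding w_def[abs_def]
      by (intro continuous_on_scaleR continuous_on_subset[OF cont\<psi>]) auto
    show "continuous_on (- S) w" by (rule continuous_on_eq[of _ "\<lambda>x. 0"]) (auto simp: wS)
  qed
  moreover have "\<Omega> \<union> - S = UNIV" using S by auto
  ultimately have contw: "continuous_on UNIV w" by simp
  have wb: "w \<in> borel_measurable borel" by (rule borel_measurable_continuous_onI[OF contw])
  have wm: "(\<lambda>x. w (x + a)) \<in> borel_measurable lebesgue" for a
    by (intro measurable_completion) (use wb in simp)
  obtain R where R: "S \<subseteq> ball 0 R" using compact_imp_bounded[OF S(1)] by (metis bounded_subset_ballD)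
  have wint: "integrable lebesgue w"
  proof -
    have "integrable lborel (\<lambda>x. indicator S x *\<^sub>R w x)"
      by (rule borel_integrable_compact[OF S(1)]) (rule continuous_on_subset[OF contw], simp)
    moreover have "(\<lambda>x. indicator S x *\<^sub>R w x) = w" using wS by (auto simp: indicator_def fun_eq_iff)
    ultimately have "integrable lborel w" by simp
    then show ?thesis using integrable_completion[of w lborel] wb by simp
  qed
  define g where "g x = indicator \<Omega> x *\<^sub>R (D x *\<^sub>R u x + \<psi> x *\<^sub>R column i (grad u x))" for x
  have eb\<psi>: "ess_bounded \<psi>" "ess_bounded D"
    by (auto intro!: ess_boundedI[OF _ AE_I2] continuous_imp_measurable_on_sets_lebesgue
        continuous_on_subset[OF cont\<psi>] continuous_on_subset[OF contD] B\<psi> BD simp del: real_norm_def)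
  have ebcol: "ess_bounded (\<lambda>x. column i (grad u x))"
  proof -
    have bl: "bounded_linear (\<lambda>A :: real^3^3. column i A)"
      unfolding linear_conv_bounded_linear[symmetric]
      by (rule linearI) (simp_all add: column_def Finite_Cartesian_Product.vec_eq_iff)
    obtain C where C: "\<And>A :: real^3^3. norm (column i A) \<le> norm A * C" using bounded_linear.bounded[OF bl] by metis
    obtain B where "AE x in lebesgue_on \<Omega>. norm (grad u x) \<le> B" and m: "grad u \<in> borel_measurable (lebesgue_on \<Omega>)"
      using fe_grad_ess_bounded[OF u] by (auto simp: ess_bounded_def)
    then have "AE x in lebesgue_on \<Omega>. norm (column i (grad u x)) \<le> B * \<bar>C\<bar>"
    proof (elim eventually_mono)
      fix x assume "norm (grad u x) \<le> B"
      have "norm (column i (grad u x)) \<le> norm (grad u x) * \<bar>C\<bar>"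
        using C[of "grad u x"] by (meson abs_ge_self mult_left_mono norm_ge_zero order_trans)
      also have "\<dots> \<le> B * \<bar>C\<bar>" using \<open>norm (grad u x) \<le> B\<close> by (intro mult_right_mono) auto
      finally show "norm (column i (grad u x)) \<le> B * \<bar>C\<bar>" .
    qed
    then show ?thesis
      by (rule ess_boundedI[rotated]) (rule borel_measurable_continuous_on[OF linear_continuous_on[OF bl] m])
  qed
  have eb1: "ess_bounded (\<lambda>x. D x *\<^sub>R u x)" and eb2: "ess_bounded (\<lambda>x. \<psi> x *\<^sub>R column i (grad u x))"
    using eb\<psi> fe_ess_bounded[OF u] ebcol by (auto intro: ess_bounded_scaleR)
  have gm: "g \<in> borel_measurable lebesgue"
    using ess_bounded_integrable[OF ess_bounded_add[OF eb1 eb2]]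
    by (simp add: g_def[abs_def] integrable_restrict_space)
  define T where "T n = r / 2 / real (Suc n)" for n
  have T: "0 < T n" "T n < r" for n
  proof -
    show "0 < T n" using r by (simp add: T_def)
    have "T n \<le> r / 2" using r by (simp add: T_def field_simps)
    then show "T n < r" using r by simp
  qed
  have T0: "T \<longlonglongrightarrow> 0"
    unfolding T_def by (rule LIMSEQ_Suc[OF lim_const_over_n])
  define q where "q n x = (1 / T n) *\<^sub>R (w (x + T n *\<^sub>R e) - w x)" for n x
  have q0: "integral\<^sup>L lebesgue (q n) = 0" for n
  proof -
    have "integrable lebesgue (\<lambda>x. w (x + T n *\<^sub>R e))"
    proof -
      have "integrable lborel w" using wint wb integrable_completion[of w lborel] by simp
      then have "integrable (distr lborel borel ((+) (T n *\<^sub>R e))) w" by (simp add: lborel_distr_plus)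
      then have "integrable lborel (\<lambda>x. w (T n *\<^sub>R e + x))" by (subst (asm) integrable_distr_eq) (use wb in auto)
      then show ?thesis using integrable_completion[of "\<lambda>x. w (x + T n *\<^sub>R e)" lborel] wb by (simp add: add.commute)
    qed
    then show ?thesis
      using integral_lebesgue_translation[OF wb, of "T n *\<^sub>R e"] wint by (simp add: q_def[abs_def])
  qed
  \<comment> \<open>Inside an element this is the product rule, outside the domain \<open>w\<close>
    vanishes near the point, and what remains is a null set.\<close>
  have lim: "AE x in lebesgue. (\<lambda>n. q n x) \<longlonglongrightarrow> g x"
    using AE_domain_interior
  proof eventually_elim
    case (elim x)
    have der: "(\<lambda>n. q n x) \<longlonglongrightarrow> w' e" if w': "(w has_derivative w') (at x)" for w'
    proof -
      have lin: "linear w'" using w' has_derivative_linear by blast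
      have "(\<lambda>h. norm (w (x + h) - w x - w' h) / norm h) \<midarrow>0\<rightarrow> 0" using w' by (simp add: has_derivative_at)
      moreover have "filterlim (\<lambda>n. T n *\<^sub>R e) (at 0) sequentially"
      proof -
        have "(\<lambda>n. T n *\<^sub>R e) \<longlonglongrightarrow> 0" using tendsto_scaleR[OF T0 tendsto_const[of e]] by simp
        moreover have "T n *\<^sub>R e \<noteq> 0" for n using T(1)[of n] e by auto
        ultimately show ?thesis by (simp add: filterlim_at)
      qed
      ultimately have "(\<lambda>n. norm (w (x + T n *\<^sub>R e) - w x - w' (T n *\<^sub>R e)) / norm (T n *\<^sub>R e)) \<longlonglongrightarrow> 0"
        by (rule filterlim_compose)
      also have "(\<lambda>n. norm (w (x + T n *\<^sub>R e) - w x - w' (T n *\<^sub>R e)) / norm (T n *\<^sub>R e)) = (\<lambda>n. norm (q n x - w' e))"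
      proof
        fix n
        have "w (x + T n *\<^sub>R e) - w x - w' (T n *\<^sub>R e) = T n *\<^sub>R (q n x - w' e)"
          using T(1)[of n] lin by (simp add: q_def linear_cmul scaleR_diff_right)
        then show "norm (w (x + T n *\<^sub>R e) - w x - w' (T n *\<^sub>R e)) / norm (T n *\<^sub>R e) = norm (q n x - w' e)"
          using T(1)[of n] e by simp
      qed
      finally have "(\<lambda>n. q n x - w' e) \<longlonglongrightarrow> 0" by (rule tendsto_norm_zero_cancel)
      then show ?thesis by (simp add: Lim_null[symmetric])
    qed
    show ?case
    proof (cases "x \<in> \<Omega>")
      case False
      then have "x \<in> - S" using S by auto
      have "(w has_derivative (\<lambda>h. 0)) (at x)"
        by (rule has_derivative_transform_within_open[OF has_derivative_const, of "- S"])
          (use compact_imp_closed[OF S(1)] wS \<open>x \<in> - S\<close> in \<open>auto simp: open_Compl\<close>)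
      from der[OF this] False show ?thesis by (simp add: g_def)
    next
      case True
      then obtain K where K: "K \<in> \<T>" "x \<in> interior K" using elim by auto
      obtain G where G: "(u has_derivative (\<lambda>y. G *v y)) (at x)" "grad u x = G" using fe_affine[OF u K(1)] K(2) by metis
      have "(\<psi> has_derivative frechet_derivative \<psi> (at x)) (at x)" using diff\<psi> frechet_derivative_works by blast
      from has_derivative_scaleR[OF this G(1)]
      have "(w has_derivative (\<lambda>h. \<psi> x *\<^sub>R (G *v h) + frechet_derivative \<psi> (at x) h *\<^sub>R u x)) (at x)"
        by (simp add: w_def[abs_def])
      from der[OF this] True G(2) show ?thesis
        by (simp add: g_def D_def e_def add.commute matrix_vector_mult_basis)
    qed
  qed
  have "(\<lambda>n. integral\<^sup>L lebesgue (q n)) \<longlonglongrightarrow> integral\<^sup>L lebesgue g"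
  \<comment> \<open>All steps \<open>T n\<close> are below \<open>r\<close>, so every difference
    quotient vanishes off one ball, and on it the Lipschitz bound \<open>L\<close>
    dominates.\<close>
  proof (rule integral_dominated_convergence[where w="\<lambda>x. L * indicator (ball 0 (R + r)) x"])
    show "q n \<in> borel_measurable lebesgue" for n
      using wm[of "T n *\<^sub>R e"] wm[of 0] by (simp add: q_def[abs_def])
    show "integrable lebesgue (\<lambda>x. L * indicator (ball 0 (R + r)) x)"
      by (intro integrable_mult_right lmeasurable_iff_integrable[THEN iffD1] lmeasurable_ball)
    show "AE x in lebesgue. norm (q n x) \<le> L * indicator (ball 0 (R + r)) x" for n
    proof (rule AE_I2)
      fix x
      show "norm (q n x) \<le> L * indicator (ball 0 (R + r)) x"
      proof (cases "x \<in> ball 0 (R + r)")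
        case True
        have "norm (q n x) = norm (w (x + T n *\<^sub>R e) - w x) / T n" using T(1)[of n] by (simp add: q_def)
        also have "\<dots> \<le> L" using wlip[OF T, of x n] T(1)[of n] by (simp add: pos_divide_le_eq)
        finally show ?thesis using True by simp
      next
        case False
        have "x \<notin> S" using False R r by auto
        moreover have "x + T n *\<^sub>R e \<notin> S"
        proof
          assume "x + T n *\<^sub>R e \<in> S"
          then have "norm (x + T n *\<^sub>R e) < R" using R by auto
          then have "norm x < R + T n" using norm_triangle_ineq4[of "x + T n *\<^sub>R e" "T n *\<^sub>R e"] e T(1)[of n] by simp
          then show False using False T(2)[of n] by simp
        qed
        ultimately show ?thesis using wS False by (simp add: q_def)
      qed
    qed
  qed (use gm lim in auto)
  then have "integral\<^sup>L lebesgue g = 0" using q0 by (simp add: LIMSEQ_const_iff)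
  then have "integral\<^sup>L (lebesgue_on \<Omega>) (\<lambda>x. D x *\<^sub>R u x + \<psi> x *\<^sub>R column i (grad u x)) = 0"
    by (simp add: integral_restrict_space g_def[abs_def])
  then have "integral\<^sup>L (lebesgue_on \<Omega>) (\<lambda>x. D x *\<^sub>R u x) + integral\<^sup>L (lebesgue_on \<Omega>) (\<lambda>x. \<psi> x *\<^sub>R column i (grad u x)) = 0"
    using ess_bounded_integrable[OF eb1] ess_bounded_integrable[OF eb2] by simp
  then show ?thesis by (simp add: D_def e_def eq_neg_iff_add_eq_0)
qed

lemma fe_in_H1:
  assumes u: "u \<in> S_h_vec \<Omega> \<T>" shows "u \<in> H1 \<Omega>"
proof -
  have L2: "f \<in> L2 \<Omega>" if "ess_bounded f" for f :: "real^3 \<Rightarrow> 'b::euclidean_space"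
    using that ess_bounded_integrable[OF ess_bounded_inner[OF that that]]
    by (simp add: L2_def ess_bounded_def power2_norm_eq_inner)
  have "weak_gradient \<Omega> u (grad u)"
    unfolding weak_gradient_def
    using fe_integration_by_parts[OF u] L2[OF fe_ess_bounded[OF u]] L2[OF fe_grad_ess_bounded[OF u]] by simp
  then show ?thesis by (auto simp: H1_def)
qed

end

subsection \<open>Householder blocks\<close>

lemma sum_lessThan_mult3:
  fixes f :: "nat \<Rightarrow> 'a::comm_monoid_add"
  shows "(\<Sum>i<3 * n. f i) = (\<Sum>j<n. f (3 * j) + f (3 * j + 1) + f (3 * j + 2))"
proof (induction n)
  case (Suc n)
  have "{..<3 * Suc n} = insert (3 * n + 2) (insert (3 * n + 1) (insert (3 * n) {..<3 * n}))" by auto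
  then show ?case using Suc by (simp add: ac_simps)
qed simp

lemma sum_lessThan_mult2:
  fixes f :: "nat \<Rightarrow> 'a::comm_monoid_add"
  shows "(\<Sum>i<2 * n. f i) = (\<Sum>j<n. f (2 * j) + f (2 * j + 1))"
proof (induction n)
  case (Suc n)
  have "{..<2 * Suc n} = insert (2 * n + 1) (insert (2 * n) {..<2 * n})" by auto
  then show ?case using Suc by (simp add: ac_simps)
qed simp

lemma scalar_prod_mat_mult:
  fixes f :: "nat \<Rightarrow> nat \<Rightarrow> real"
  assumes "v \<in> carrier_vec n" "w \<in> carrier_vec n"
  shows "scalar_prod v (Matrix.mat n n (\<lambda>(i, j). f i j) *\<^sub>v w) =
    (\<Sum>i<n. \<Sum>j<n. vec_index v i * vec_index w j * f i j)"
proof -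
  have "scalar_prod v (Matrix.mat n n (\<lambda>(i, j). f i j) *\<^sub>v w) =
     (\<Sum>i<n. vec_index v i * (\<Sum>j<n. f i j * vec_index w j))"
    using assms by (simp add: scalar_prod_def lessThan_atLeast0)
  then show ?thesis by (simp add: sum_distrib_left ac_simps)
qed

text \<open>The reflection sends the third unit vector to \<open>- m\<close>, while the exceptional
  matrix at \<open>- axis 3 1\<close> sends it to \<open>m\<close>. Recording the third column up to
  sign treats both alike and says that the first two columns span the plane orthogonal to
  \<open>m\<close>.\<close>

lemma Householder_orthogonal:
  assumes m: "norm m = 1"
  shows "Householder m ** Finite_Cartesian_Product.transpose (Householder m) = Finite_Cartesian_Product.mat 1"
    and "\<exists>s. s * s = 1 \<and> (\<forall>i. Householder m $ i $ 3 = s * m $ i)"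
proof -
  have m3: "m $ 1 * m $ 1 + m $ 2 * m $ 2 + m $ 3 * m $ 3 = 1"
    using m by (simp add: norm_eq_1 inner_vec_def sum_3)
  have "Householder m ** Finite_Cartesian_Product.transpose (Householder m) = Finite_Cartesian_Product.mat 1 \<and>
    (\<exists>s. s * s = 1 \<and> (\<forall>i. Householder m $ i $ 3 = s * m $ i))"
  proof (cases "m = - axis 3 1")
    case True
    then show ?thesis
      by (auto simp: Householder_def Finite_Cartesian_Product.vec_eq_iff matrix_matrix_mult_def Finite_Cartesian_Product.transpose_def
          Finite_Cartesian_Product.mat_def forall_3 sum_3 axis_def intro!: exI[of _ 1])
  next
    case False
    \<comment> \<open>\<open>2 * (1 + m $ 3)\<close> is the squared length by which \<open>w\<close>
      is normalised; it vanishes only at the excluded vector.\<close>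
    have pos: "1 + m $ 3 > 0"
    proof -
      have "\<bar>m $ 3\<bar> \<le> 1" using component_le_norm_cart[of m 3] m by simp
      moreover have "m $ 3 \<noteq> -1"
      proof
        assume *: "m $ 3 = -1"
        then have "m $ 1 * m $ 1 + m $ 2 * m $ 2 = 0" using m3 by simp
        then have "m $ 1 = 0" "m $ 2 = 0" by (simp_all add: sum_squares_eq_zero_iff)
        then have "m = - axis 3 1" using * by (simp add: Finite_Cartesian_Product.vec_eq_iff forall_3 axis_def)
        then show False using False by simp
      qed
      ultimately show ?thesis by linarith
    qed
    define w where "w = (m + axis 3 1) /\<^sub>R norm (m + axis 3 1)"
    define \<rho> where "\<rho> = 1 / norm (m + axis 3 1)"
    have n2: "norm (m + axis 3 1) * norm (m + axis 3 1) = 2 * (1 + m $ 3)"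
    proof -
      have "(norm (m + axis 3 1))\<^sup>2 = 2 * (1 + m $ 3)"
        unfolding power2_norm_eq_inner using m3 by (simp add: inner_vec_def sum_3 axis_def algebra_simps)
      then show ?thesis by (simp add: power2_eq_square)
    qed
    have \<rho>: "\<rho> * \<rho> * (2 * (1 + m $ 3)) = 1"
      using n2 pos by (simp add: \<rho>_def flip: n2)
    have w: "w $ 1 = \<rho> * m $ 1" "w $ 2 = \<rho> * m $ 2" "w $ 3 = \<rho> * (1 + m $ 3)"
      by (simp_all add: w_def \<rho>_def axis_def divide_inverse)
    have ww: "w $ 1 * w $ 1 + w $ 2 * w $ 2 + w $ 3 * w $ 3 = 1"
    proof -
      have "w $ 1 * w $ 1 + w $ 2 * w $ 2 + w $ 3 * w $ 3 =
          \<rho> * \<rho> * ((m $ 1 * m $ 1 + m $ 2 * m $ 2 + m $ 3 * m $ 3) + 1 + 2 * m $ 3)"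
        unfolding w by (simp add: algebra_simps)
      then show ?thesis using \<rho> unfolding m3 by simp
    qed
    have H: "Householder m $ i $ j = (if i = j then 1 else 0) - 2 * (w $ i * w $ j)" for i j
      using False by (simp add: Householder_def Let_def w_def Finite_Cartesian_Product.mat_def)
    have "(\<Sum>k\<in>UNIV. Householder m $ i $ k * Householder m $ j $ k) = (if i = j then 1 else 0)" for i j
    proof -
      have "(\<Sum>k\<in>UNIV. Householder m $ i $ k * Householder m $ j $ k) =
        (\<Sum>k\<in>UNIV. (if k = i then (if i = j then 1 else 0) - 2 * (w $ i * w $ j) else 0)
          + (if k = j then - 2 * (w $ i * w $ j) else 0) + 4 * (w $ i * w $ j) * (w $ k * w $ k))"
        by (rule sum.cong) (auto simp: H algebra_simps)
      also have "\<dots> = (if i = j then 1 else 0) - 4 * (w $ i * w $ j) + 4 * (w $ i * w $ j) * (\<Sum>k\<in>UNIV. w $ k * w $ k)"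
        by (simp add: sum.distrib flip: sum_distrib_left)
      also have "(\<Sum>k\<in>UNIV. w $ k * w $ k) = 1" using ww by (simp add: sum_3)
      finally show ?thesis by simp
    qed
    then have "Householder m ** Finite_Cartesian_Product.transpose (Householder m) = Finite_Cartesian_Product.mat 1"
      by (simp add: Finite_Cartesian_Product.vec_eq_iff matrix_matrix_mult_def Finite_Cartesian_Product.transpose_def
          Finite_Cartesian_Product.mat_def)
    moreover have "Householder m $ i $ 3 = (-1) * m $ i" for i
    proof -
      have "w $ i * w $ 3 = \<rho> * \<rho> * ((m $ i + (if i = 3 then 1 else 0)) * (1 + m $ 3))"
        using exhaust_3[of i] by (auto simp: w)
      also have "\<dots> = (\<rho> * \<rho> * (2 * (1 + m $ 3))) * (m $ i + (if i = 3 then 1 else 0)) / 2" by simp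
      finally show ?thesis unfolding \<rho> by (simp add: H)
    qed
    ultimately show ?thesis by (intro conjI exI[of _ "-1"]) auto
  qed
  then show "Householder m ** Finite_Cartesian_Product.transpose (Householder m) = Finite_Cartesian_Product.mat 1"
    "\<exists>s. s * s = 1 \<and> (\<forall>i. Householder m $ i $ 3 = s * m $ i)" by auto
qed

text \<open>Rows of an orthogonal matrix are orthonormal, so the outer products of its three columns
  sum to the identity. Removing the third leaves the identity minus the outer product of
  \<open>m\<close> with itself; the sign cancels.\<close>

lemma H_mat_orthonormal:
  assumes m: "norm m = 1"
  shows "Finite_Cartesian_Product.transpose (H_mat m) *v (H_mat m *v y) = y"
    and "H_mat m *v (Finite_Cartesian_Product.transpose (H_mat m) *v x) = x - (m \<bullet> x) *\<^sub>R m"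
proof -
  define R where "R = Householder m"
  have HR: "H_mat m $ i $ j = (if j = 1 then R $ i $ 1 else R $ i $ 2)" for i j
    by (simp add: H_mat_def R_def matrix_vector_mult_basis column_def)
  obtain s where s: "s * s = 1" "\<And>i. R $ i $ 3 = s * m $ i" using Householder_orthogonal(2)[OF m] by (auto simp: R_def)
  have RRt: "R ** Finite_Cartesian_Product.transpose R = Finite_Cartesian_Product.mat 1"
    using Householder_orthogonal(1)[OF m] by (simp add: R_def)
  then have RtR: "Finite_Cartesian_Product.transpose R ** R = Finite_Cartesian_Product.mat 1"
    by (simp add: matrix_left_right_inverse)
  have r: "(\<Sum>k\<in>UNIV. R $ i $ k * R $ j $ k) = (if i = j then 1 else 0)" for i j
    using RRt by (simp add: Finite_Cartesian_Product.vec_eq_iff matrix_matrix_mult_def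
      Finite_Cartesian_Product.transpose_def Finite_Cartesian_Product.mat_def)
  have l: "(\<Sum>k\<in>UNIV. R $ k $ i * R $ k $ j) = (if i = j then 1 else 0)" for i j
    using RtR by (simp add: Finite_Cartesian_Product.vec_eq_iff matrix_matrix_mult_def
      Finite_Cartesian_Product.transpose_def Finite_Cartesian_Product.mat_def)
  have "Finite_Cartesian_Product.transpose (H_mat m) ** H_mat m = Finite_Cartesian_Product.mat 1"
    using l[of 1 1] l[of 1 2] l[of 2 1] l[of 2 2]
    by (simp add: Finite_Cartesian_Product.vec_eq_iff forall_2 matrix_matrix_mult_def Finite_Cartesian_Product.transpose_def
        Finite_Cartesian_Product.mat_def HR)
  then show "Finite_Cartesian_Product.transpose (H_mat m) *v (H_mat m *v y) = y"
    by (simp add: matrix_vector_mul_assoc)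
  have hh: "R $ i $ 1 * R $ j $ 1 + R $ i $ 2 * R $ j $ 2 = (if i = j then 1 else 0) - m $ i * m $ j" for i j
  proof -
    have "R $ i $ 3 * R $ j $ 3 = m $ i * m $ j" 
    proof -
      have "R $ i $ 3 * R $ j $ 3 = (s * s) * (m $ i * m $ j)" unfolding s(2) by (simp only: ac_simps)
      then show ?thesis using s(1) by simp
    qed
    then show ?thesis using r[of i j] by (simp add: sum_3)
  qed
  have "H_mat m ** Finite_Cartesian_Product.transpose (H_mat m) = (\<chi> i j. (if i = j then 1 else 0) - m $ i * m $ j)"
    by (simp add: Finite_Cartesian_Product.vec_eq_iff matrix_matrix_mult_def Finite_Cartesian_Product.transpose_def HR sum_2 hh)
  then have "H_mat m *v (Finite_Cartesian_Product.transpose (H_mat m) *v x) = (\<chi> i j. (if i = j then 1 else 0) - m $ i * m $ j) *v x"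
    by (metis matrix_vector_mul_assoc)
  also have "\<dots> = x - (m \<bullet> x) *\<^sub>R m"
    by (simp add: Finite_Cartesian_Product.vec_eq_iff forall_3 matrix_vector_mult_def sum_3 inner_vec_def algebra_simps)
  finally show "H_mat m *v (Finite_Cartesian_Product.transpose (H_mat m) *v x) = x - (m \<bullet> x) *\<^sub>R m" .
qed

text \<open>Bridge from flat coefficient vectors to the fixed-size vectors on which the Householder
  matrices act; in these terms \<open>Q_mat\<close> works node by node.\<close>

definition nodal3 :: "real Matrix.vec \<Rightarrow> nat \<Rightarrow> real^3" where
  "nodal3 v j = (\<chi> i. if i = 1 then vec_index v (3 * j) else if i = 2 then vec_index v (3 * j + 1) else vec_index v (3 * j + 2))"

definition nodal2 :: "real Matrix.vec \<Rightarrow> nat \<Rightarrow> real^2" where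
  "nodal2 y j = (\<chi> i. if i = 1 then vec_index y (2 * j) else vec_index y (2 * j + 1))"

lemma nodal3_eqD:
  assumes "u \<in> carrier_vec (3 * n)" "v \<in> carrier_vec (3 * n)" "\<And>j. j < n \<Longrightarrow> nodal3 u j = nodal3 v j"
  shows "u = v"
proof (rule eq_vecI)
  fix i assume "i < dim_vec v"
  then have j: "i div 3 < n" using assms(2) by auto
  have "i = 3 * (i div 3) + i mod 3" "i mod 3 < 3" by auto
  then consider "i = 3 * (i div 3)" | "i = 3 * (i div 3) + 1" | "i = 3 * (i div 3) + 2" by linarith
  then show "vec_index u i = vec_index v i"
    using assms(3)[OF j] by cases (auto simp: nodal3_def Finite_Cartesian_Product.vec_eq_iff forall_3)
qed (use assms in auto)

lemma nodal2_eqD: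
  assumes "u \<in> carrier_vec (2 * n)" "v \<in> carrier_vec (2 * n)" "\<And>j. j < n \<Longrightarrow> nodal2 u j = nodal2 v j"
  shows "u = v"
proof (rule eq_vecI)
  fix i assume "i < dim_vec v"
  then have j: "i div 2 < n" using assms(2) by auto
  have "i = 2 * (i div 2) + i mod 2" "i mod 2 < 2" by auto
  then consider "i = 2 * (i div 2)" | "i = 2 * (i div 2) + 1" by linarith
  then show "vec_index u i = vec_index v i"
    using assms(3)[OF j] by cases (auto simp: nodal2_def Finite_Cartesian_Product.vec_eq_iff forall_2)
qed (use assms in auto)

definition node_block :: "llg_data \<Rightarrow> (real^3 \<Rightarrow> real^3) \<Rightarrow> nat \<Rightarrow> real^2^3" where
  "node_block D m j = Tmat D ** H_mat (Tmat D *v m (node D j))"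

lemma div_mod_3: "Suc (3 * j) div 3 = (j::nat)" "Suc (Suc (3 * j)) div 3 = j"
   "Suc (3 * j) mod 3 = Suc 0" "Suc (Suc (3 * j)) mod 3 = Suc (Suc 0)"
  by presburger+

lemma div_mod_2: "Suc (2 * j) div 2 = (j::nat)" "Suc (2 * j) mod 2 = Suc 0"
  by presburger+

text \<open>Stated for unevaluated \<open>Suc\<close> terms, the shape of the indices after
  \<open>div_mod_3\<close> and \<open>div_mod_2\<close>; hence the removal of
  \<open>of_nat_Suc\<close> from the simplifier at the uses.\<close>

lemma of_nat_Suc_index:
  "of_nat (Suc 0) = (1 :: 3)" "of_nat (Suc (Suc 0)) = (2 :: 3)" "of_nat (Suc (Suc (Suc 0))) = (3 :: 3)"
  "of_nat (Suc 0) = (1 :: 2)" "of_nat (Suc (Suc 0)) = (2 :: 2)"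
  by simp_all

lemma Q_mat_entry:
  assumes "i < 3 * num_nodes D" "j < 2 * num_nodes D"
  shows "Q_mat D m $$ (i, j) = (if i div 3 = j div 2
     then node_block D m (i div 3) $ of_nat (Suc (i mod 3)) $ of_nat (Suc (j mod 2)) else 0)"
  using assms by (simp add: Q_mat_def node_block_def)

lemma Q_mat_mult_index:
  assumes i: "i < 3 * num_nodes D" and y: "y \<in> carrier_vec (2 * num_nodes D)"
  shows "vec_index (Q_mat D m *\<^sub>v y) i = (node_block D m (i div 3) *v nodal2 y (i div 3)) $ of_nat (Suc (i mod 3))"
proof -
  define N where "N = num_nodes D"
  have ij: "i div 3 < N" using i by (auto simp: N_def)
  have "vec_index (Q_mat D m *\<^sub>v y) i = (\<Sum>j<2 * N. Q_mat D m $$ (i, j) * vec_index y j)"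
    using i y by (simp add: Q_mat_def scalar_prod_def lessThan_atLeast0 N_def)
  also have "\<dots> = (\<Sum>j<N. if j = i div 3 then (node_block D m (i div 3) *v nodal2 y (i div 3)) $ of_nat (Suc (i mod 3)) else 0)"
    unfolding sum_lessThan_mult2
  proof (rule sum.cong)
    fix j assume "j \<in> {..<N}"
    then have "2 * j < 2 * num_nodes D" "2 * j + 1 < 2 * num_nodes D" by (auto simp: N_def)
    then show "Q_mat D m $$ (i, 2 * j) * vec_index y (2 * j) + Q_mat D m $$ (i, 2 * j + 1) * vec_index y (2 * j + 1) =
       (if j = i div 3 then (node_block D m (i div 3) *v nodal2 y (i div 3)) $ of_nat (Suc (i mod 3)) else 0)"
      using i by (simp add: Q_mat_entry div_mod_2 of_nat_Suc_index matrix_vector_mult_def sum_2 nodal2_def del: of_nat_Suc)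
  qed simp
  finally show ?thesis using ij by simp
qed

lemma QT_mat_mult_index:
  assumes i: "i < 2 * num_nodes D" and v: "v \<in> carrier_vec (3 * num_nodes D)"
  shows "vec_index (transpose_mat (Q_mat D m) *\<^sub>v v) i =
    (Finite_Cartesian_Product.transpose (node_block D m (i div 2)) *v nodal3 v (i div 2)) $ of_nat (Suc (i mod 2))"
proof -
  define N where "N = num_nodes D"
  have ij: "i div 2 < N" using i by (auto simp: N_def)
  have "vec_index (transpose_mat (Q_mat D m) *\<^sub>v v) i = (\<Sum>j<3 * N. Q_mat D m $$ (j, i) * vec_index v j)"
    using i v by (simp add: Q_mat_def scalar_prod_def lessThan_atLeast0 N_def)
  also have "\<dots> = (\<Sum>j<N. if j = i div 2 then
      (Finite_Cartesian_Product.transpose (node_block D m (i div 2)) *v nodal3 v (i div 2)) $ of_nat (Suc (i mod 2)) else 0)"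
    unfolding sum_lessThan_mult3
  proof (rule sum.cong)
    fix j assume "j \<in> {..<N}"
    then have "3 * j < 3 * num_nodes D" "3 * j + 1 < 3 * num_nodes D" "3 * j + 2 < 3 * num_nodes D" by (auto simp: N_def)
    then show "Q_mat D m $$ (3 * j, i) * vec_index v (3 * j) + Q_mat D m $$ (3 * j + 1, i) * vec_index v (3 * j + 1)
        + Q_mat D m $$ (3 * j + 2, i) * vec_index v (3 * j + 2) =
       (if j = i div 2 then
         (Finite_Cartesian_Product.transpose (node_block D m (i div 2)) *v nodal3 v (i div 2)) $ of_nat (Suc (i mod 2)) else 0)"
      using i by (simp add: Q_mat_entry div_mod_3 matrix_vector_mult_def sum_3 nodal3_def
          Finite_Cartesian_Product.transpose_def of_nat_Suc_index del: of_nat_Suc)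
  qed simp
  finally show ?thesis using ij by simp
qed

lemma nodal3_Q_mult:
  assumes "j < num_nodes D" "y \<in> carrier_vec (2 * num_nodes D)"
  shows "nodal3 (Q_mat D m *\<^sub>v y) j = node_block D m j *v nodal2 y j"
  using assms Q_mat_mult_index[of "3 * j" D y m] Q_mat_mult_index[of "3 * j + 1" D y m] Q_mat_mult_index[of "3 * j + 2" D y m]
  by (simp add: div_mod_3 of_nat_Suc_index Finite_Cartesian_Product.vec_eq_iff forall_3 nodal3_def del: of_nat_Suc)

lemma nodal2_QT_mult:
  assumes "j < num_nodes D" "v \<in> carrier_vec (3 * num_nodes D)"
  shows "nodal2 (transpose_mat (Q_mat D m) *\<^sub>v v) j =
    Finite_Cartesian_Product.transpose (node_block D m j) *v nodal3 v j"
  using assms QT_mat_mult_index[of "2 * j" D v m] QT_mat_mult_index[of "2 * j + 1" D v m]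
  by (simp add: div_mod_2 of_nat_Suc_index Finite_Cartesian_Product.vec_eq_iff forall_2 nodal2_def del: of_nat_Suc)

subsection \<open>The discrete system\<close>

context fem_mesh
begin

lemma S_h_vec_add: "u \<in> S_h_vec \<Omega> \<T> \<Longrightarrow> v \<in> S_h_vec \<Omega> \<T> \<Longrightarrow> (\<lambda>x. u x + v x) \<in> S_h_vec \<Omega> \<T>"
proof -
  have S: "(\<lambda>x. f x + g x) \<in> S_h \<Omega> \<T>" if f: "f \<in> S_h \<Omega> \<T>" and g: "g \<in> S_h \<Omega> \<T>" for f g
    unfolding S_h_def
  proof (intro CollectI conjI ballI)
    show "continuous_on (closure \<Omega>) (\<lambda>x. f x + g x)" using f g by (auto simp: S_h_def intro: continuous_on_add)
    fix K assume "K \<in> \<T>"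
    then have "\<exists>a b. \<forall>x\<in>K. f x = a \<bullet> x + b" "\<exists>a b. \<forall>x\<in>K. g x = a \<bullet> x + b"
      using f g by (auto simp: S_h_def)
    then obtain a b a' b' where "\<forall>x\<in>K. f x = a \<bullet> x + b" "\<forall>x\<in>K. g x = a' \<bullet> x + b'" by (elim exE)
    then have "\<forall>x\<in>K. f x + g x = (a + a') \<bullet> x + (b + b')" by (simp add: inner_add_left)
    then show "\<exists>a c. \<forall>x\<in>K. f x + g x = a \<bullet> x + c" by blast
  qed
  assume "u \<in> S_h_vec \<Omega> \<T>" "v \<in> S_h_vec \<Omega> \<T>"
  then show ?thesis by (simp add: S_h_vec_def S)
qed

lemma S_h_scale: "f \<in> S_h \<Omega> \<T> \<Longrightarrow> (\<lambda>x. r * f x) \<in> S_h \<Omega> \<T>"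
  unfolding S_h_def
proof (intro CollectI conjI ballI)
  assume f: "f \<in> {u. continuous_on (closure \<Omega>) u \<and> (\<forall>K\<in>\<T>. \<exists>a c. \<forall>x\<in>K. u x = a \<bullet> x + c)}"
  show "continuous_on (closure \<Omega>) (\<lambda>x. r * f x)" using f by (auto intro: continuous_on_mult_left)
  fix K assume "K \<in> \<T>"
  then obtain a b where "\<And>x. x \<in> K \<Longrightarrow> f x = a \<bullet> x + b" using f by blast
  then have "\<forall>x\<in>K. r * f x = (r *\<^sub>R a) \<bullet> x + r * b" by (simp add: distrib_left)
  then show "\<exists>a c. \<forall>x\<in>K. r * f x = a \<bullet> x + c" by blast
qed

lemma S_h_vec_scale: "u \<in> S_h_vec \<Omega> \<T> \<Longrightarrow> (\<lambda>x. r *\<^sub>R u x) \<in> S_h_vec \<Omega> \<T>"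
  by (simp add: S_h_vec_def S_h_scale)

lemma S_h_vec_zero: "(\<lambda>x. 0) \<in> S_h_vec \<Omega> \<T>"
  by (auto simp: S_h_vec_def S_h_def intro!: exI[of _ 0])

lemma S_h_vec_sum:
  assumes "\<And>i. i \<in> I \<Longrightarrow> u i \<in> S_h_vec \<Omega> \<T>"
  shows "(\<lambda>x. \<Sum>i\<in>I. r i *\<^sub>R u i x) \<in> S_h_vec \<Omega> \<T>"
proof (cases "finite I")
  case True
  then show ?thesis using assms
    by (induction I rule: finite_induct) (simp_all add: S_h_vec_zero S_h_vec_add S_h_vec_scale)
qed (simp add: S_h_vec_zero)

lemma grad_sum_interior:
  assumes u: "\<And>i. i \<in> I \<Longrightarrow> u i \<in> S_h_vec \<Omega> \<T>" and I: "finite I" and K: "K \<in> \<T>" "x \<in> interior K"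
  shows "grad (\<lambda>x. \<Sum>i\<in>I. r i *\<^sub>R u i x) x = (\<Sum>i\<in>I. r i *\<^sub>R grad (u i) x)"
proof -
  have "\<exists>G. (u i has_derivative (\<lambda>y. G *v y)) (at x) \<and> grad (u i) x = G" if "i \<in> I" for i
    using fe_affine[OF u[OF that] K(1)] K(2) by metis
  then have "\<forall>i\<in>I. \<exists>G. (u i has_derivative (\<lambda>y. G *v y)) (at x) \<and> grad (u i) x = G" by blast
  from bchoice[OF this] obtain G where
    G: "\<And>i. i \<in> I \<Longrightarrow> (u i has_derivative (\<lambda>y. G i *v y)) (at x)" "\<And>i. i \<in> I \<Longrightarrow> grad (u i) x = G i" by blast
  have "((\<lambda>x. \<Sum>i\<in>I. r i *\<^sub>R u i x) has_derivative (\<lambda>y. \<Sum>i\<in>I. r i *\<^sub>R (G i *v y))) (at x)"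
    by (intro has_derivative_sum has_derivative_scaleR_right G(1))
  also have "(\<lambda>y. \<Sum>i\<in>I. r i *\<^sub>R (G i *v y)) = (\<lambda>y. (\<Sum>i\<in>I. r i *\<^sub>R G i) *v y)"
    using I by (induction I rule: finite_induct)
      (simp_all add: fun_eq_iff matrix_vector_mult_add_rdistrib scaleR_matrix_vector_assoc)
  finally have "frechet_derivative (\<lambda>x. \<Sum>i\<in>I. r i *\<^sub>R u i x) (at x) = (\<lambda>y. (\<Sum>i\<in>I. r i *\<^sub>R G i) *v y)"
    by (rule frechet_derivative_at[symmetric])
  then have "grad (\<lambda>x. \<Sum>i\<in>I. r i *\<^sub>R u i x) x = (\<Sum>i\<in>I. r i *\<^sub>R G i)"
    unfolding grad_def by (simp only: matrix_of_matrix_vector_mul)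
  then show ?thesis using G(2) by simp
qed

text \<open>One computation for all four matrices: weights and cross products are absorbed into the
  row functions \<open>f\<close>.\<close>

lemma L2_inner_sum:
  fixes f g :: "nat \<Rightarrow> real^3 \<Rightarrow> 'b::euclidean_space"
  assumes f: "\<And>i. i < n \<Longrightarrow> ess_bounded (f i)" and g: "\<And>i. i < n \<Longrightarrow> ess_bounded (g i)"
    and v: "v \<in> carrier_vec n" and w: "w \<in> carrier_vec n"
  shows "scalar_prod v (Matrix.mat n n (\<lambda>(i, j). L2_inner \<Omega> (f i) (g j)) *\<^sub>v w) =
     L2_inner \<Omega> (\<lambda>x. \<Sum>i<n. vec_index v i *\<^sub>R f i x) (\<lambda>x. \<Sum>j<n. vec_index w j *\<^sub>R g j x)"
proof -
  have int: "integrable (lebesgue_on \<Omega>) (\<lambda>x. f i x \<bullet> g j x)" if "i < n" "j < n" for i j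
    by (intro ess_bounded_integrable ess_bounded_inner f g that)
  have "L2_inner \<Omega> (\<lambda>x. \<Sum>i<n. vec_index v i *\<^sub>R f i x) (\<lambda>x. \<Sum>j<n. vec_index w j *\<^sub>R g j x) =
    integral\<^sup>L (lebesgue_on \<Omega>) (\<lambda>x. \<Sum>i<n. \<Sum>j<n. vec_index v i * vec_index w j * (f i x \<bullet> g j x))"
    unfolding L2_inner_def inner_sum_left unfolding inner_sum_right by (simp add: mult.assoc mult.left_commute)
  also have "\<dots> = (\<Sum>i<n. integral\<^sup>L (lebesgue_on \<Omega>) (\<lambda>x. \<Sum>j<n. vec_index v i * vec_index w j * (f i x \<bullet> g j x)))"
    by (intro Bochner_Integration.integral_sum Bochner_Integration.integrable_sum integrable_mult_right int) auto
  also have "\<dots> = (\<Sum>i<n. \<Sum>j<n. integral\<^sup>L (lebesgue_on \<Omega>) (\<lambda>x. vec_index v i * vec_index w j * (f i x \<bullet> g j x)))"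
    by (intro sum.cong refl Bochner_Integration.integral_sum integrable_mult_right int) auto
  also have "\<dots> = (\<Sum>i<n. \<Sum>j<n. vec_index v i * vec_index w j * L2_inner \<Omega> (f i) (g j))"
    by (simp add: L2_inner_def)
  finally show ?thesis by (simp add: scalar_prod_mat_mult[OF v w])
qed

text \<open>Linear combinations can be pulled out of \<open>grad\<close> in element interiors; on
  the null set in between its values are arbitrary, and here this is shown to be harmless.\<close>

lemma L2_inner_cong_mesh:
  assumes "ess_bounded f" "ess_bounded g" "ess_bounded f'" "ess_bounded g'"
    and "\<And>K x. K \<in> \<T> \<Longrightarrow> x \<in> interior K \<Longrightarrow> f x = f' x" "\<And>K x. K \<in> \<T> \<Longrightarrow> x \<in> interior K \<Longrightarrow> g x = g' x"
  shows "L2_inner \<Omega> f g = L2_inner \<Omega> f' g'"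
  unfolding L2_inner_def
proof (rule integral_cong_AE)
  show "AE x in lebesgue_on \<Omega>. f x \<bullet> g x = f' x \<bullet> g' x" by (rule AE_mesh) (simp add: assms(5,6))
qed (use assms ess_bounded_inner in \<open>auto simp: ess_bounded_def\<close>)

lemma ess_bounded_sum:
  assumes "\<And>i. i < n \<Longrightarrow> ess_bounded (f i)" shows "ess_bounded (\<lambda>x. \<Sum>i<(n::nat). r i *\<^sub>R f i x)"
  using assms
proof (induction n)
  case (Suc n)
  have "ess_bounded (\<lambda>x. r n *\<^sub>R f n x)"
    using ess_bounded_scaleR[OF ess_bounded_const Suc.prems] by simp
  then show ?case using Suc ess_bounded_add[of "\<lambda>x. \<Sum>i<n. r i *\<^sub>R f i x"] by simp
qed (simp add: ess_bounded_const)

lemma L2_inner_self_nonneg: "0 \<le> L2_inner \<Omega> f f"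
  by (simp add: L2_inner_def integral_nonneg_AE)

text \<open>The maximum bound on an element containing \<open>z\<close> turns a nonzero nodal value
  into positive mass; this is what makes \<open>B_mat\<close> positive definite.\<close>

lemma L2_inner_self_pos:
  assumes u: "u \<in> S_h_vec \<Omega> \<T>" and z: "z \<in> mesh_nodes \<T>" "u z \<noteq> 0"
  shows "0 < L2_inner \<Omega> u u"
proof -
  obtain K where K: "K \<in> \<T>" "z \<in> K" using z by (auto simp: mesh_nodes_def extreme_point_of_def)
  let ?I = "\<lambda>K. integral\<^sup>L (lebesgue_on (interior K)) (\<lambda>x. (norm (u x))\<^sup>2)"
  have "0 < measure lebesgue (interior K)" using measure_interior_ge[OF K(1)] h_pos by (smt (verit) zero_less_power)
  then have "0 < measure lebesgue (interior K) * (norm (u z))\<^sup>2" using z by simp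
  also have "\<dots> \<le> 256 * ?I K" by (rule fe_max_le_integral[OF u K])
  also have "?I K \<le> (\<Sum>K\<in>\<T>. ?I K)" using K fin by (intro member_le_sum) auto
  also have "\<dots> = L2_inner \<Omega> u u"
    using integral_mesh(2)[OF norm_sq_integrable_interior[OF fe_ess_bounded[OF u]]]
    by (simp add: L2_inner_def power2_norm_eq_inner)
  finally show ?thesis by simp
qed

end

lemma smult_mat_mult_vec:
  fixes A :: "real mat"
  assumes "A \<in> carrier_mat nr nc" "v \<in> carrier_vec nc"
  shows "(a \<cdot>\<^sub>m A) *\<^sub>v v = a \<cdot>\<^sub>v (A *\<^sub>v v)"
  using assms by (intro eq_vecI) (auto simp: scalar_prod_def sum_distrib_left mult.assoc)

section \<open>One time step: data, weight and nodes\<close>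

locale llg =
  fixes Cmesh :: real and D :: llg_data and m :: "real^3 \<Rightarrow> real^3" and \<alpha>P :: real
  assumes setting: "llg_setting Cmesh D" and m: "m \<in> M_h (Dom D) (Mesh D)" and \<alpha>P_ge: "\<alpha>P \<ge> alpha D"
begin

sublocale fem_mesh Cmesh "mesh_size D" "Dom D" "Mesh D"
  using setting by unfold_locales (auto simp: llg_setting_def)

abbreviation "n \<equiv> 3 * num_nodes D"
definition \<beta>k :: real where "\<beta>k = beta D (step_size D) * step_size D"

lemma alpha_pos: "0 < alpha D" and alpha_P_pos: "0 < \<alpha>P"
  using setting \<alpha>P_ge by (auto simp: llg_setting_def)

lemma step_size_pos: "0 < step_size D" using setting by (auto simp: llg_setting_def step_size_def)

lemma \<beta>k_pos: "0 < \<beta>k" using setting step_size_pos by (auto simp: llg_setting_def \<beta>k_def)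

lemma m_fe: "m \<in> S_h_vec (Dom D) (Mesh D)" using m by (simp add: M_h_def)

lemma node_bij: "bij_betw (node D) {..<num_nodes D} (mesh_nodes (Mesh D))"
  using setting by (simp add: llg_setting_def)

lemma node_in: "j < num_nodes D \<Longrightarrow> node D j \<in> mesh_nodes (Mesh D)"
  using node_bij by (auto simp: bij_betw_def)

lemma W_lambda_ge: "alpha D / 2 \<le> W_lambda D m x"
proof -
  have pos: "\<And>k s. k > 0 \<Longrightarrow> Wfun D k s > 0" using setting by (auto simp: llg_setting_def)
  have "alpha D / 2 \<le> (INF k\<in>{0<..}. INF s. Wfun D k s)" using setting by (simp add: llg_setting_def)
  also have "\<dots> \<le> (INF s. Wfun D (step_size D) s)"
  \<comment> \<open>The infima are over sets of reals and need lower bounds to be meaningful;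
    positivity of \<open>Wfun\<close> supplies 0.\<close>
  proof (rule cINF_lower)
    show "bdd_below ((\<lambda>k. INF s. Wfun D k s) ` {0<..})"
      by (rule bdd_belowI2[of _ 0]) (auto intro!: cINF_greatest less_imp_le[OF pos])
  qed (use step_size_pos in auto)
  also have "\<dots> \<le> Wfun D (step_size D) (lambda_h D m x)"
    by (rule cINF_lower) (auto intro!: bdd_belowI2[of _ 0] less_imp_le[OF pos] step_size_pos)
  finally show ?thesis by (simp add: W_lambda_def)
qed

text \<open>The hypothesis on \<open>pi_op\<close> only speaks about \<open>H1\<close>; without \<open>m \<in> H1\<close> the weight might fail to be measurable and
  \<open>Linf_norm\<close> would degenerate to the junk value 0.\<close>

lemma W_lambda_ess_bounded: "ess_bounded (W_lambda D m)"
proof -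
  let ?t = "real (step_index D) * step_size D"
  have t: "?t \<in> {0..final_time D}"
  proof -
    have s: "step_index D < num_steps D" "final_time D > 0" using setting by (auto simp: llg_setting_def)
    have "?t = final_time D * (real (step_index D) / real (num_steps D))" by (simp add: step_size_def)
    also have "\<dots> \<le> final_time D * 1" using s by (intro mult_left_mono) auto
    finally show ?thesis using step_size_pos by simp
  qed
  have "ffun D ?t \<in> L2 (Dom D)" using setting t by (auto simp: llg_setting_def C1_L2_def)
  moreover have "pi_op D m \<in> L2 (Dom D)"
    using setting fe_in_H1[OF m_fe] by (auto simp: llg_setting_def bounded_operator_H1_L2_def)
  moreover have "m \<in> borel_measurable (lebesgue_on (Dom D))" "grad m \<in> borel_measurable (lebesgue_on (Dom D))"
    using fe_ess_bounded[OF m_fe] fe_grad_ess_bounded[OF m_fe] by (auto simp: ess_bounded_def)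
  ultimately have "lambda_h D m \<in> borel_measurable (lebesgue_on (Dom D))"
    unfolding lambda_h_def[abs_def] L2_def
    by (auto intro!: borel_measurable_add borel_measurable_times borel_measurable_inner borel_measurable_power
        borel_measurable_norm borel_measurable_const)
  moreover have "Wfun D (step_size D) \<in> borel_measurable borel" "bounded (range (Wfun D (step_size D)))"
    using setting step_size_pos by (auto simp: llg_setting_def)
  ultimately have "W_lambda D m \<in> borel_measurable (lebesgue_on (Dom D))"
    unfolding W_lambda_def[abs_def] by (rule_tac measurable_compose)
  moreover obtain B where "\<And>s. norm (Wfun D (step_size D) s) \<le> B"
    using \<open>bounded (range (Wfun D (step_size D)))\<close> by (auto simp: bounded_iff)
  ultimately show ?thesis by (intro ess_boundedI[of _ B] AE_I2) (auto simp: W_lambda_def)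
qed

section \<open>Coefficient vectors and the bilinear forms of the matrices\<close>

lemma basis_fe: assumes "i < n" shows "basis_fun D i \<in> S_h_vec (Dom D) (Mesh D)"
proof -
  have "i div 3 < num_nodes D" using assms by auto
  then have "hat D (i div 3) \<in> S_h (Dom D) (Mesh D)" using setting by (simp add: llg_setting_def)
  from S_h_scale[OF this] show ?thesis
    by (simp add: S_h_vec_def basis_fun_def mult.commute[of "hat D (i div 3) _"])
qed

definition fe :: "real Matrix.vec \<Rightarrow> real^3 \<Rightarrow> real^3" where
  "fe v x = (\<Sum>i<n. vec_index v i *\<^sub>R basis_fun D i x)"

lemma fe_S_h_vec: "fe v \<in> S_h_vec (Dom D) (Mesh D)"
  unfolding fe_def[abs_def] by (rule S_h_vec_sum) (simp add: basis_fe)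

lemma fe_node:
  assumes j: "j < num_nodes D"
  shows "fe v (node D j) = nodal3 v j"
proof -
  have hat: "hat D i (node D j) = (if i = j then 1 else 0)" if "i < num_nodes D" for i
    using setting j that by (auto simp: llg_setting_def)
  have "fe v (node D j) = (\<Sum>i<num_nodes D. if i = j then nodal3 v j else 0)"
    unfolding fe_def sum_lessThan_mult3
  proof (rule sum.cong)
    fix i assume "i \<in> {..<num_nodes D}"
    then show "vec_index v (3 * i) *\<^sub>R basis_fun D (3 * i) (node D j) + vec_index v (3 * i + 1) *\<^sub>R basis_fun D (3 * i + 1) (node D j)
       + vec_index v (3 * i + 2) *\<^sub>R basis_fun D (3 * i + 2) (node D j) = (if i = j then nodal3 v j else 0)"
      by (simp add: basis_fun_def div_mod_3 of_nat_Suc_index hat Finite_Cartesian_Product.vec_eq_iff forall_3 axis_def nodal3_def del: of_nat_Suc)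
  qed simp
  then show ?thesis using j by simp
qed

lemma mass_form:
  assumes "v \<in> carrier_vec n" "w \<in> carrier_vec n"
  shows "scalar_prod v (mass_mat D *\<^sub>v w) = L2_inner (Dom D) (fe v) (fe w)"
  unfolding mass_mat_def fe_def[abs_def]
  by (rule L2_inner_sum) (simp_all add: assms fe_ess_bounded basis_fe)

lemma grad_fe:
  assumes "K \<in> Mesh D" "x \<in> interior K"
  shows "grad (fe v) x = (\<Sum>i<n. vec_index v i *\<^sub>R grad (basis_fun D i) x)"
  unfolding fe_def[abs_def] by (rule grad_sum_interior[OF _ _ assms]) (simp_all add: basis_fe)

lemma stiffness_form:
  assumes "v \<in> carrier_vec n" "w \<in> carrier_vec n"
  shows "scalar_prod v (stiffness_mat D *\<^sub>v w) = L2_inner (Dom D) (grad (fe v)) (grad (fe w))"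
proof -
  have gb: "ess_bounded (grad (basis_fun D i))" if "i < n" for i by (rule fe_grad_ess_bounded[OF basis_fe[OF that]])
  have "scalar_prod v (stiffness_mat D *\<^sub>v w) = L2_inner (Dom D)
     (\<lambda>x. \<Sum>i<n. vec_index v i *\<^sub>R grad (basis_fun D i) x) (\<lambda>x. \<Sum>j<n. vec_index w j *\<^sub>R grad (basis_fun D j) x)"
    unfolding stiffness_mat_def by (rule L2_inner_sum) (simp_all add: assms gb)
  also have "\<dots> = L2_inner (Dom D) (grad (fe v)) (grad (fe w))"
    by (rule L2_inner_cong_mesh)
      (simp_all add: ess_bounded_sum gb fe_grad_ess_bounded[OF fe_S_h_vec] grad_fe)
  finally show ?thesis .
qed

lemma weighted_mass_form:
  assumes "v \<in> carrier_vec n" "w \<in> carrier_vec n"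
  shows "alpha D * scalar_prod v (weighted_mass_mat D m *\<^sub>v w) = integral\<^sup>L (lebesgue_on (Dom D)) (\<lambda>x. W_lambda D m x * (fe v x \<bullet> fe w x))"
proof -
  have "ess_bounded (\<lambda>x. W_lambda D m x / alpha D)"
    using ess_bounded_scaleR[OF W_lambda_ess_bounded ess_bounded_const[of "1 / alpha D"]] by simp
  then have e: "ess_bounded (\<lambda>x. (W_lambda D m x / alpha D) *\<^sub>R basis_fun D i x)" if "i < n" for i
    by (rule ess_bounded_scaleR[OF _ fe_ess_bounded[OF basis_fe[OF that]]])
  have "scalar_prod v (weighted_mass_mat D m *\<^sub>v w) = L2_inner (Dom D)
     (\<lambda>x. \<Sum>i<n. vec_index v i *\<^sub>R ((W_lambda D m x / alpha D) *\<^sub>R basis_fun D i x)) (fe w)"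
    unfolding weighted_mass_mat_def fe_def[abs_def] by (rule L2_inner_sum) (simp_all add: assms e basis_fe fe_ess_bounded)
  also have "\<dots> = L2_inner (Dom D) (\<lambda>x. (W_lambda D m x / alpha D) *\<^sub>R fe v x) (fe w)"
    by (simp add: fe_def scaleR_sum_right mult.commute)
  also have "alpha D * \<dots> = integral\<^sup>L (lebesgue_on (Dom D)) (\<lambda>x. alpha D * (((W_lambda D m x / alpha D) *\<^sub>R fe v x) \<bullet> fe w x))"
    by (simp add: L2_inner_def)
  also have "\<dots> = integral\<^sup>L (lebesgue_on (Dom D)) (\<lambda>x. W_lambda D m x * (fe v x \<bullet> fe w x))"
    using alpha_pos by simp
  finally show ?thesis .
qed

lemma skew_form:
  assumes "v \<in> carrier_vec n" "w \<in> carrier_vec n"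
  shows "scalar_prod v (skew_mat D m *\<^sub>v w) = integral\<^sup>L (lebesgue_on (Dom D)) (\<lambda>x. cross3 (m x) (fe v x) \<bullet> fe w x)"
proof -
  have e: "ess_bounded (\<lambda>x. cross3 (m x) (basis_fun D i x))" if "i < n" for i
    by (rule ess_bounded_cross3[OF fe_ess_bounded[OF m_fe] fe_ess_bounded[OF basis_fe[OF that]]])
  have "scalar_prod v (skew_mat D m *\<^sub>v w) = L2_inner (Dom D)
     (\<lambda>x. \<Sum>i<n. vec_index v i *\<^sub>R cross3 (m x) (basis_fun D i x)) (fe w)"
    unfolding skew_mat_def fe_def[abs_def] by (rule L2_inner_sum) (simp_all add: assms e basis_fe fe_ess_bounded)
  also have "(\<lambda>x. \<Sum>i<n. vec_index v i *\<^sub>R cross3 (m x) (basis_fun D i x)) = (\<lambda>x. cross3 (m x) (fe v x))"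
  proof
    fix x
    have "linear (cross3 (m x))" using bilinear_cross by (simp add: bilinear_def)
    then show "(\<Sum>i<n. vec_index v i *\<^sub>R cross3 (m x) (basis_fun D i x)) = cross3 (m x) (fe v x)"
      by (simp add: fe_def linear_sum linear_cmul)
  qed
  finally show ?thesis by (simp add: L2_inner_def)
qed

definition B_mat :: "real mat" where
  "B_mat = \<alpha>P \<cdot>\<^sub>m mass_mat D + \<beta>k \<cdot>\<^sub>m stiffness_mat D"

lemma mat_carriers[simp]:
  "mass_mat D \<in> carrier_mat n n" "stiffness_mat D \<in> carrier_mat n n" "weighted_mass_mat D m \<in> carrier_mat n n"
  "skew_mat D m \<in> carrier_mat n n" "B_mat \<in> carrier_mat n n" "A_mat D m \<in> carrier_mat n n"
  "Q_mat D m \<in> carrier_mat n (2 * num_nodes D)"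
proof -
  show M: "mass_mat D \<in> carrier_mat n n" "stiffness_mat D \<in> carrier_mat n n" "weighted_mass_mat D m \<in> carrier_mat n n"
    and S: "skew_mat D m \<in> carrier_mat n n" and "Q_mat D m \<in> carrier_mat n (2 * num_nodes D)"
    unfolding mass_mat_def stiffness_mat_def weighted_mass_mat_def skew_mat_def Q_mat_def by (rule mat_carrier)+
  show "B_mat \<in> carrier_mat n n" unfolding B_mat_def by (rule add_carrier_mat[OF smult_carrier_mat[OF M(2)]])
  show "A_mat D m \<in> carrier_mat n n" unfolding A_mat_def by (rule minus_carrier_mat[OF S])
qed

lemma B_form:
  assumes "v \<in> carrier_vec n" "w \<in> carrier_vec n"
  shows "scalar_prod v (B_mat *\<^sub>v w) = \<alpha>P * L2_inner (Dom D) (fe v) (fe w) + \<beta>k * L2_inner (Dom D) (grad (fe v)) (grad (fe w))"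
proof -
  have c: "mass_mat D *\<^sub>v w \<in> carrier_vec n" "stiffness_mat D *\<^sub>v w \<in> carrier_vec n"
    by (rule mult_mat_vec_carrier[OF _ assms(2)], rule mat_carriers)+
  have "B_mat *\<^sub>v w = \<alpha>P \<cdot>\<^sub>v (mass_mat D *\<^sub>v w) + \<beta>k \<cdot>\<^sub>v (stiffness_mat D *\<^sub>v w)"
    using assms by (simp add: B_mat_def add_mult_distrib_mat_vec[of _ n n] smult_mat_mult_vec[of _ n n])
  then show ?thesis using assms c
    by (simp add: scalar_prod_add_distrib[of _ n] scalar_prod_smult_distrib[of _ n] mass_form stiffness_form)
qed

lemma A_form:
  assumes "v \<in> carrier_vec n" "w \<in> carrier_vec n"
  shows "scalar_prod v (A_mat D m *\<^sub>v w) = integral\<^sup>L (lebesgue_on (Dom D)) (\<lambda>x. W_lambda D m x * (fe v x \<bullet> fe w x))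
    + \<beta>k * L2_inner (Dom D) (grad (fe v)) (grad (fe w)) - integral\<^sup>L (lebesgue_on (Dom D)) (\<lambda>x. cross3 (m x) (fe v x) \<bullet> fe w x)"
proof -
  have c: "weighted_mass_mat D m *\<^sub>v w \<in> carrier_vec n" "stiffness_mat D *\<^sub>v w \<in> carrier_vec n" "skew_mat D m *\<^sub>v w \<in> carrier_vec n"
    by (rule mult_mat_vec_carrier[OF _ assms(2)], rule mat_carriers)+
  have "A_mat D m *\<^sub>v w = alpha D \<cdot>\<^sub>v (weighted_mass_mat D m *\<^sub>v w) + \<beta>k \<cdot>\<^sub>v (stiffness_mat D *\<^sub>v w) - skew_mat D m *\<^sub>v w"
    using assms by (simp add: A_mat_def \<beta>k_def[symmetric] minus_mult_distrib_mat_vec[of _ n n] add_mult_distrib_mat_vec[of _ n n] smult_mat_mult_vec[of _ n n])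
  then show ?thesis using assms c
    by (simp add: scalar_prod_minus_distrib[of _ n] scalar_prod_add_distrib[of _ n] scalar_prod_smult_distrib[of _ n]
       weighted_mass_form[symmetric] stiffness_form skew_form)
qed

lemma B_symmetric: "transpose_mat B_mat = B_mat"
proof (rule eq_matI)
  fix i j assume "i < dim_row B_mat" "j < dim_col B_mat"
  then have "i < n" "j < n" using mat_carriers(5) by auto
  then show "transpose_mat B_mat $$ (i, j) = B_mat $$ (i, j)"
    by (simp add: B_mat_def mass_mat_def stiffness_mat_def L2_inner_def inner_commute)
qed (use carrier_matD[OF mat_carriers(5)] in auto)

lemma B_positive:
  assumes v: "v \<in> carrier_vec n" "v \<noteq> 0\<^sub>v n"
  shows "0 < scalar_prod v (B_mat *\<^sub>v v)"
proof -
  have "\<exists>j<num_nodes D. nodal3 v j \<noteq> 0"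
  proof (rule ccontr)
    assume "\<not> (\<exists>j<num_nodes D. nodal3 v j \<noteq> 0)"
    moreover have "nodal3 (0\<^sub>v n) j = 0" if "j < num_nodes D" for j
      using that by (simp add: nodal3_def Finite_Cartesian_Product.vec_eq_iff)
    ultimately have "v = 0\<^sub>v n" using v by (intro nodal3_eqD) auto
    then show False using v by simp
  qed
  then obtain j where j: "j < num_nodes D" "nodal3 v j \<noteq> 0" by auto
  then have "0 < L2_inner (Dom D) (fe v) (fe v)"
    using fe_node by (intro L2_inner_self_pos[OF fe_S_h_vec node_in]) auto
  then have "0 < \<alpha>P * L2_inner (Dom D) (fe v) (fe v)" using alpha_P_pos by simp
  moreover have "0 \<le> \<beta>k * L2_inner (Dom D) (grad (fe v)) (grad (fe v))"
    using \<beta>k_pos L2_inner_self_nonneg by (intro mult_nonneg_nonneg) auto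
  ultimately show ?thesis using v by (simp add: B_form)
qed

text \<open>\<open>matrix_inv\<close> is a choice; invertibility makes the chosen matrix a true
  inverse, so \<open>Tmat D\<close> is an orthogonal involution.\<close>

lemma T_mat: "Tmat D ** Tmat D = Finite_Cartesian_Product.mat 1" "Finite_Cartesian_Product.transpose (Tmat D) = Tmat D"
proof -
  have "invertible (Tmat D)" "matrix_inv (Tmat D) = Tmat D" using setting by (auto simp: llg_setting_def)
  then show "Tmat D ** Tmat D = Finite_Cartesian_Product.mat 1"
    using someI_ex[of "\<lambda>A'. Tmat D ** A' = Finite_Cartesian_Product.mat 1 \<and> A' ** Tmat D = Finite_Cartesian_Product.mat 1"]
    by (simp add: invertible_def matrix_inv_def)
  show "Finite_Cartesian_Product.transpose (Tmat D) = Tmat D" using setting by (simp add: llg_setting_def)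
qed

lemma T_twice: "Tmat D *v (Tmat D *v x) = x"
  by (simp add: matrix_vector_mul_assoc T_mat(1))

lemma T_inner: "(Tmat D *v x) \<bullet> y = x \<bullet> (Tmat D *v y)"
  using dot_lmul_matrix[of x "Tmat D" y] T_mat(2) by (metis dot_matrix_vector_mul transpose_matrix_vector)

lemma T_norm: "norm (Tmat D *v x) = norm x"
  by (simp add: norm_eq_sqrt_inner T_inner T_twice)

text \<open>Conjugation by the symmetric involution \<open>Tmat D\<close> carries the projection
  orthogonal to \<open>Tmat D *v m\<close> into the one orthogonal to \<open>m\<close>, so the
  choice of \<open>Tmat D\<close> leaves no trace.\<close>

lemma node_block_QT_Q:
  assumes j: "j < num_nodes D"
  shows "Finite_Cartesian_Product.transpose (node_block D m j) *v (node_block D m j *v y) = y"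
    and "node_block D m j *v (Finite_Cartesian_Product.transpose (node_block D m j) *v x) = x - (m (node D j) \<bullet> x) *\<^sub>R m (node D j)"
proof -
  let ?m = "m (node D j)" and ?H = "H_mat (Tmat D *v m (node D j))"
  have n1: "norm (Tmat D *v ?m) = 1" using m node_in[OF j] by (simp add: T_norm M_h_def)
  have b: "node_block D m j *v y = Tmat D *v (?H *v y)" for y by (simp add: node_block_def matrix_vector_mul_assoc)
  have bt: "Finite_Cartesian_Product.transpose (node_block D m j) *v x = Finite_Cartesian_Product.transpose ?H *v (Tmat D *v x)" for x
    unfolding node_block_def matrix_transpose_mul T_mat(2) by (simp only: matrix_vector_mul_assoc)
  show "Finite_Cartesian_Product.transpose (node_block D m j) *v (node_block D m j *v y) = y"
    unfolding b bt T_twice by (rule H_mat_orthonormal(1)[OF n1])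
  show "node_block D m j *v (Finite_Cartesian_Product.transpose (node_block D m j) *v x) = x - (?m \<bullet> x) *\<^sub>R ?m"
    unfolding b bt H_mat_orthonormal(2)[OF n1]
    by (simp add: matrix_vector_mult_diff_distrib matrix_vector_mult_scaleR T_twice T_inner)
qed

lemma Q_mult_carrier: "y \<in> carrier_vec (2 * num_nodes D) \<Longrightarrow> Q_mat D m *\<^sub>v y \<in> carrier_vec n"
  by (rule mult_mat_vec_carrier[OF mat_carriers(7)])

lemma QT_mult_carrier: "v \<in> carrier_vec n \<Longrightarrow> transpose_mat (Q_mat D m) *\<^sub>v v \<in> carrier_vec (2 * num_nodes D)"
  by (rule mult_mat_vec_carrier[OF transpose_carrier_mat[THEN iffD2, OF mat_carriers(7)]])

lemma QT_Q:
  assumes y: "y \<in> carrier_vec (2 * num_nodes D)"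
  shows "transpose_mat (Q_mat D m) *\<^sub>v (Q_mat D m *\<^sub>v y) = y"
proof (rule nodal2_eqD[OF _ y])
  have Qy: "Q_mat D m *\<^sub>v y \<in> carrier_vec n" by (rule Q_mult_carrier[OF y])
  then show "transpose_mat (Q_mat D m) *\<^sub>v (Q_mat D m *\<^sub>v y) \<in> carrier_vec (2 * num_nodes D)"
    by (rule QT_mult_carrier)
  show "nodal2 (transpose_mat (Q_mat D m) *\<^sub>v (Q_mat D m *\<^sub>v y)) j = nodal2 y j" if "j < num_nodes D" for j
    using that y Qy by (simp only: nodal2_QT_mult nodal3_Q_mult node_block_QT_Q)
qed

text \<open>For \<open>\<kappa> = 1 / mesh_size D\<close> this is the factor in (i); for the maximum
  norm of \<open>grad m\<close> it is the factor in (ii) without the power of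
  \<open>\<gamma>\<close>.\<close>

definition \<Phi> :: "real \<Rightarrow> real" where
  "\<Phi> \<kappa> = 1 + \<beta>k * \<kappa>\<^sup>2 / \<alpha>P"

lemma \<Phi>_ge_1: "1 \<le> \<Phi> \<kappa>"
  unfolding \<Phi>_def using \<beta>k_pos alpha_P_pos by simp

abbreviation "C0 \<equiv> 1179648 * Cmesh ^ 6"

lemma C0_ge: "256 \<le> C0" "1 \<le> C0"
  using one_le_power[OF c_ge_1, of 6] by linarith+

text \<open>The lower-order remainder in the gradient estimate is charged to the mass part of the
  energy. Relative to it the remainder has size
  \<open>\<beta>k * \<kappa>\<^sup>2 / \<alpha>P\<close>, the excess of
  \<open>\<Phi> \<kappa>\<close> over 1.\<close>

lemma projection_stable:
  assumes v: "v \<in> carrier_vec n" and \<kappa>: "\<kappa> = 1 / mesh_size D \<or> \<kappa> = Linf_norm (Dom D) (grad m)"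
  defines "w \<equiv> Q_mat D m *\<^sub>v (transpose_mat (Q_mat D m) *\<^sub>v v)"
  shows "scalar_prod w (B_mat *\<^sub>v w) \<le> C0 * \<Phi> \<kappa> * scalar_prod v (B_mat *\<^sub>v v)"
proof -
  have QTv: "transpose_mat (Q_mat D m) *\<^sub>v v \<in> carrier_vec (2 * num_nodes D)"
    by (rule QT_mult_carrier[OF v])
  then have w: "w \<in> carrier_vec n" unfolding w_def by (rule Q_mult_carrier)
  have "fe w z = fe v z - (m z \<bullet> fe v z) *\<^sub>R m z" if z: "z \<in> mesh_nodes (Mesh D)" for z
  proof -
    obtain j where j: "j < num_nodes D" "z = node D j" using node_bij z by (auto simp: bij_betw_def)
    then show ?thesis using QTv v
      by (simp only: fe_node w_def nodal3_Q_mult nodal2_QT_mult node_block_QT_Q)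
  qed
  note P = projection_stability[OF fe_S_h_vec fe_S_h_vec m this \<kappa>]
  let ?u = "L2_inner (Dom D) (fe v) (fe v)" and ?gu = "L2_inner (Dom D) (grad (fe v)) (grad (fe v))"
  have nn: "0 \<le> ?u" "0 \<le> ?gu" by (rule L2_inner_self_nonneg)+
  have "scalar_prod w (B_mat *\<^sub>v w) \<le> \<alpha>P * (256 * ?u) + \<beta>k * (C0 * (?gu + \<kappa>\<^sup>2 * ?u))"
    unfolding B_form[OF w w] using P \<beta>k_pos alpha_P_pos by (intro add_mono mult_left_mono) auto
  also have "\<dots> \<le> \<alpha>P * (C0 * ?u) + \<beta>k * (C0 * (?gu + \<kappa>\<^sup>2 * ?u))"
    using C0_ge nn alpha_P_pos by (intro add_mono mult_left_mono mult_right_mono) auto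
  also have "\<dots> = C0 * (\<alpha>P * ?u * \<Phi> \<kappa> + \<beta>k * ?gu)"
    using alpha_P_pos by (simp add: \<Phi>_def field_simps)
  also have "\<dots> \<le> C0 * (\<alpha>P * ?u * \<Phi> \<kappa> + \<beta>k * ?gu * \<Phi> \<kappa>)"
    using C0_ge nn \<beta>k_pos mult_left_mono[OF \<Phi>_ge_1[of \<kappa>], of "\<beta>k * ?gu"] by (intro mult_left_mono add_left_mono) auto
  also have "\<dots> = C0 * \<Phi> \<kappa> * scalar_prod v (B_mat *\<^sub>v v)"
    unfolding B_form[OF v v] by (simp add: algebra_simps)
  finally show ?thesis .
qed

text \<open>The skew part vanishes on the diagonal and the weight is at least half of
  \<open>alpha D\<close>. For the stiffness part the constant is at most 1 because
  \<open>alpha D \<le> \<alpha>P\<close>.\<close>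

lemma A_coercive:
  assumes v: "v \<in> carrier_vec n"
  shows "alpha D / (2 * \<alpha>P) * scalar_prod v (B_mat *\<^sub>v v) \<le> scalar_prod v (A_mat D m *\<^sub>v v)"
proof -
  let ?u = "L2_inner (Dom D) (fe v) (fe v)" and ?gu = "L2_inner (Dom D) (grad (fe v)) (grad (fe v))"
  note eb = fe_ess_bounded[OF fe_S_h_vec[of v]]
  have "alpha D / 2 * ?u = integral\<^sup>L (lebesgue_on (Dom D)) (\<lambda>x. alpha D / 2 * (fe v x \<bullet> fe v x))"
    by (simp add: L2_inner_def)
  also have "\<dots> \<le> integral\<^sup>L (lebesgue_on (Dom D)) (\<lambda>x. W_lambda D m x * (fe v x \<bullet> fe v x))"
  proof (rule integral_mono)
    show "integrable (lebesgue_on (Dom D)) (\<lambda>x. alpha D / 2 * (fe v x \<bullet> fe v x))"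
      by (intro integrable_mult_right ess_bounded_integrable ess_bounded_inner eb)
    show "integrable (lebesgue_on (Dom D)) (\<lambda>x. W_lambda D m x * (fe v x \<bullet> fe v x))"
      using ess_bounded_scaleR[OF W_lambda_ess_bounded ess_bounded_inner[OF eb eb]] ess_bounded_integrable by simp
  qed (intro mult_right_mono W_lambda_ge inner_ge_zero)
  finally have "alpha D / 2 * ?u + \<beta>k * ?gu \<le> scalar_prod v (A_mat D m *\<^sub>v v)"
    unfolding A_form[OF v v] by (simp add: dot_cross_self)
  moreover have "alpha D / (2 * \<alpha>P) * (\<beta>k * ?gu) \<le> 1 * (\<beta>k * ?gu)"
    using alpha_pos alpha_P_pos \<alpha>P_ge \<beta>k_pos L2_inner_self_nonneg[of "grad (fe v)"]
    by (intro mult_right_mono mult_nonneg_nonneg) auto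
  moreover have "alpha D / (2 * \<alpha>P) * (\<alpha>P * ?u) = alpha D / 2 * ?u" using alpha_P_pos by simp
  ultimately show ?thesis unfolding B_form[OF v v] by (simp add: distrib_left)
qed

definition \<Lambda> :: real where
  "\<Lambda> = 1 + 1 / \<alpha>P + Linf_norm (Dom D) (\<lambda>y. W_lambda D m y - \<alpha>P) / \<alpha>P"

lemma W_diff_ess_bounded: "ess_bounded (\<lambda>y. W_lambda D m y - \<alpha>P)"
  using ess_bounded_add[OF W_lambda_ess_bounded ess_bounded_const[of "- \<alpha>P"]] by simp

lemma \<Lambda>_ge_1: "1 \<le> \<Lambda>"
  unfolding \<Lambda>_def using ess_bounded_Linf(2)[OF W_diff_ess_bounded] alpha_P_pos by simp

text \<open>The weight is at most \<open>\<alpha>P\<close> plus its distance from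
  \<open>\<alpha>P\<close>, and the cross product adds 1 because \<open>m\<close> has modulus at
  most 1. Dividing by the factor \<open>\<alpha>P\<close> in the energy gives
  \<open>\<Lambda>\<close>.\<close>

lemma A_bounded:
  assumes v: "v \<in> carrier_vec n" and w: "w \<in> carrier_vec n"
  shows "scalar_prod w (A_mat D m *\<^sub>v v) \<le> \<Lambda> / 2 * (scalar_prod v (B_mat *\<^sub>v v) + scalar_prod w (B_mat *\<^sub>v w))"
proof -
  define L where "L = Linf_norm (Dom D) (\<lambda>y. W_lambda D m y - \<alpha>P)"
  have L: "L \<ge> 0" unfolding L_def by (rule ess_bounded_Linf(2)[OF W_diff_ess_bounded])
  let ?M = "lebesgue_on (Dom D)"
  note ev = fe_ess_bounded[OF fe_S_h_vec[of v]] and ew = fe_ess_bounded[OF fe_S_h_vec[of w]]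
  note gv = fe_grad_ess_bounded[OF fe_S_h_vec[of v]] and gw = fe_grad_ess_bounded[OF fe_S_h_vec[of w]]
  note ebi = ess_bounded_integrable
  have i1: "integrable ?M (\<lambda>x. W_lambda D m x * (fe w x \<bullet> fe v x))"
    using ess_bounded_scaleR[OF W_lambda_ess_bounded ess_bounded_inner[OF ew ev]] ebi by simp
  have i2: "integrable ?M (\<lambda>x. cross3 (m x) (fe w x) \<bullet> fe v x)"
    by (intro ebi ess_bounded_inner ess_bounded_cross3 ev ew fe_ess_bounded[OF m_fe])
  have i3: "integrable ?M (\<lambda>x. fe v x \<bullet> fe v x)" "integrable ?M (\<lambda>x. fe w x \<bullet> fe w x)"
    by (intro ebi ess_bounded_inner ev ew)+
  have ae: "AE x in ?M. W_lambda D m x * (fe w x \<bullet> fe v x) - cross3 (m x) (fe w x) \<bullet> fe v x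
      \<le> (L + \<alpha>P + 1) / 2 * (fe v x \<bullet> fe v x + fe w x \<bullet> fe w x)"
  proof -
    have "AE x in ?M. norm (m x) \<le> 1" by (rule AE_mesh) (rule fe_norm_le_1[OF m _ subsetD[OF interior_subset]])
    moreover have "AE x in ?M. norm (W_lambda D m x - \<alpha>P) \<le> L"
      unfolding L_def by (rule ess_bounded_Linf(1)[OF W_diff_ess_bounded])
    ultimately show ?thesis
    proof eventually_elim
      case (elim x)
      define a b where "a = norm (fe v x)" and "b = norm (fe w x)"
      have ab: "a \<ge> 0" "b \<ge> 0" by (auto simp: a_def b_def)
      have "\<bar>fe w x \<bullet> fe v x\<bar> \<le> b * a" unfolding a_def b_def by (rule Cauchy_Schwarz_ineq2)
      moreover have W: "\<bar>W_lambda D m x\<bar> \<le> L + \<alpha>P" using elim(2) alpha_P_pos by simp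
      ultimately have "\<bar>W_lambda D m x\<bar> * \<bar>fe w x \<bullet> fe v x\<bar> \<le> (L + \<alpha>P) * (b * a)"
        using L alpha_P_pos by (intro mult_mono) auto
      then have 1: "W_lambda D m x * (fe w x \<bullet> fe v x) \<le> (L + \<alpha>P) * (b * a)"
        by (metis abs_le_D1 abs_mult)
      have "\<bar>cross3 (m x) (fe w x) \<bullet> fe v x\<bar> \<le> norm (cross3 (m x) (fe w x)) * a"
        unfolding a_def by (rule Cauchy_Schwarz_ineq2)
      also have "norm (cross3 (m x) (fe w x)) \<le> norm (m x) * b"
      proof (rule power2_le_imp_le)
        have "(norm (cross3 (m x) (fe w x)))\<^sup>2 + (m x \<bullet> fe w x)\<^sup>2 = (norm (m x) * b)\<^sup>2"
          unfolding b_def by (rule norm_cross_dot)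
        then show "(norm (cross3 (m x) (fe w x)))\<^sup>2 \<le> (norm (m x) * b)\<^sup>2"
          by (metis le_add_same_cancel1 zero_le_power2)
      qed (use ab in simp)
      also have "norm (m x) * b \<le> 1 * b" using elim(1) ab by (intro mult_right_mono) auto
      finally have 2: "- (cross3 (m x) (fe w x) \<bullet> fe v x) \<le> 1 * (b * a)" using ab by (simp add: mult_right_mono)
      have "(L + \<alpha>P) * (b * a) + 1 * (b * a) = (L + \<alpha>P + 1) * (b * a)" by (simp add: algebra_simps)
      also have "\<dots> \<le> (L + \<alpha>P + 1) * ((a\<^sup>2 + b\<^sup>2) / 2)"
        using L alpha_P_pos sum_squares_bound[of a b] by (intro mult_left_mono) (auto simp: algebra_simps)
      also have "\<dots> = (L + \<alpha>P + 1) / 2 * (fe v x \<bullet> fe v x + fe w x \<bullet> fe w x)"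
        by (simp add: a_def b_def power2_norm_eq_inner)
      finally show ?case using 1 2 by linarith
    qed
  qed
  have "integral\<^sup>L ?M (\<lambda>x. W_lambda D m x * (fe w x \<bullet> fe v x)) - integral\<^sup>L ?M (\<lambda>x. cross3 (m x) (fe w x) \<bullet> fe v x)
     = integral\<^sup>L ?M (\<lambda>x. W_lambda D m x * (fe w x \<bullet> fe v x) - cross3 (m x) (fe w x) \<bullet> fe v x)"
    using i1 i2 by simp
  also have "\<dots> \<le> integral\<^sup>L ?M (\<lambda>x. (L + \<alpha>P + 1) / 2 * (fe v x \<bullet> fe v x + fe w x \<bullet> fe w x))"
    using i1 i2 i3 ae by (intro integral_mono_AE integrable_mult_right) auto
  also have "\<dots> = (L + \<alpha>P + 1) / 2 * (L2_inner (Dom D) (fe v) (fe v) + L2_inner (Dom D) (fe w) (fe w))"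
    using i3 by (simp add: L2_inner_def)
  also have "\<dots> = \<Lambda> / 2 * (\<alpha>P * (L2_inner (Dom D) (fe v) (fe v) + L2_inner (Dom D) (fe w) (fe w)))"
    using alpha_P_pos by (simp add: \<Lambda>_def L_def[symmetric] field_simps)
  finally have 1: "integral\<^sup>L ?M (\<lambda>x. W_lambda D m x * (fe w x \<bullet> fe v x)) - integral\<^sup>L ?M (\<lambda>x. cross3 (m x) (fe w x) \<bullet> fe v x)
     \<le> \<Lambda> / 2 * (\<alpha>P * (L2_inner (Dom D) (fe v) (fe v) + L2_inner (Dom D) (fe w) (fe w)))" .
  have "L2_inner (Dom D) (grad (fe w)) (grad (fe v)) \<le>
      integral\<^sup>L ?M (\<lambda>x. (grad (fe v) x \<bullet> grad (fe v) x + grad (fe w) x \<bullet> grad (fe w) x) / 2)"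
    unfolding L2_inner_def
  proof (rule integral_mono)
    show "integrable ?M (\<lambda>x. grad (fe w) x \<bullet> grad (fe v) x)" by (intro ebi ess_bounded_inner gv gw)
    show "integrable ?M (\<lambda>x. (grad (fe v) x \<bullet> grad (fe v) x + grad (fe w) x \<bullet> grad (fe w) x) / 2)"
      by (intro integrable_divide Bochner_Integration.integrable_add ebi ess_bounded_inner gv gw)
    fix x
    have "0 \<le> (grad (fe v) x - grad (fe w) x) \<bullet> (grad (fe v) x - grad (fe w) x)" by simp
    then show "grad (fe w) x \<bullet> grad (fe v) x \<le> (grad (fe v) x \<bullet> grad (fe v) x + grad (fe w) x \<bullet> grad (fe w) x) / 2"
      by (simp add: inner_diff_left inner_diff_right inner_commute)
  qed
  also have "\<dots> = 1 / 2 * (L2_inner (Dom D) (grad (fe v)) (grad (fe v)) + L2_inner (Dom D) (grad (fe w)) (grad (fe w)))"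
    using ebi[OF ess_bounded_inner[OF gv gv]] ebi[OF ess_bounded_inner[OF gw gw]] by (simp add: L2_inner_def)
  \<comment> \<open>For the stiffness part 1/2 suffices; \<open>\<Lambda>\<close> is inserted for a
    factor common with the mass part.\<close>
  also have "\<dots> \<le> \<Lambda> / 2 * (L2_inner (Dom D) (grad (fe v)) (grad (fe v)) + L2_inner (Dom D) (grad (fe w)) (grad (fe w)))"
    using \<Lambda>_ge_1 L2_inner_self_nonneg[of "grad (fe v)"] L2_inner_self_nonneg[of "grad (fe w)"]
    by (intro mult_right_mono) auto
  finally have "\<beta>k * L2_inner (Dom D) (grad (fe w)) (grad (fe v)) \<le>
      \<beta>k * (\<Lambda> / 2 * (L2_inner (Dom D) (grad (fe v)) (grad (fe v)) + L2_inner (Dom D) (grad (fe w)) (grad (fe w))))"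
    using \<beta>k_pos by (intro mult_left_mono) auto
  with 1 show ?thesis unfolding A_form[OF w v] B_form[OF v v] B_form[OF w w] by (simp add: algebra_simps)
qed

text \<open>The hypothesis on \<open>F * C\<close> lets numerical factors move between
  \<open>F\<close> and \<open>C\<close>, so that both parts of the theorem become instances.\<close>

lemma gmres_bound:
  assumes x0: "x0 \<in> carrier_vec (2 * num_nodes D)"
    and x: "\<And>l. gmres_iterate (P_Q D \<alpha>P m) (A_Q D m) (b_Q D m) x0 l (x l)"
    and \<kappa>: "\<kappa> = 1 / mesh_size D \<or> \<kappa> = Linf_norm (Dom D) (grad m)"
    and C: "C \<ge> 4 * C0" "C > 1" and F: "\<Phi> \<kappa> * (4 * C0) \<le> F * C" "F \<ge> 1"
  shows "prec_norm (P_Q D \<alpha>P m) (prec_residual (P_Q D \<alpha>P m) (A_Q D m) (b_Q D m) (x l)) \<le>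
     (1 - inverse C * (alpha D / \<alpha>P)\<^sup>2 * inverse (\<Lambda>\<^sup>2) * inverse F) powr (real l / 2)
     * prec_norm (P_Q D \<alpha>P m) (prec_residual (P_Q D \<alpha>P m) (A_Q D m) (b_Q D m) (x 0))"
proof -
  have b: "b_Q D m \<in> carrier_vec (2 * num_nodes D)"
  proof -
    have "b_vec D m \<in> carrier_vec n" by (simp add: b_vec_def)
    then show ?thesis unfolding b_Q_def by (rule QT_mult_carrier)
  qed
  have P: "P_Q D \<alpha>P m = transpose_mat (Q_mat D m) * mat_inv B_mat * Q_mat D m"
    by (simp add: P_Q_def B_mat_def \<beta>k_def)
  have q: "0 < alpha D / \<alpha>P" "alpha D / \<alpha>P \<le> 1" using alpha_pos alpha_P_pos \<alpha>P_ge by auto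
  define \<delta> where "\<delta> = (alpha D / (2 * \<alpha>P))\<^sup>2 / (\<Lambda>\<^sup>2 * (C0 * \<Phi> \<kappa>))"
  define X where "X = (alpha D / \<alpha>P)\<^sup>2 * inverse (\<Lambda>\<^sup>2)"
  have X: "0 \<le> X" "X \<le> 1"
  proof -
    have "(alpha D / \<alpha>P)\<^sup>2 \<le> 1" using q by (simp add: power_le_one)
    moreover have "inverse (\<Lambda>\<^sup>2) \<le> 1" using \<Lambda>_ge_1 by (simp add: inverse_le_1_iff)
    ultimately show "0 \<le> X" "X \<le> 1" by (auto simp: X_def intro: mult_le_one)
  qed
  have pos: "0 < C0" "0 < \<Phi> \<kappa>" "0 < \<Lambda>" using C0_ge \<Phi>_ge_1[of \<kappa>] \<Lambda>_ge_1 by auto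
  \<comment> \<open>The 4 is the square of the 2 in the coercivity constant.\<close>
  have \<delta>X: "\<delta> = X / (\<Phi> \<kappa> * (4 * C0))"
    by (simp add: \<delta>_def X_def power_divide power_mult_distrib field_simps)
  \<comment> \<open>This keeps the base of \<open>powr\<close> strictly positive.\<close>
  have "X / (\<Phi> \<kappa> * (4 * C0)) < 1"
  proof -
    have "1 * 4 \<le> \<Phi> \<kappa> * (4 * C0)" using C0_ge \<Phi>_ge_1[of \<kappa>] by (intro mult_mono) auto
    then have "X < \<Phi> \<kappa> * (4 * C0)" using X by linarith
    then show ?thesis using pos by simp
  qed
  then have \<delta>1: "\<delta> < 1" using \<delta>X by simp
  define \<theta> where "\<theta> = inverse C * (alpha D / \<alpha>P)\<^sup>2 * inverse (\<Lambda>\<^sup>2) * inverse F"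
  have "\<theta> = X / (F * C)" using C F by (simp add: \<theta>_def X_def divide_inverse)
  also have "\<dots> \<le> X / (\<Phi> \<kappa> * (4 * C0))"
    using F(1) pos X by (intro divide_left_mono mult_pos_pos) (use C F in auto)
  finally have \<theta>: "\<theta> \<le> \<delta>" unfolding \<delta>X .
  show ?thesis
    unfolding \<theta>_def[symmetric] P A_Q_def
  proof (rule constrained_gmres_convergence[OF mat_carriers(5) B_symmetric B_positive mat_carriers(6,7) QT_Q A_coercive A_bounded
        projection_stable[OF _ \<kappa>] _ _ _ _ _ b x0 x[unfolded P A_Q_def]])
    show "0 < alpha D / (2 * \<alpha>P)" "0 < \<Lambda>" "0 < C0 * \<Phi> \<kappa>" using alpha_pos alpha_P_pos pos by auto
    show "\<theta> \<le> (alpha D / (2 * \<alpha>P))\<^sup>2 / (\<Lambda>\<^sup>2 * (C0 * \<Phi> \<kappa>))" "\<theta> < 1" using \<theta> \<delta>1 by (auto simp: \<delta>_def)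
  qed
qed

lemma node_bound_le_2:
  assumes \<gamma>: "\<And>z. z \<in> mesh_nodes (Mesh D) \<Longrightarrow> \<gamma> \<le> 1 + (Tmat D *v m z) $ 3"
  shows "\<gamma> \<le> 2"
proof -
  obtain K where K: "K \<in> Mesh D" using mesh_nonempty by auto
  obtain z where "z extreme_point_of K" using fe_maximum[OF m_fe K] by metis
  then have z: "z \<in> mesh_nodes (Mesh D)" using K by (auto simp: mesh_nodes_def)
  have "(Tmat D *v m z) $ 3 \<le> norm (Tmat D *v m z)" using component_le_norm_cart[of "Tmat D *v m z" 3] by simp
  also have "\<dots> = 1" using m z by (simp add: T_norm M_h_def)
  finally show ?thesis using \<gamma>[OF z] by simp
qed

end

theorem theorem7:
  fixes Cmesh :: real
  shows
    "(\<exists>C>1. \<forall>(D :: llg_data) \<alpha>P m x0 x.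
        llg_setting Cmesh D \<and> \<alpha>P \<ge> alpha D \<and> m \<in> M_h (Dom D) (Mesh D) \<and>
        Lh D m (m_prev D) \<in> L2 (Dom D) \<and>
        x0 \<in> carrier_vec (2 * num_nodes D) \<and>
        (\<forall>l. gmres_iterate (P_Q D \<alpha>P m) (A_Q D m) (b_Q D m) x0 l (x l))
        \<longrightarrow>
        (let k = step_size D;
             r = (\<lambda>l. prec_residual (P_Q D \<alpha>P m) (A_Q D m) (b_Q D m) (x l));
             F = 1 + beta D k * k / (\<alpha>P * (mesh_size D)\<^sup>2)
         in F \<ge> 1 \<and>
            (\<forall>l. prec_norm (P_Q D \<alpha>P m) (r l) \<le>
               (1 - inverse C * (alpha D / \<alpha>P)\<^sup>2
                  * inverse ((1 + 1 / \<alpha>P + Linf_norm (Dom D) (\<lambda>y. W_lambda D m y - \<alpha>P) / \<alpha>P)\<^sup>2)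
                  * inverse F) powr (real l / 2) * prec_norm (P_Q D \<alpha>P m) (r 0))))
     \<and>
     (\<exists>C>1. \<forall>(D :: llg_data) \<alpha>P m x0 x \<gamma>.
        llg_setting Cmesh D \<and> \<alpha>P \<ge> alpha D \<and> m \<in> M_h (Dom D) (Mesh D) \<and>
        Lh D m (m_prev D) \<in> L2 (Dom D) \<and>
        x0 \<in> carrier_vec (2 * num_nodes D) \<and>
        (\<forall>l. gmres_iterate (P_Q D \<alpha>P m) (A_Q D m) (b_Q D m) x0 l (x l)) \<and>
        \<gamma> > 0 \<and> (\<forall>z\<in>mesh_nodes (Mesh D). 1 + (Tmat D *v m z) $ 3 \<ge> \<gamma>)
        \<longrightarrow>
        (let k = step_size D;
             r = (\<lambda>l. prec_residual (P_Q D \<alpha>P m) (A_Q D m) (b_Q D m) (x l));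
             F = 1 + beta D k * k / (\<alpha>P * \<gamma> ^ 4) * (Linf_norm (Dom D) (grad m))\<^sup>2
         in F \<ge> 1 \<and>
            (\<forall>l. prec_norm (P_Q D \<alpha>P m) (r l) \<le>
               (1 - inverse C * (alpha D / \<alpha>P)\<^sup>2
                  * inverse ((1 + 1 / \<alpha>P + Linf_norm (Dom D) (\<lambda>y. W_lambda D m y - \<alpha>P) / \<alpha>P)\<^sup>2)
                  * inverse F) powr (real l / 2) * prec_norm (P_Q D \<alpha>P m) (r 0))))"
proof -
  \<comment> \<open>The constant must exceed 1 for every real \<open>Cmesh\<close>, even one that
    admits no mesh; the maximum takes effect only when \<open>Cmesh < 1\<close>, where no setting
    exists.\<close>
  define c0 where "c0 = 1179648 * max 1 Cmesh ^ 6"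
  have c0: "c0 \<ge> 1" unfolding c0_def using one_le_power[of "max 1 Cmesh" 6] by linarith
  show ?thesis
  proof (rule conjI, goal_cases)
    case 1
    show ?case
    proof (intro exI[of _ "4 * c0"] conjI allI impI, goal_cases)
      case 1
      show ?case using c0 by simp
    next
      case (2 D \<alpha>P m x0 x)
      then interpret llg Cmesh D m \<alpha>P by unfold_locales auto
      have c0': "c0 = 1179648 * Cmesh ^ 6" using c_ge_1 by (simp add: c0_def max_absorb2)
      have F: "\<Phi> (1 / mesh_size D) = 1 + beta D (step_size D) * step_size D / (\<alpha>P * (mesh_size D)\<^sup>2)"
        by (simp add: \<Phi>_def \<beta>k_def power_divide mult.commute)
      show ?case unfolding Let_def F[symmetric] \<Lambda>_def[symmetric]
      proof (intro conjI allI \<Phi>_ge_1)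
        show "prec_norm (P_Q D \<alpha>P m) (prec_residual (P_Q D \<alpha>P m) (A_Q D m) (b_Q D m) (x l)) \<le>
           (1 - inverse (4 * c0) * (alpha D / \<alpha>P)\<^sup>2 * inverse (\<Lambda>\<^sup>2) * inverse (\<Phi> (1 / mesh_size D))) powr (real l / 2)
           * prec_norm (P_Q D \<alpha>P m) (prec_residual (P_Q D \<alpha>P m) (A_Q D m) (b_Q D m) (x 0))" for l
          by (rule gmres_bound[of x0 x "1 / mesh_size D"]) (use 2 c0 \<Phi>_ge_1 in \<open>auto simp flip: c0'\<close>)
      qed
    qed
  next
    case 2
    show ?case
    \<comment> \<open>Here 64 is 4 times 16, and 16 is the largest value of
      \<open>\<gamma> ^ 4\<close> for \<open>\<gamma> \<le> 2\<close>.\<close>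
    proof (intro exI[of _ "64 * c0"] conjI allI impI, goal_cases)
      case 1
      show ?case using c0 by simp
    next
      case (2 D \<alpha>P m x0 x \<gamma>)
      then interpret llg Cmesh D m \<alpha>P by unfold_locales auto
      have c0': "c0 = 1179648 * Cmesh ^ 6" using c_ge_1 by (simp add: c0_def max_absorb2)
      define g where "g = Linf_norm (Dom D) (grad m)"
      define F where "F = 1 + \<beta>k / (\<alpha>P * \<gamma> ^ 4) * g\<^sup>2"
      have \<gamma>: "0 < \<gamma>" "\<gamma> \<le> 2" using 2 node_bound_le_2[of \<gamma>] by auto
      have F1: "1 \<le> F" using \<beta>k_pos alpha_P_pos \<gamma> by (simp add: F_def)
      have "\<gamma> ^ 4 \<le> 2 ^ 4" using \<gamma> by (intro power_mono) auto
      then have "\<beta>k * g\<^sup>2 / \<alpha>P * (\<gamma> ^ 4 / \<gamma> ^ 4) \<le> \<beta>k * g\<^sup>2 / \<alpha>P * (16 / \<gamma> ^ 4)"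
        using \<beta>k_pos alpha_P_pos \<gamma> by (intro mult_left_mono divide_right_mono) auto
      then have "\<Phi> g \<le> 16 * F" using \<gamma> by (simp add: \<Phi>_def F_def mult.commute)
      then have F2: "\<Phi> g * (4 * c0) \<le> F * (64 * c0)" using mult_right_mono[of "\<Phi> g" "16 * F" "4 * c0"] c0 by simp
      show ?case unfolding Let_def g_def[symmetric] \<beta>k_def[symmetric] F_def[symmetric] \<Lambda>_def[symmetric]
      proof (intro conjI allI F1)
        show "prec_norm (P_Q D \<alpha>P m) (prec_residual (P_Q D \<alpha>P m) (A_Q D m) (b_Q D m) (x l)) \<le>
           (1 - inverse (64 * c0) * (alpha D / \<alpha>P)\<^sup>2 * inverse (\<Lambda>\<^sup>2) * inverse F) powr (real l / 2)
           * prec_norm (P_Q D \<alpha>P m) (prec_residual (P_Q D \<alpha>P m) (A_Q D m) (b_Q D m) (x 0))" for l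
          by (rule gmres_bound[of x0 x g]) (use 2 c0 F1 F2 in \<open>auto simp: g_def simp flip: c0'\<close>)
      qed
    qed
  qed
qed

end
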